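(* Let $0<\gamma<1$, let $T\ge R_0^2/\nu$, and suppose that $$\sigma_0< c\,\gamma\,R_0,\qquad c=\frac{1}{\sqrt{C_0K_1K_2}}.$$ Then for every $R$ with $\frac{1}{c\gamma}\,\sigma_0\le R\le R_0$, the ensemble average $\tilde\Psi_{2R,R}$ of the time-averaged enstrophy fluxes into the shells of thickness $R$, determined by an optimal covering $\{A(\mathbf x_i,2R,R)\}_{i=1}^n$ of $B(\mathbf 0,R_0)$, satisfies $$c_{0,\gamma}\left(\frac{R}{R_0}\right)^2\nu\tilde P_0\le\tilde\Psi_{2R,R}\le c_{1,\gamma}\left(\frac{R}{R_0}\right)^2\nu\tilde P_0,$$ where $$c_{0,\gamma}=\frac{1-\gamma^2}{K_1},\qquad c_{1,\gamma}=K_2\left[1+\frac{\gamma^2}{K_1K_2}\right].$$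
   Context: Solution. $\nu>0$; $\Omega\subset\mathbb{R}^2$ is a bounded open connected set; $R_0>0$ is such that $B(\mathbf 0,3R_0)\subset\Omega$. $B(\mathbf x,r)$ and $S(\mathbf x,r)$ are the ball and the sphere (circle) of center $\mathbf x$ and radius $r$ in $\mathbb{R}^2$; $A(\mathbf x,r_1,r_2)$ is the shell between $S(\mathbf x,r_2)$ and $S(\mathbf x,r_1)$, $r_2<r_1$. $(\mathbf u,p)$, $\mathbf u=(u_1,u_2)$, is a smooth solution on $(0,\infty)\times\Omega$ of $\partial_t\mathbf u-\nu\Delta\mathbf u+(\mathbf u\cdot\nabla)\mathbf u+\nabla p=0$, $\nabla\cdot\mathbf u=0$, with no-slip boundary condition $\mathbf u|_{\partial\Omega}=0$. The vorticity is the scalar $\omega=\partial_1u_2-\partial_2u_1$, which satisfies $\partial_t\omega-\nu\Delta\omega+(\mathbf u\cdot\nabla)\omega=0$. Cut-offs. $1/2\le\delta<1$ and $C_0>0$ are fixed constants; $\mathcal D(U)$ denotes the smooth functions with compact support in $U$. Quotients below are understood where the denominator is nonzero, and $\phi^{2\delta-1}$ is read as $0$ where $\phi=0$. - $\psi_0\in\mathcal D(B(\mathbf 0,2R_0))$, $0\le\psi_0\le1$, $\psi_0=1$ on $B(\mathbf 0,R_0)$, $|\nabla\psi_0|/\psi_0^{\delta}\le C_0/R_0$, $|\Delta\psi_0|/\psi_0^{2\delta-1}\le C_0/R_0^2$. - $\eta\in\mathcal D((0,2T))$, $0\le\eta\le1$, $\eta=1$ on $(T/4,5T/4)$, $|\eta'|/\eta^\delta\le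 C_0/T$. - For a shell $A(\mathbf x_i,2R,R)$ with $B(\mathbf x_i,R)\subset B(\mathbf 0,R_0)$: $\psi_i$ is smooth, $0\le\psi_i\le\psi_0$, $\psi_i=1$ on $A(\mathbf x_i,2R,R)\cap B(\mathbf 0,R_0)$, $|\nabla\psi_i|/\psi_i^\delta\le C_0/R$, $|\Delta\psi_i|/\psi_i^{2\delta-1}\le C_0/R^2$. If $A(\mathbf x_i,2R,R)\subset B(\mathbf 0,R_0)$, then $\psi_i\in\mathcal D(A(\mathbf x_i,4R,R/2))$. If $A(\mathbf x_i,2R,R)\not\subset B(\mathbf 0,R_0)$, then $\psi_i\in\mathcal D(B(\mathbf 0,2R_0))$ and additionally: $\psi_i=\psi_0$ on $\{s\mathbf y:\mathbf y\in S(\mathbf 0,R_0)\cap B(\mathbf x_i,2R),\,1\le s\le2\}$; $\psi_i=0$ on $B(\mathbf 0,R_0)\setminus A(\mathbf x_i,4R,R/2)$; and $\psi_i=0$ at those points of $\{R_0\le|\mathbf x|\le2R_0\}$ that do not lie in $\{s\mathbf y:\mathbf y\in S(\mathbf 0,R_0)\cap B(\mathbf x_i,4R),\,1\le s\le2\}$. - $\phi_i(t,\mathbf x)=\eta(t)\psi_i(\mathbf x)$ and $\phi_0(t,\mathbf x)=\eta(t)\psi_0(\mathbf x)$. Optimal shell coverings. $K_1,K_2>1$ are absolute constants. A covering $\{A(\mathbf x_i,2R,R)\}_{i=1}^n$ of $B(\mathbf 0,R_0)$ is optimal if $B(\mathbf x_i,R)\subset B(\mathbf 0,R_0)$ for all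 $i$, $(R_0/R)^2\le n\le K_1(R_0/R)^2$, and every $\mathbf x\in B(\mathbf 0,R_0)$ belongs to at most $K_2$ of the shells $A(\mathbf x_i,4R,R/2)$. Averages (time integrals are over $(0,2T)$). $$\Psi_{\mathbf x_i,2R,R}=\frac1T\iint\tfrac12|\omega|^2\,\mathbf u\cdot\nabla\phi_i\,d\mathbf x\,dt,\qquad\tilde\Psi_{2R,R}=\frac1n\sum_{i=1}^n\Psi_{\mathbf x_i,2R,R},$$ $$\tilde E_0=\frac1T\iint\tfrac12|\omega|^2\phi_0^{2\delta-1}\,d\mathbf x\,dt,\qquad \tilde P_0=\frac1T\iint|\nabla\omega|^2\phi_0\,d\mathbf x\,dt,\qquad \sigma_0=\left(\frac{\tilde E_0}{\tilde P_0}\right)^{1/2}$$ (it is understood that $\tilde P_0>0$). *)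

theory Defs
  imports "HOL-Analysis.Analysis"
begin

text \<open>\<open>smooth_on S f\<close> means \<open>f\<close> is \<open>C\<^sup>\<infinity>\<close> on the set \<open>S\<close>; it is meant for open \<open>S\<close>, since the
  derivatives are two-sided ones.\<close>

primrec Ck_on :: "nat \<Rightarrow> 'a::euclidean_space set \<Rightarrow> ('a \<Rightarrow> 'b::real_normed_vector) \<Rightarrow> bool" where
  "Ck_on 0 S f \<longleftrightarrow> continuous_on S f"
| "Ck_on (Suc k) S f \<longleftrightarrow>
     (\<forall>x\<in>S. f differentiable (at x)) \<and> (\<forall>v. Ck_on k S (\<lambda>x. frechet_derivative f (at x) v))"

definition smooth_on :: "'a::euclidean_space set \<Rightarrow> ('a \<Rightarrow> 'b::real_normed_vector) \<Rightarrow> bool" where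
  "smooth_on S f \<longleftrightarrow> (\<forall>k. Ck_on k S f)"

definition test_function :: "'a::euclidean_space set \<Rightarrow> ('a \<Rightarrow> real) \<Rightarrow> bool" where
  "test_function U f \<longleftrightarrow>
     smooth_on UNIV f \<and> compact (closure {x. f x \<noteq> 0}) \<and> closure {x. f x \<noteq> 0} \<subseteq> U"

definition partial :: "2 \<Rightarrow> (real^2 \<Rightarrow> 'b::real_normed_vector) \<Rightarrow> real^2 \<Rightarrow> 'b" where
  "partial j f x = frechet_derivative f (at x) (axis j 1)"

definition grad :: "(real^2 \<Rightarrow> real) \<Rightarrow> real^2 \<Rightarrow> real^2" where
  "grad f x = (\<chi> j. partial j f x)"

definition laplacian :: "(real^2 \<Rightarrow> 'b::real_normed_vector) \<Rightarrow> real^2 \<Rightarrow> 'b" where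
  "laplacian f x = (\<Sum>j\<in>UNIV. partial j (partial j f) x)"

definition div_op :: "(real^2 \<Rightarrow> real^2) \<Rightarrow> real^2 \<Rightarrow> real" where
  "div_op v x = (\<Sum>j\<in>UNIV. partial j (\<lambda>y. v y $ j) x)"

definition advect :: "real^2 \<Rightarrow> (real^2 \<Rightarrow> real^2) \<Rightarrow> real^2 \<Rightarrow> real^2" where
  "advect a v x = (\<Sum>j\<in>UNIV. a $ j *\<^sub>R partial j v x)"

definition vorticity :: "(real^2 \<Rightarrow> real^2) \<Rightarrow> real^2 \<Rightarrow> real" where
  "vorticity v x = partial 1 (\<lambda>y. v y $ 2) x - partial 2 (\<lambda>y. v y $ 1) x"

text \<open>The no-slip condition is imposed in the classical sense: each \<open>u t\<close> is continuous up to the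
  boundary and vanishes there.\<close>

definition smooth_NSE_solution ::
  "real \<Rightarrow> (real^2) set \<Rightarrow> (real \<Rightarrow> real^2 \<Rightarrow> real^2) \<Rightarrow> (real \<Rightarrow> real^2 \<Rightarrow> real) \<Rightarrow> bool" where
  "smooth_NSE_solution \<nu> \<Omega> u p \<longleftrightarrow>
     smooth_on ({0<..} \<times> \<Omega>) (\<lambda>(t, x). u t x) \<and>
     smooth_on ({0<..} \<times> \<Omega>) (\<lambda>(t, x). p t x) \<and>
     (\<forall>t>0. \<forall>x\<in>\<Omega>.
        vector_derivative (\<lambda>s. u s x) (at t) - \<nu> *\<^sub>R laplacian (u t) x
          + advect (u t x) (u t) x + grad (p t) x = 0 \<and>
        div_op (u t) x = 0) \<and>
     (\<forall>t>0. continuous_on (closure \<Omega>) (u t) \<and> (\<forall>x\<in>frontier \<Omega>. u t x = 0))"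

definition shell :: "'a::metric_space \<Rightarrow> real \<Rightarrow> real \<Rightarrow> 'a set" where
  "shell x r1 r2 = {y. r2 < dist x y \<and> dist x y < r1}"

text \<open>The part of the annulus \<open>R0 \<le> |z| \<le> 2 R0\<close> lying radially above \<open>S(0,R0) \<inter> B(x,r)\<close>.\<close>

definition cone_over :: "real \<Rightarrow> real^2 \<Rightarrow> real \<Rightarrow> (real^2) set" where
  "cone_over R0 x r = {s *\<^sub>R y | s y. y \<in> sphere 0 R0 \<inter> ball x r \<and> 1 \<le> s \<and> s \<le> 2}"

text \<open>In all powers below the base is nonnegative and \<open>0 powr a = 0\<close> for every \<open>a\<close>, so that
  \<open>\<psi> x powr (2*\<delta>-1)\<close> is \<open>0\<close> where \<open>\<psi>\<close> vanishes, also for \<open>\<delta> = 1/2\<close>.\<close>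

definition cutoff_bounds :: "real \<Rightarrow> real \<Rightarrow> real \<Rightarrow> (real^2 \<Rightarrow> real) \<Rightarrow> bool" where
  "cutoff_bounds \<delta> C0 r \<psi> \<longleftrightarrow>
     (\<forall>x. \<psi> x \<noteq> 0 \<longrightarrow>
        norm (grad \<psi> x) / \<psi> x powr \<delta> \<le> C0 / r \<and>
        \<bar>laplacian \<psi> x\<bar> / \<psi> x powr (2 * \<delta> - 1) \<le> C0 / r\<^sup>2)"

definition ball_cutoff :: "real \<Rightarrow> real \<Rightarrow> real \<Rightarrow> (real^2 \<Rightarrow> real) \<Rightarrow> bool" where
  "ball_cutoff \<delta> C0 R0 \<psi>0 \<longleftrightarrow>
     test_function (ball 0 (2 * R0)) \<psi>0 \<and>
     (\<forall>x. 0 \<le> \<psi>0 x \<and> \<psi>0 x \<le> 1) \<and>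
     (\<forall>x\<in>ball 0 R0. \<psi>0 x = 1) \<and>
     cutoff_bounds \<delta> C0 R0 \<psi>0"

definition time_cutoff :: "real \<Rightarrow> real \<Rightarrow> real \<Rightarrow> (real \<Rightarrow> real) \<Rightarrow> bool" where
  "time_cutoff \<delta> C0 T \<eta> \<longleftrightarrow>
     test_function {0<..<2 * T} \<eta> \<and>
     (\<forall>t. 0 \<le> \<eta> t \<and> \<eta> t \<le> 1) \<and>
     (\<forall>t\<in>{T / 4<..<5 * T / 4}. \<eta> t = 1) \<and>
     (\<forall>t. \<eta> t \<noteq> 0 \<longrightarrow> \<bar>deriv \<eta> t\<bar> / \<eta> t powr \<delta> \<le> C0 / T)"

definition shell_cutoff ::
  "real \<Rightarrow> real \<Rightarrow> real \<Rightarrow> (real^2 \<Rightarrow> real) \<Rightarrow> real^2 \<Rightarrow> real \<Rightarrow> (real^2 \<Rightarrow> real) \<Rightarrow> bool" where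
  "shell_cutoff \<delta> C0 R0 \<psi>0 x R \<psi> \<longleftrightarrow>
     smooth_on UNIV \<psi> \<and>
     (\<forall>y. 0 \<le> \<psi> y \<and> \<psi> y \<le> \<psi>0 y) \<and>
     (\<forall>y \<in> shell x (2 * R) R \<inter> ball 0 R0. \<psi> y = 1) \<and>
     cutoff_bounds \<delta> C0 R \<psi> \<and>
     (if shell x (2 * R) R \<subseteq> ball 0 R0
      then test_function (shell x (4 * R) (R / 2)) \<psi>
      else test_function (ball 0 (2 * R0)) \<psi> \<and>
           (\<forall>y \<in> cone_over R0 x (2 * R). \<psi> y = \<psi>0 y) \<and>
           (\<forall>y \<in> ball 0 R0 - shell x (4 * R) (R / 2). \<psi> y = 0) \<and>
           (\<forall>y. R0 \<le> norm y \<and> norm y \<le> 2 * R0 \<and> y \<notin> cone_over R0 x (4 * R) \<longrightarrow> \<psi> y = 0))"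

text \<open>A covering is an indexed family; shells are counted with multiplicity.\<close>

definition optimal_covering :: "real \<Rightarrow> real \<Rightarrow> real \<Rightarrow> real \<Rightarrow> nat \<Rightarrow> (nat \<Rightarrow> real^2) \<Rightarrow> bool" where
  "optimal_covering K1 K2 R0 R n x \<longleftrightarrow>
     ball 0 R0 \<subseteq> (\<Union>i\<in>{1..n}. shell (x i) (2 * R) R) \<and>
     (\<forall>i\<in>{1..n}. ball (x i) R \<subseteq> ball 0 R0) \<and>
     (R0 / R)\<^sup>2 \<le> real n \<and> real n \<le> K1 * (R0 / R)\<^sup>2 \<and>
     (\<forall>y\<in>ball 0 R0. real (card {i \<in> {1..n}. y \<in> shell (x i) (4 * R) (R / 2)}) \<le> K2)"

text \<open>The weights are functions \<open>\<phi> t x\<close> with compact support in \<open>(0,2T) \<times> \<Omega>\<close>, so integrating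
  over \<open>(0,2T) \<times> \<Omega>\<close> is the same as integrating over the whole space.\<close>

definition enstrophy_flux ::
  "real \<Rightarrow> (real^2) set \<Rightarrow> (real \<Rightarrow> real^2 \<Rightarrow> real^2) \<Rightarrow> (real \<Rightarrow> real^2 \<Rightarrow> real) \<Rightarrow> real" where
  "enstrophy_flux T \<Omega> u \<phi> = 1 / T *
     (LINT (t, x):{0<..<2 * T} \<times> \<Omega>|lborel.
        1 / 2 * \<bar>vorticity (u t) x\<bar>\<^sup>2 * (u t x \<bullet> grad (\<phi> t) x))"

definition avg_enstrophy ::
  "real \<Rightarrow> real \<Rightarrow> (real^2) set \<Rightarrow> (real \<Rightarrow> real^2 \<Rightarrow> real^2) \<Rightarrow> (real \<Rightarrow> real^2 \<Rightarrow> real) \<Rightarrow> real" where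
  "avg_enstrophy \<delta> T \<Omega> u \<phi> = 1 / T *
     (LINT (t, x):{0<..<2 * T} \<times> \<Omega>|lborel.
        1 / 2 * \<bar>vorticity (u t) x\<bar>\<^sup>2 * \<phi> t x powr (2 * \<delta> - 1))"

definition avg_palinstrophy ::
  "real \<Rightarrow> (real^2) set \<Rightarrow> (real \<Rightarrow> real^2 \<Rightarrow> real^2) \<Rightarrow> (real \<Rightarrow> real^2 \<Rightarrow> real) \<Rightarrow> real" where
  "avg_palinstrophy T \<Omega> u \<phi> = 1 / T *
     (LINT (t, x):{0<..<2 * T} \<times> \<Omega>|lborel.
        (norm (grad (vorticity (u t)) x))\<^sup>2 * \<phi> t x)"

definition ensemble_flux ::
  "real \<Rightarrow> (real^2) set \<Rightarrow> (real \<Rightarrow> real^2 \<Rightarrow> real^2) \<Rightarrow> (real \<Rightarrow> real) \<Rightarrow> nat \<Rightarrow>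
   (nat \<Rightarrow> real^2 \<Rightarrow> real) \<Rightarrow> real" where
  "ensemble_flux T \<Omega> u \<eta> n \<psi> =
     1 / real n * (\<Sum>i=1..n. enstrophy_flux T \<Omega> u (\<lambda>t x. \<eta> t * \<psi> i x))"

end

theory Submission
  imports Defs "HOL-Real_Asymp.Real_Asymp"
begin

text \<open>Write \<open>w\<close> for the vorticity, \<open>\<Phi>\<close> for the sum of the cut-offs \<open>\<psi> i\<close>, and, for a spatial weight
  \<open>f\<close>, write \<open>P(f)\<close> for the integral of \<open>|\<nabla>w|\<^sup>2 \<eta> f\<close> and \<open>E\<close> for the integral of
  \<open>w\<^sup>2/2 (\<eta> \<psi>0)\<^sup>\<theta>\<close>, where \<open>\<theta> = 2\<delta>-1\<close>. Testing the vorticity equation with \<open>w \<eta> \<Phi>\<close> gives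
  the identity \<open>energy_identity\<close>: the total flux, before averaging over time and over the shells, is
  \<open>\<nu> P(\<Phi>)\<close> minus the integral of
  \<open>w\<^sup>2/2 (\<eta>' \<Phi> + \<nu> \<eta> \<Delta>\<Phi>)\<close>. With \<open>\<mu> = C0/R\<^sup>2\<close>, \<open>\<rho> = (R/R0)\<^sup>2\<close> and \<open>q = n \<rho>\<close>, which lies between
  \<open>1\<close> and \<open>K1\<close>, the theorem follows from

  \<open>\<nu> P(\<psi>0) - q K2 \<nu> \<mu> E \<le> flux \<le> q K2 \<nu> P(\<psi>0) + q K2 \<nu> \<mu> E\<close>

  (\<open>flux_bounds\<close>), because the lower bound on \<open>R\<close> says exactly that \<open>\<mu> E \<le> \<gamma>\<^sup>2 P(\<psi>0) / (K1 K2)\<close>.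

  Both bounds are obtained pointwise under the integral. At most \<open>K2\<close> of the \<open>\<psi> i\<close> are nonzero at
  a given point, and the crude count, \<open>\<mu> \<psi>0\<^sup>\<theta>\<close> for each \<open>\<Delta>\<psi> i\<close> and \<open>\<rho>\<mu>\<close> for the
  time derivative, overshoots \<open>q K2\<close>. Three observations repair it.

  \<^item> The centre of the ball is covered, so \<open>R < R0/2\<close>, \<open>\<rho> < 1/4\<close> and \<open>n \<ge> 5\<close>.

  \<^item> Where \<open>\<psi>0\<close> does not vanish, and off a closed set without interior points, one of the \<open>\<psi> i\<close> coincides with \<open>\<psi>0\<close> near the point
    (\<open>locally_full\<close>): in the ball this is the covering property, in the annulus the radial extension
    of the cut-offs. Its Laplacian costs only \<open>\<rho>\<mu>\<close>. By continuity the resulting bounds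
    hold everywhere (\<open>Phi_bounds\<close>, \<open>laplacian_bounds\<close>). This settles all cases except the one where
    \<open>K2 \<ge> n\<close> and \<open>n\<close> is almost as small as the covering allows, that is \<open>(q-1)(n-1) < \<rho>\<close>.

  \<^item> In that critical case all \<open>n\<close> cut-offs may be active at a point, but then \<open>X = \<Phi> - \<psi>0\<close> and
    \<open>Y = n \<psi>0 - \<Phi>\<close> give room: \<open>P(\<Phi>)\<close> exceeds \<open>P(\<psi>0)\<close> by \<open>P(X)\<close>, and \<open>n P(\<psi>0)\<close> exceeds
    \<open>P(\<Phi>)\<close> by \<open>P(Y)\<close>. This room is traded for part of the Laplacian by adding a small multiple of the
    vanishing integral of the divergence of \<open>\<eta> w\<^sup>2 \<nabla>X\<close> (resp. \<open>\<nabla>Y\<close>) and completing the square, as in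
    Hardy's inequality (\<open>quadratic_form_nonneg\<close>). What is needed is a bound of \<open>|\<nabla>X|\<^sup>2\<close> by \<open>X\<close> times the
    bound of \<open>|\<Delta>X|\<close>: the elementary inequality for a nonnegative function with controlled Laplacian, here
    with explicit constants from Green's identity on circles (\<open>gradient_bound\<close>). The constants are
    good enough to close the argument (\<open>upper_critical\<close>, \<open>lower_critical\<close>), with little to spare
    when \<open>n = 5\<close>.

  Points where \<open>\<psi>0\<close> vanishes do not matter: almost everywhere on that set all first and second
  derivatives involved vanish.\<close>

section \<open>Directional derivatives of smooth functions\<close>

definition ddir :: "'a::real_normed_vector \<Rightarrow> ('a \<Rightarrow> 'b::real_normed_vector) \<Rightarrow> 'a \<Rightarrow> 'b" where
  "ddir v f x = frechet_derivative f (at x) v"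

lemma ddir_eqI: "(f has_derivative f') (at x) \<Longrightarrow> ddir v f x = f' v"
  unfolding ddir_def by (metis frechet_derivative_at)

lemma has_derivative_ddir: "f differentiable (at x) \<Longrightarrow> (f has_derivative (\<lambda>v. ddir v f x)) (at x)"
  unfolding ddir_def by (simp add: frechet_derivative_works)

lemma smooth_on_differentiable: "smooth_on S f \<Longrightarrow> x \<in> S \<Longrightarrow> f differentiable (at x)"
  unfolding smooth_on_def by (metis Ck_on.simps(2))

lemma smooth_on_ddir: "smooth_on S f \<Longrightarrow> smooth_on S (ddir v f)"
  unfolding smooth_on_def ddir_def[abs_def] by (metis Ck_on.simps(2))

lemma smooth_on_continuous: "smooth_on S f \<Longrightarrow> continuous_on S f"
  unfolding smooth_on_def by (metis Ck_on.simps(1))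

lemma smooth_on_subset: "smooth_on S f \<Longrightarrow> T \<subseteq> S \<Longrightarrow> smooth_on T f"
proof -
  have "Ck_on k S f \<Longrightarrow> T \<subseteq> S \<Longrightarrow> Ck_on k T f" for k
    by (induction k arbitrary: f) (auto intro: continuous_on_subset)
  then show "smooth_on S f \<Longrightarrow> T \<subseteq> S \<Longrightarrow> smooth_on T f"
    unfolding smooth_on_def by blast
qed

lemma ddir_add_dir: "f differentiable (at x) \<Longrightarrow> ddir (v + w) f x = ddir v f x + ddir w f x"
  using linear_frechet_derivative[of f "at x"] by (simp add: ddir_def linear_add)

lemma ddir_scaleR_dir: "f differentiable (at x) \<Longrightarrow> ddir (c *\<^sub>R v) f x = c *\<^sub>R ddir v f x"
  using linear_frechet_derivative[of f "at x"] by (simp add: ddir_def linear_scale)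

lemma ddir_cong:
  assumes "open S" "x \<in> S" "\<And>y. y \<in> S \<Longrightarrow> f y = g y"
  shows "ddir v f x = ddir v g x"
proof -
  have "(f has_derivative D) (at x) \<longleftrightarrow> (g has_derivative D) (at x)" for D
    using assms has_derivative_transform_within_open[of f D x UNIV S g]
      has_derivative_transform_within_open[of g D x UNIV S f] by auto
  then show ?thesis by (simp add: ddir_def frechet_derivative_def)
qed

lemma differentiable_cong_open:
  assumes "open S" "x \<in> S" "\<And>y. y \<in> S \<Longrightarrow> f y = g y" "f differentiable (at x)"
  shows "g differentiable (at x)"
  using assms has_derivative_transform_within_open[of f _ x UNIV S g]
  unfolding differentiable_def by blast

lemma ddir_add:
  "f differentiable (at x) \<Longrightarrow> g differentiable (at x) \<Longrightarrow>
    ddir v (\<lambda>y. f y + g y) x = ddir v f x + ddir v g x"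
  by (rule ddir_eqI[OF has_derivative_add[OF has_derivative_ddir has_derivative_ddir]])

lemma ddir_diff:
  "f differentiable (at x) \<Longrightarrow> g differentiable (at x) \<Longrightarrow>
    ddir v (\<lambda>y. f y - g y) x = ddir v f x - ddir v g x"
  by (rule ddir_eqI[OF has_derivative_diff[OF has_derivative_ddir has_derivative_ddir]])

lemma ddir_linear:
  "bounded_linear L \<Longrightarrow> f differentiable (at x) \<Longrightarrow> ddir v (\<lambda>y. L (f y)) x = L (ddir v f x)"
  by (rule ddir_eqI[OF bounded_linear.has_derivative[OF _ has_derivative_ddir]])

lemma ddir_cmult:
  fixes f :: "'a::real_normed_vector \<Rightarrow> real"
  shows "f differentiable (at x) \<Longrightarrow> ddir v (\<lambda>y. c * f y) x = c * ddir v f x"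
  by (rule ddir_linear[OF bounded_linear_mult_right])

lemma ddir_mult:
  fixes f g :: "'a::real_normed_vector \<Rightarrow> real"
  shows "f differentiable (at x) \<Longrightarrow> g differentiable (at x) \<Longrightarrow>
    ddir v (\<lambda>y. f y * g y) x = f x * ddir v g x + ddir v f x * g x"
  by (rule ddir_eqI[OF has_derivative_mult[OF has_derivative_ddir has_derivative_ddir]])

lemma ddir_const: "ddir v (\<lambda>_. c) x = 0"
  by (rule ddir_eqI) (rule has_derivative_const)

lemma ddir_sum:
  assumes "\<And>i. i \<in> I \<Longrightarrow> f i differentiable (at x)"
  shows "ddir v (\<lambda>y. \<Sum>i\<in>I. f i y) x = (\<Sum>i\<in>I. ddir v (f i) x)"
  by (rule ddir_eqI[OF has_derivative_sum[OF has_derivative_ddir[OF assms]]])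

lemma Ck_on_cong:
  assumes "open S" shows "(\<And>y. y \<in> S \<Longrightarrow> f y = g y) \<Longrightarrow> Ck_on k S f \<Longrightarrow> Ck_on k S g"
proof (induction k arbitrary: f g)
  case 0
  then show ?case using continuous_on_cong[of S S f g] by auto
next
  case (Suc k)
  have "ddir v f y = ddir v g y" if "y \<in> S" for v y
    using ddir_cong[OF assms that, of f g v] Suc.prems(1) by auto
  then have "Ck_on k S (\<lambda>x. frechet_derivative g (at x) v)" for v
    using Suc.IH[of "\<lambda>x. frechet_derivative f (at x) v" "\<lambda>x. frechet_derivative g (at x) v"] Suc.prems(2)
    by (simp add: ddir_def)
  moreover have "\<forall>x\<in>S. g differentiable (at x)"
    by (metis differentiable_cong_open[OF assms] Suc.prems Ck_on.simps(2))
  ultimately show ?case by simp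
qed

lemma Ck_on_linear:
  assumes "open S" "bounded_linear L" shows "Ck_on k S f \<Longrightarrow> Ck_on k S (\<lambda>x. L (f x))"
proof (induction k arbitrary: f)
  case 0
  then show ?case using assms(2) by (simp add: bounded_linear.continuous_on)
next
  case (Suc k)
  have "Ck_on k S (ddir v (\<lambda>x. L (f x)))" for v
    by (rule Ck_on_cong[OF assms(1) _ Suc.IH[of "ddir v f"]])
       (use Suc.prems in \<open>auto simp: ddir_linear[OF assms(2)]  simp flip: ddir_def\<close>)
  moreover have "\<forall>x\<in>S. (\<lambda>x. L (f x)) differentiable (at x)"
    using Suc.prems by (auto intro!: differentiable_compose[OF bounded_linear_imp_differentiable[OF assms(2)]])
  ultimately show ?case by (simp add: ddir_def[abs_def])
qed

lemma Ck_on_add: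
  assumes "open S" shows "Ck_on k S f \<Longrightarrow> Ck_on k S g \<Longrightarrow> Ck_on k S (\<lambda>x. f x + g x)"
proof (induction k arbitrary: f g)
  case 0
  then show ?case by (simp add: continuous_on_add)
next
  case (Suc k)
  have "Ck_on k S (ddir v (\<lambda>x. f x + g x))" for v
    by (rule Ck_on_cong[OF assms(1) _ Suc.IH[of "ddir v f" "ddir v g"]])
       (use Suc.prems in \<open>auto simp: ddir_add ddir_def[abs_def] ddir_add[unfolded ddir_def]\<close>)
  then show ?case using Suc.prems by (auto simp: ddir_def[abs_def])
qed

lemma smooth_on_linear: "open S \<Longrightarrow> bounded_linear L \<Longrightarrow> smooth_on S f \<Longrightarrow> smooth_on S (\<lambda>x. L (f x))"
  unfolding smooth_on_def using Ck_on_linear by blast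

lemma smooth_on_add: "open S \<Longrightarrow> smooth_on S f \<Longrightarrow> smooth_on S g \<Longrightarrow> smooth_on S (\<lambda>x. f x + g x)"
  unfolding smooth_on_def using Ck_on_add by blast

lemma smooth_on_cmult:
  fixes f :: "_ \<Rightarrow> real"
  shows "open S \<Longrightarrow> smooth_on S f \<Longrightarrow> smooth_on S (\<lambda>x. c * f x)"
  by (rule smooth_on_linear[OF _ bounded_linear_mult_right])

lemma smooth_on_diff:
  fixes f :: "_ \<Rightarrow> real"
  assumes "open S" "smooth_on S f" "smooth_on S g" shows "smooth_on S (\<lambda>x. f x - g x)"
  using smooth_on_add[OF assms(1,2) smooth_on_cmult[OF assms(1,3), of "-1"]] by simp

lemma smooth_on_zero: "smooth_on S (\<lambda>_. 0)"
proof -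
  have "Ck_on k S (\<lambda>_. 0)" for k
    by (induction k) (auto simp: ddir_const[unfolded ddir_def])
  then show ?thesis unfolding smooth_on_def by blast
qed

lemma smooth_on_sum:
  assumes "open S" "finite I" "\<And>i. i \<in> I \<Longrightarrow> smooth_on S (f i)"
  shows "smooth_on S (\<lambda>x. \<Sum>i\<in>I. f i x)"
  using assms(2,3) by (induction I) (auto intro: smooth_on_add smooth_on_zero assms(1))

lemma has_derivative_line:
  fixes f :: "'a::real_normed_vector \<Rightarrow> real"
  assumes "f differentiable (at (a + s *\<^sub>R v))"
  shows "((\<lambda>s. f (a + s *\<^sub>R v)) has_real_derivative ddir v f (a + s *\<^sub>R v)) (at s)"
proof -
  have "((\<lambda>s. f (a + s *\<^sub>R v)) has_derivative (\<lambda>h. ddir (h *\<^sub>R v) f (a + s *\<^sub>R v))) (at s)"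
  proof (rule has_derivative_compose[where f = "\<lambda>s. a + s *\<^sub>R v" and g = f])
    show "((\<lambda>s. a + s *\<^sub>R v) has_derivative (\<lambda>h. h *\<^sub>R v)) (at s)"
      by (auto intro!: derivative_eq_intros)
  qed (rule has_derivative_ddir[OF assms])
  then show ?thesis
    unfolding has_field_derivative_def
    by (rule has_derivative_eq_rhs) (auto simp: ddir_scaleR_dir[OF assms] mult.commute)
qed

text \<open>The second difference quotient is symmetric in the two directions; applied once in each order of
  the directions, this gives the symmetry of second derivatives.\<close>

lemma mixed_difference_mvt:
  fixes f :: "'a::real_normed_vector \<Rightarrow> real"
  assumes f: "\<And>y. y \<in> ball x r \<Longrightarrow> f differentiable (at y)"
    and fv: "\<And>y. y \<in> ball x r \<Longrightarrow> ddir v f differentiable (at y)"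
    and h: "0 < h" "h * (norm v + norm w) < r"
  shows "\<exists>p\<in>ball x r. f (x + h *\<^sub>R v + h *\<^sub>R w) - f (x + h *\<^sub>R v) - f (x + h *\<^sub>R w) + f x
           = h * h * ddir w (ddir v f) p"
proof -
  have inb: "x + a *\<^sub>R v + b *\<^sub>R w \<in> ball x r" if "0 \<le> a" "a \<le> h" "0 \<le> b" "b \<le> h" for a b
  proof -
    have "norm (a *\<^sub>R v + b *\<^sub>R w) \<le> a * norm v + b * norm w"
      using that by (metis abs_of_nonneg norm_scaleR norm_triangle_ineq)
    also have "\<dots> \<le> h * (norm v + norm w)"
      using that by (simp add: distrib_left add_mono mult_right_mono)
    finally have "norm ((x + a *\<^sub>R v + b *\<^sub>R w) - x) < r"
      using h by (simp add: add.assoc)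
    then show ?thesis by (simp only: mem_ball dist_norm norm_minus_commute)
  qed
  have "\<exists>s. 0 < s \<and> s < h \<and>
     (f (x + h *\<^sub>R w + h *\<^sub>R v) - f (x + h *\<^sub>R v)) - (f (x + h *\<^sub>R w + 0 *\<^sub>R v) - f (x + 0 *\<^sub>R v))
       = (h - 0) * (ddir v f (x + h *\<^sub>R w + s *\<^sub>R v) - ddir v f (x + s *\<^sub>R v))"
  proof (rule MVT2[OF h(1), of "\<lambda>s. f (x + h *\<^sub>R w + s *\<^sub>R v) - f (x + s *\<^sub>R v)"])
    fix s assume s: "0 \<le> s" "s \<le> h"
    have "x + h *\<^sub>R w + s *\<^sub>R v \<in> ball x r" "x + s *\<^sub>R v \<in> ball x r"
      using inb[of s h] inb[of s 0] s h by (simp_all add: algebra_simps)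
    then show "((\<lambda>s. f (x + h *\<^sub>R w + s *\<^sub>R v) - f (x + s *\<^sub>R v)) has_real_derivative
        ddir v f (x + h *\<^sub>R w + s *\<^sub>R v) - ddir v f (x + s *\<^sub>R v)) (at s)"
      by (intro DERIV_diff has_derivative_line f)
  qed
  then obtain s where s: "0 < s" "s < h" and e1:
     "f (x + h *\<^sub>R w + h *\<^sub>R v) - f (x + h *\<^sub>R v) - (f (x + h *\<^sub>R w) - f x)
       = h * (ddir v f (x + h *\<^sub>R w + s *\<^sub>R v) - ddir v f (x + s *\<^sub>R v))" by auto
  have "\<exists>t. 0 < t \<and> t < h \<and>
     ddir v f (x + s *\<^sub>R v + h *\<^sub>R w) - ddir v f (x + s *\<^sub>R v + 0 *\<^sub>R w)
       = (h - 0) * ddir w (ddir v f) (x + s *\<^sub>R v + t *\<^sub>R w)"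
  proof (rule MVT2[OF h(1), of "\<lambda>t. ddir v f (x + s *\<^sub>R v + t *\<^sub>R w)"])
    fix t assume t: "0 \<le> t" "t \<le> h"
    show "((\<lambda>t. ddir v f (x + s *\<^sub>R v + t *\<^sub>R w)) has_real_derivative
        ddir w (ddir v f) (x + s *\<^sub>R v + t *\<^sub>R w)) (at t)"
      using inb[of s t] s t by (intro has_derivative_line fv) simp
  qed
  then obtain t where t: "0 < t" "t < h" and e2:
     "ddir v f (x + s *\<^sub>R v + h *\<^sub>R w) - ddir v f (x + s *\<^sub>R v) = h * ddir w (ddir v f) (x + s *\<^sub>R v + t *\<^sub>R w)"
    by auto
  have "x + s *\<^sub>R v + t *\<^sub>R w \<in> ball x r" using inb[of s t] s t by simp
  then show ?thesis using e1 e2 by (intro bexI) (simp_all add: algebra_simps)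
qed

lemma ddir_commute:
  fixes f :: "'a::real_normed_vector \<Rightarrow> real"
  assumes S: "open S" "x \<in> S"
    and f: "\<And>y. y \<in> S \<Longrightarrow> f differentiable (at y)"
    and fv: "\<And>y. y \<in> S \<Longrightarrow> ddir v f differentiable (at y)"
    and fw: "\<And>y. y \<in> S \<Longrightarrow> ddir w f differentiable (at y)"
    and c1: "continuous_on S (ddir w (ddir v f))"
    and c2: "continuous_on S (ddir v (ddir w f))"
  shows "ddir w (ddir v f) x = ddir v (ddir w f) x"
proof -
  let ?F = "ddir w (ddir v f)" and ?G = "ddir v (ddir w f)"
  have cx: "isCont ?F x" "isCont ?G x"
    using c1 c2 S by (auto simp: continuous_on_eq_continuous_at)
  have "\<bar>?F x - ?G x\<bar> \<le> 0 + e" if "e > 0" for e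
  proof -
    have "\<forall>\<^sub>F y in nhds x. dist (?F y) (?F x) < e / 2 \<and> dist (?G y) (?G x) < e / 2 \<and> y \<in> S"
      using cx that S tendstoD[of ?F "?F x" "nhds x" "e/2"] tendstoD[of ?G "?G x" "nhds x" "e/2"]
      unfolding isCont_def tendsto_at_iff_tendsto_nhds
      by (auto intro!: eventually_conj eventually_nhds_in_open)
    then obtain r where r: "r > 0" "\<And>y. y \<in> ball x r \<Longrightarrow>
        dist (?F y) (?F x) < e / 2 \<and> dist (?G y) (?G x) < e / 2 \<and> y \<in> S"
      unfolding eventually_nhds_metric by (auto simp: dist_commute)
    define c where "c = norm v + norm w + 1"
    define h where "h = r / (2 * c)"
    have pos: "c > 0" by (simp add: c_def add_nonneg_pos)
    have h: "0 < h" "h * (norm v + norm w) < r"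
    proof -
      show "0 < h" using r pos by (simp add: h_def)
      have "h * (norm v + norm w) \<le> h * c"
        using \<open>0 < h\<close> by (simp add: distrib_left c_def)
      also have "\<dots> = r / 2" using pos by (simp add: h_def)
      finally show "h * (norm v + norm w) < r" using r by simp
    qed
    obtain p where p: "p \<in> ball x r"
      "f (x + h *\<^sub>R v + h *\<^sub>R w) - f (x + h *\<^sub>R v) - f (x + h *\<^sub>R w) + f x = h * h * ?F p"
      using mixed_difference_mvt[of x r f v h w] f fv r h by blast
    obtain q where q: "q \<in> ball x r"
      "f (x + h *\<^sub>R w + h *\<^sub>R v) - f (x + h *\<^sub>R w) - f (x + h *\<^sub>R v) + f x = h * h * ?G q"
      using mixed_difference_mvt[of x r f w h v] f fw r h by (auto simp: add.commute)
    have "h * h * ?F p = h * h * ?G q" using p q by (simp add: algebra_simps)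
    then have "?F p = ?G q" using h by simp
    then show ?thesis using r(2)[OF p(1)] r(2)[OF q(1)] unfolding dist_real_def by linarith
  qed
  then have "\<bar>?F x - ?G x\<bar> \<le> 0" by (rule field_le_epsilon)
  then show ?thesis by simp
qed

lemma smooth_ddir_commute:
  fixes f :: "'a::euclidean_space \<Rightarrow> real"
  assumes "open S" "x \<in> S" "smooth_on S f"
  shows "ddir w (ddir v f) x = ddir v (ddir w f) x"
  using assms by (intro ddir_commute[of S])
    (auto intro: smooth_on_differentiable smooth_on_continuous smooth_on_ddir)

section \<open>Integrals of derivatives and zero sets\<close>

lemma integrable_continuous_compact_support:
  fixes f :: "'a::euclidean_space \<Rightarrow> real"
  assumes "compact K" "continuous_on UNIV f" "\<And>x. x \<notin> K \<Longrightarrow> f x = 0"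
  shows "integrable lborel f"
proof -
  have "integrable lborel (\<lambda>x. indicator K x *\<^sub>R f x)"
    using assms by (intro borel_integrable_compact) (auto intro: continuous_on_subset)
  moreover have "(\<lambda>x. indicator K x *\<^sub>R f x) = f"
    using assms(3) by (auto simp: fun_eq_iff indicator_def)
  ultimately show ?thesis by simp
qed

lemma ddir_zero_outside:
  assumes "closed K" "\<And>y. y \<notin> K \<Longrightarrow> F y = 0" "x \<notin> K"
  shows "ddir v F x = 0"
  using ddir_cong[of "- K" x F "\<lambda>_. 0" v] assms by (auto simp: ddir_const)

lemma integral_translate:
  fixes f :: "'a::euclidean_space \<Rightarrow> real"
  assumes [measurable]: "f \<in> borel_measurable borel"
  shows "(\<integral>x. f (c + x) \<partial>lborel) = (\<integral>x. f x \<partial>lborel)"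
proof -
  have "(\<integral>x. f x \<partial>distr lborel borel ((+) c)) = (\<integral>x. f (c + x) \<partial>lborel)"
    by (rule integral_distr) auto
  then show ?thesis by (simp add: lborel_distr_plus)
qed

lemma integrable_translate:
  fixes f :: "'a::euclidean_space \<Rightarrow> real"
  assumes "integrable lborel f"
  shows "integrable lborel (\<lambda>x. f (c + x))"
proof -
  have "integrable (distr lborel borel ((+) c)) f" using assms by (simp add: lborel_distr_plus)
  then show ?thesis by (subst (asm) integrable_distr_eq) (use assms in auto)
qed

text \<open>Translating a compactly supported function does not change its integral; differentiate
  this at translation \<open>0\<close> under the integral sign.\<close>

lemma integral_ddir_eq_0:
  fixes F :: "'a::euclidean_space \<Rightarrow> real"
  assumes K: "compact K" "\<And>x. x \<notin> K \<Longrightarrow> F x = 0"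
    and F: "\<And>x. F differentiable (at x)" and c: "continuous_on UNIV (ddir v F)"
  shows "integrable lborel (ddir v F) \<and> (\<integral>x. ddir v F x \<partial>lborel) = 0"
proof -
  have out: "ddir v F x = 0" if "x \<notin> K" for x
    using ddir_zero_outside[of K F x v] K that compact_imp_closed by auto
  have cF: "continuous_on UNIV F"
    using F by (simp add: continuous_at_imp_continuous_on differentiable_imp_continuous_within)
  have intF: "integrable lborel F" by (rule integrable_continuous_compact_support[OF K(1) cF K(2)])
  have intD: "integrable lborel (ddir v F)"
    by (rule integrable_continuous_compact_support[OF K(1) c out])
  have [measurable]: "F \<in> borel_measurable borel"
    using cF by (rule borel_measurable_continuous_onI)
  obtain B where B: "\<And>x. \<bar>ddir v F x\<bar> \<le> B" and "B \<ge> 0"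
  proof -
    have "bounded (ddir v F ` K)"
      using c K(1) by (intro compact_imp_bounded compact_continuous_image) (auto intro: continuous_on_subset)
    then obtain B where "\<And>x. x \<in> K \<Longrightarrow> \<bar>ddir v F x\<bar> \<le> B" "B > 0"
      unfolding bounded_pos by auto
    then show ?thesis using out by (intro that[of B]) (metis abs_zero less_imp_le, simp)
  qed
  obtain r where r: "K \<subseteq> cball 0 r"
    using bounded_subset_ballD[OF compact_imp_bounded[OF K(1)], of 0] ball_subset_cball by blast
  define h where "h n = inverse (real (Suc n))" for n
  have h: "h n > 0" "h n \<le> 1" for n by (auto simp: h_def field_simps)
  define s where "s n x = (F (h n *\<^sub>R v + x) - F x) / h n" for n x
  have lim: "(\<lambda>n. s n x) \<longlonglongrightarrow> ddir v F x" for x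
  proof -
    have "((\<lambda>t. F (x + t *\<^sub>R v)) has_real_derivative ddir v F (x + 0 *\<^sub>R v)) (at 0)"
      by (rule has_derivative_line) (simp add: F)
    then have "((\<lambda>t. (F (x + t *\<^sub>R v) - F x) / t) \<longlongrightarrow> ddir v F x) (at 0)"
      by (simp add: has_field_derivative_iff)
    moreover have "filterlim h (at 0) sequentially"
      unfolding filterlim_at h_def using LIMSEQ_inverse_real_of_nat by (auto simp: eventually_sequentially)
    ultimately have "(\<lambda>n. (F (x + h n *\<^sub>R v) - F x) / h n) \<longlonglongrightarrow> ddir v F x"
      by (rule filterlim_compose)
    then show ?thesis by (simp add: s_def add.commute)
  qed
  have bnd: "\<bar>s n x\<bar> \<le> B * indicator (cball 0 (r + norm v)) x" for n x
  proof (cases "x \<in> cball 0 (r + norm v)")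
    case True
    have "\<exists>z. 0 < z \<and> z < h n \<and> F (x + h n *\<^sub>R v) - F (x + 0 *\<^sub>R v) = (h n - 0) * ddir v F (x + z *\<^sub>R v)"
      by (rule MVT2[OF h(1)]) (rule has_derivative_line[OF F])
    then obtain z where "F (x + h n *\<^sub>R v) - F x = h n * ddir v F (x + z *\<^sub>R v)" by auto
    then have "s n x = ddir v F (x + z *\<^sub>R v)" using h(1)[of n] by (simp add: s_def add.commute)
    then show ?thesis using B True by simp
  next
    case False
    have "norm x > r + norm v" using False by simp
    moreover have "norm (h n *\<^sub>R v) \<le> norm v" using h[of n] by (simp add: mult_left_le_one_le)
    moreover have "norm x \<le> norm (h n *\<^sub>R v + x) + norm (h n *\<^sub>R v)"
      by (metis add_diff_cancel_left' norm_triangle_ineq4 add.commute)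
    ultimately have "norm (h n *\<^sub>R v + x) > r" by linarith
    moreover have "norm x > r" using \<open>norm x > r + norm v\<close> norm_ge_zero[of v] by linarith
    ultimately have "x \<notin> K" "h n *\<^sub>R v + x \<notin> K"
      using r by (auto simp: subset_iff)
    then show ?thesis using K(2) False by (simp add: s_def)
  qed
  have "(\<lambda>n. \<integral>x. s n x \<partial>lborel) \<longlonglongrightarrow> (\<integral>x. ddir v F x \<partial>lborel)"
  proof (rule integral_dominated_convergence[where w = "\<lambda>x. B * indicator (cball 0 (r + norm v)) x"])
    show "integrable lborel (\<lambda>x. B * indicator (cball 0 (r + norm v)) (x::'a))"
      using borel_integrable_compact[of "cball 0 (r + norm v)" "\<lambda>_::'a. B"] by (simp add: mult.commute)
    show "ddir v F \<in> borel_measurable lborel" using intD by auto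
    show "s n \<in> borel_measurable lborel" for n unfolding s_def[abs_def] by measurable
    show "AE x in lborel. (\<lambda>n. s n x) \<longlonglongrightarrow> ddir v F x" using lim by simp
    show "AE x in lborel. norm (s n x) \<le> B * indicator (cball 0 (r + norm v)) x" for n
      using bnd by simp
  qed
  moreover have "(\<integral>x. s n x \<partial>lborel) = 0" for n
    unfolding s_def using intF integrable_translate[OF intF, of "h n *\<^sub>R v"]
    by (simp add: integral_translate[of F "h n *\<^sub>R v"] Bochner_Integration.integral_diff)
  ultimately have "(\<integral>x. ddir v F x \<partial>lborel) = 0" by (simp add: LIMSEQ_const_iff)
  then show ?thesis using intD by simp
qed

text \<open>The version for functions defined on an open set: extension by zero is smooth because the support
  stays away from the boundary.\<close>

lemma integral_ddir_eq_0_on: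
  fixes F :: "'a::euclidean_space \<Rightarrow> real"
  assumes U: "open U" "K \<subseteq> U" and K: "compact K" "\<And>x. x \<notin> K \<Longrightarrow> F x = 0"
    and F: "\<And>x. x \<in> U \<Longrightarrow> F differentiable (at x)" and c: "continuous_on U (ddir v F)"
  shows "integrable lborel (ddir v F) \<and> (\<integral>x. ddir v F x \<partial>lborel) = 0"
proof (rule integral_ddir_eq_0[OF K])
  have oK: "open (- K)" using K(1) compact_imp_closed by blast
  show "F differentiable (at x)" for x
  proof (cases "x \<in> K")
    case True then show ?thesis using U F by blast
  next
    case False
    then show ?thesis
      using differentiable_cong_open[OF oK, of x "\<lambda>_. 0" F] K(2) by auto
  qed
  have "continuous_on (- K) (ddir v F)"
    using ddir_zero_outside[of K F _ v] K compact_imp_closed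
    by (subst continuous_on_cong[where g = "\<lambda>_. 0"]) auto
  then have "continuous_on (U \<union> - K) (ddir v F)"
    using c U(1) oK by (intro continuous_on_open_Un) auto
  then show "continuous_on UNIV (ddir v F)"
    using U(2) by (metis Compl_subset_Compl_iff Un_commute compl_sup_top sup.orderE sup_assoc sup_compl_top_left1 top.extremum_unique sup.absorb_iff1)
qed

text \<open>On a line in direction \<open>v\<close>, zeros with nonvanishing derivative are isolated, hence countable, so
  such a line carries no mass; translating along the line and exchanging the order of integration
  shows that the whole exceptional set is null.\<close>

lemma AE_ddir_zero_on_zeros:
  fixes f :: "'a::euclidean_space \<Rightarrow> real"
  assumes f: "\<And>x. f differentiable (at x)" and c: "continuous_on UNIV (ddir v f)"
  shows "AE x in lborel. f x = 0 \<longrightarrow> ddir v f x = 0"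
proof -
  define B where "B = {x. f x = 0 \<and> ddir v f x \<noteq> 0}"
  have cf: "continuous_on UNIV f"
    using f by (simp add: continuous_at_imp_continuous_on differentiable_imp_continuous_within)
  have [measurable]: "f \<in> borel_measurable borel" "ddir v f \<in> borel_measurable borel"
    using cf c by (auto intro: borel_measurable_continuous_onI)
  have Bm[measurable]: "B \<in> sets borel" unfolding B_def by measurable
  have cnt: "countable {t::real. x + t *\<^sub>R v \<in> B}" for x
  proof -
    define g where "g t = f (x + t *\<^sub>R v)" for t
    define g' where "g' t = ddir v f (x + t *\<^sub>R v)" for t
    have g: "(g has_real_derivative g' t) (at t)" for t
      unfolding g_def g'_def by (rule has_derivative_line[OF f])
    have cg: "continuous_on UNIV g'" unfolding g'_def
      by (rule continuous_on_compose2[OF c]) (auto intro!: continuous_intros)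
    define D where "D = {t. g' t \<noteq> 0}"
    have D: "open D" unfolding D_def using cg by (rule open_Collect_neq) auto
    have nl: "\<not> t islimpt {t. g t = 0}" if "t \<in> D" for t
    proof
      assume l: "t islimpt {t. g t = 0}"
      have "continuous_on UNIV g" using g by (meson DERIV_continuous_on)
      then have "closed {t. g t = 0}" by (intro closed_Collect_eq) auto
      then have "g t = 0" using l unfolding closed_limpt by auto
      then have "((\<lambda>s. g s / (s - t)) \<longlongrightarrow> g' t) (at t)"
        using g[of t] by (simp add: has_field_derivative_iff)
      then have "\<forall>\<^sub>F s in at t. g s / (s - t) \<noteq> 0"
        using that unfolding D_def by (intro tendsto_imp_eventually_ne) auto
      then have "\<forall>\<^sub>F s in at t. g s \<noteq> 0" by eventually_elim auto
      then show False using l unfolding islimpt_conv_frequently_at frequently_def by auto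
    qed
    have "{t. g t = 0} sparse_in D" unfolding sparse_in_def using D nl by blast
    then have "countable (D \<inter> {t. g t = 0})" by (rule sparse_imp_countable[OF D])
    moreover have "{t. x + t *\<^sub>R v \<in> B} = D \<inter> {t. g t = 0}"
      by (auto simp: B_def D_def g_def g'_def)
    ultimately show ?thesis by simp
  qed
  have tr: "(\<integral>\<^sup>+x. indicator B (x + t *\<^sub>R v) \<partial>lborel) = emeasure lborel B" for t :: real
  proof -
    have "emeasure lborel B = (\<integral>\<^sup>+x. indicator B x \<partial>distr lborel borel ((+) (t *\<^sub>R v)))"
      by (simp add: lborel_distr_plus)
    also have "\<dots> = (\<integral>\<^sup>+x. indicator B (t *\<^sub>R v + x) \<partial>lborel)"
      by (rule nn_integral_distr) auto
    finally show ?thesis by (simp add: add.commute)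
  qed
  have "emeasure lborel B = (\<integral>\<^sup>+t. indicator {0..1::real} t * emeasure lborel B \<partial>lborel)"
    by (simp add: nn_integral_multc)
  also have "\<dots> = (\<integral>\<^sup>+t. (\<integral>\<^sup>+x. indicator {0..1} t * indicator B (x + t *\<^sub>R v) \<partial>lborel) \<partial>lborel)"
    by (simp add: nn_integral_cmult tr)
  also have "\<dots> = (\<integral>\<^sup>+x. (\<integral>\<^sup>+t. indicator {0..1} t * indicator B (x + t *\<^sub>R v) \<partial>lborel) \<partial>lborel)"
    by (rule lborel_pair.Fubini') (simp add: case_prod_unfold)
  also have "\<dots> = (\<integral>\<^sup>+(x::'a). 0 \<partial>lborel)"
  proof (rule nn_integral_cong)
    fix x :: 'a
    have "AE t in lborel. t \<notin> {t::real. x + t *\<^sub>R v \<in> B}"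
      using cnt[of x] by (intro AE_not_in) (auto simp: null_sets_def countable_imp_null_set_lborel
        dest: countable_imp_null_set_lborel)
    then have "(\<integral>\<^sup>+t. indicator {0..1} t * indicator B (x + t *\<^sub>R v) \<partial>lborel) = (\<integral>\<^sup>+(t::real). 0 \<partial>lborel)"
      by (intro nn_integral_cong_AE) (auto simp: indicator_def elim!: eventually_mono)
    then show "(\<integral>\<^sup>+t. indicator {0..1} t * indicator B (x + t *\<^sub>R v) \<partial>lborel) = 0" by simp
  qed
  finally have "B \<in> null_sets lborel" by (auto simp: null_sets_def)
  then show ?thesis by (rule AE_I') (auto simp: B_def)
qed

section \<open>Green's identity on circles\<close>

lemma partial_eq_ddir: "partial j f = ddir (axis j 1) f"
  by (simp add: partial_def ddir_def fun_eq_iff)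

lemma laplacian_eq_ddir:
  "laplacian f x = ddir (axis 1 1) (ddir (axis 1 1) f) x + ddir (axis 2 1) (ddir (axis 2 1) f) x"
  by (simp add: laplacian_def partial_eq_ddir sum_2)

lemma ddir_coordinates:
  fixes f :: "real^2 \<Rightarrow> real"
  assumes "f differentiable (at x)"
  shows "ddir w f x = w $ 1 * ddir (axis 1 1) f x + w $ 2 * ddir (axis 2 1) f x"
proof -
  have "w = w $ 1 *\<^sub>R axis 1 1 + w $ 2 *\<^sub>R axis 2 1"
    by (simp add: vec_eq_iff forall_2 axis_def)
  then have "ddir w f x = ddir (w $ 1 *\<^sub>R axis 1 1 + w $ 2 *\<^sub>R axis 2 1) f x" by simp
  then show ?thesis by (simp add: ddir_add_dir[OF assms] ddir_scaleR_dir[OF assms])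
qed

lemma norm_real2: "(norm (x::real^2))\<^sup>2 = (x$1)\<^sup>2 + (x$2)\<^sup>2"
  by (simp add: norm_vec_def L2_set_def sum_2)

definition rot :: "real^2 \<Rightarrow> real^2" where "rot e = vector [- e $ 2, e $ 1]"

lemma rot_nth [simp]: "rot e $ 1 = - e $ 2" "rot e $ 2 = e $ 1"
  by (simp_all add: rot_def)

context
  fixes v :: "real^2 \<Rightarrow> real"
  assumes v: "smooth_on UNIV v"
begin

lemma v_diff: "v differentiable (at x)" "ddir w v differentiable (at x)"
    "ddir w' (ddir w v) differentiable (at x)"
  using v smooth_on_differentiable smooth_on_ddir by (metis UNIV_I)+

lemma v_cont: "continuous_on A v" "continuous_on A (ddir w v)" "continuous_on A (ddir w' (ddir w v))"
  using v by (meson smooth_on_continuous smooth_on_ddir continuous_on_subset subset_UNIV)+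

lemma ddir_ddir_coordinates:
  "ddir w (ddir w' v) x = w' $ 1 * ddir w (ddir (axis 1 1) v) x + w' $ 2 * ddir w (ddir (axis 2 1) v) x"
proof -
  have "ddir w' v = (\<lambda>x. w' $ 1 * ddir (axis 1 1) v x + w' $ 2 * ddir (axis 2 1) v x)"
    using ddir_coordinates v_diff(1) by blast
  then show ?thesis by (simp add: ddir_add ddir_cmult v_diff)
qed

lemma laplacian_orthonormal:
  assumes "norm n = 1"
  shows "laplacian v x = ddir n (ddir n v) x + ddir (rot n) (ddir (rot n) v) x"
proof -
  let ?a = "axis 1 1 :: real^2" and ?b = "axis 2 1 :: real^2"
  have sq: "(n$1)\<^sup>2 + (n$2)\<^sup>2 = 1" using norm_real2[of n] assms by simp
  have sym: "ddir ?b (ddir ?a v) x = ddir ?a (ddir ?b v) x"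
    by (rule smooth_ddir_commute[of UNIV]) (auto simp: v)
  have e: "ddir w (ddir w v) x = (w$1)\<^sup>2 * ddir ?a (ddir ?a v) x
      + 2 * (w$1 * w$2) * ddir ?a (ddir ?b v) x + (w$2)\<^sup>2 * ddir ?b (ddir ?b v) x" for w
    by (simp add: ddir_ddir_coordinates[of w w] ddir_coordinates[of "ddir ?a v" x w]
        ddir_coordinates[of "ddir ?b v" x w] v_diff sym algebra_simps power2_eq_square)
  have "ddir n (ddir n v) x + ddir (rot n) (ddir (rot n) v) x
     = ((n$1)\<^sup>2 + (n$2)\<^sup>2) * (ddir ?a (ddir ?a v) x + ddir ?b (ddir ?b v) x)"
    unfolding e[of n] e[of "rot n"] by (simp add: algebra_simps)
  then show ?thesis by (simp add: sq laplacian_eq_ddir)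
qed

end

definition unit_at :: "real^2 \<Rightarrow> real \<Rightarrow> real^2" where
  "unit_at e \<theta> = cos \<theta> *\<^sub>R e + sin \<theta> *\<^sub>R rot e"

lemma norm_unit_at: "norm (unit_at e \<theta>) = norm e"
proof -
  have *: "(c * a - s * b)\<^sup>2 + (c * b + s * a)\<^sup>2 = (c\<^sup>2 + s\<^sup>2) * (a\<^sup>2 + b\<^sup>2)" for a b c s :: real
    by algebra
  have "(norm (unit_at e \<theta>))\<^sup>2 = (norm e)\<^sup>2"
    using *[of "cos \<theta>" "e $ 1" "sin \<theta>" "e $ 2"] by (simp add: norm_real2 unit_at_def)
  then show ?thesis by simp
qed

lemma rot_unit_at: "rot (unit_at e \<theta>) = (- sin \<theta>) *\<^sub>R e + cos \<theta> *\<^sub>R rot e"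
  by (simp add: unit_at_def vec_eq_iff forall_2)

lemma has_derivative_angle:
  fixes f :: "real^2 \<Rightarrow> real"
  assumes "f differentiable (at (z + t *\<^sub>R unit_at e \<theta>))"
  shows "((\<lambda>\<theta>. f (z + t *\<^sub>R unit_at e \<theta>)) has_real_derivative
      t * ddir (rot (unit_at e \<theta>)) f (z + t *\<^sub>R unit_at e \<theta>)) (at \<theta>)"
proof -
  have "((\<lambda>\<theta>. f (z + t *\<^sub>R unit_at e \<theta>)) has_derivative
      (\<lambda>h. ddir (h *\<^sub>R (t *\<^sub>R rot (unit_at e \<theta>))) f (z + t *\<^sub>R unit_at e \<theta>))) (at \<theta>)"
  proof (rule has_derivative_compose[where f = "\<lambda>\<theta>. z + t *\<^sub>R unit_at e \<theta>" and g = f])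
    show "((\<lambda>\<theta>. z + t *\<^sub>R unit_at e \<theta>) has_derivative (\<lambda>h. h *\<^sub>R (t *\<^sub>R rot (unit_at e \<theta>)))) (at \<theta>)"
      unfolding unit_at_def rot_unit_at[unfolded unit_at_def]
      by (auto intro!: derivative_eq_intros simp: fun_eq_iff algebra_simps)
  qed (rule has_derivative_ddir[OF assms])
  then show ?thesis
    unfolding has_field_derivative_def
    by (rule has_derivative_eq_rhs) (auto simp: ddir_scaleR_dir[OF assms] mult.commute mult.left_commute)
qed

lemma has_integral_antiderivative:
  fixes F f :: "real \<Rightarrow> real"
  assumes "a \<le> b" "\<And>x. (F has_real_derivative f x) (at x)"
  shows "(f has_integral (F b - F a)) {a..b}"
  by (rule fundamental_theorem_of_calculus[OF assms(1)])
     (metis assms(2) has_field_derivative_at_within has_real_derivative_iff_has_vector_derivative)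

lemma has_integral_cos_2pi: "((\<lambda>\<theta>. cos \<theta>) has_integral 0) {0..2*pi}"
  using has_integral_antiderivative[of 0 "2*pi" sin cos] by (simp add: DERIV_sin)

lemma has_integral_cos_squared_2pi: "((\<lambda>\<theta>. (cos \<theta>)\<^sup>2) has_integral pi) {0..2*pi}"
proof -
  have "((\<lambda>x. x/2 + sin x * cos x/2) has_real_derivative
      1/2 + (cos x * cos x + - sin x * sin x)/2) (at x)" for x :: real
    by (intro DERIV_add DERIV_cdivide DERIV_mult DERIV_sin DERIV_cos DERIV_ident)
  moreover have "1/2 + (cos x * cos x + - sin x * sin x)/2 = (cos x)\<^sup>2" for x :: real
    using sin_cos_squared_add[of x] by (simp add: power2_eq_square add_divide_distrib diff_divide_distrib)
  ultimately have "((\<lambda>x. x/2 + sin x * cos x/2) has_real_derivative (cos x)\<^sup>2) (at x)" for x :: real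
    by (metis (no_types, lifting))
  from has_integral_antiderivative[OF _ this, of 0 "2*pi"] show ?thesis by simp
qed

lemma has_integral_sin_cos_2pi: "((\<lambda>\<theta>. sin \<theta> * cos \<theta>) has_integral 0) {0..2*pi}"
proof -
  have "((\<lambda>x. sin x * sin x/2) has_real_derivative (cos x * sin x + cos x * sin x)/2) (at x)" for x :: real
    by (intro DERIV_add DERIV_cdivide DERIV_mult DERIV_sin)
  then have "((\<lambda>x. sin x * sin x/2) has_real_derivative (sin x * cos x)) (at x)" for x :: real
    by (simp add: mult.commute)
  from has_integral_antiderivative[OF _ this, of 0 "2*pi"] show ?thesis by simp
qed

text \<open>Green's identity on the annulus between the circles of radius \<open>t\<close> and \<open>r\<close> about \<open>z\<close>, with
  the kernel \<open>ln (r/t) - \<kappa>/2 (r/t - t/r) cos \<theta>\<close>, which is harmonic and vanishes on the outer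
  circle. The angle \<open>\<theta>\<close> is measured from the unit vector \<open>e\<close>, so the dipole term detects the derivative of
  \<open>v\<close> at \<open>z\<close> in direction \<open>e\<close>.\<close>

context
  fixes v :: "real^2 \<Rightarrow> real" and e z :: "real^2" and r \<kappa> :: real
  assumes v: "smooth_on UNIV v" and e: "norm e = 1" and r: "r > 0"
begin

text \<open>The boundary term of Green's identity on the circle of radius \<open>t\<close>: the normal derivative of \<open>v\<close>
  times the kernel minus \<open>v\<close> times the normal derivative of the kernel, multiplied by \<open>t\<close> from the
  arc length.\<close>

definition green_flux :: "real \<Rightarrow> real" where
  "green_flux t = integral {0..2*pi} (\<lambda>\<theta>.
     ddir (unit_at e \<theta>) v (z + t *\<^sub>R unit_at e \<theta>) * (t * ln (r/t) - \<kappa> * ((r\<^sup>2 - t\<^sup>2)/(2*r)) * cos \<theta>)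
     - v (z + t *\<^sub>R unit_at e \<theta>) * (- 1 + \<kappa> * ((r\<^sup>2 + t\<^sup>2)/(2*r*t)) * cos \<theta>))"

lemma continuous_unit_at [continuous_intros]:
  fixes f :: "'c::real_normed_vector \<Rightarrow> real"
  shows "continuous_on A f \<Longrightarrow> continuous_on A (\<lambda>x. unit_at e (f x))"
  unfolding unit_at_def by (auto intro!: continuous_intros)

lemma continuous_polar:
  fixes f g :: "'c::real_normed_vector \<Rightarrow> real"
  assumes "continuous_on UNIV h" "continuous_on A f" "continuous_on A g"
  shows "continuous_on A (\<lambda>x. h (z + f x *\<^sub>R unit_at e (g x)))"
  by (rule continuous_on_compose2[OF assms(1)]) (intro continuous_intros assms, auto)

lemma ddir_unit_at:
  assumes "\<And>x. f differentiable (at x)"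
  shows "ddir (unit_at e \<theta>) f x = cos \<theta> * ddir e f x + sin \<theta> * ddir (rot e) f x"
    and "ddir (rot (unit_at e \<theta>)) f x = - sin \<theta> * ddir e f x + cos \<theta> * ddir (rot e) f x"
  unfolding rot_unit_at unfolding unit_at_def
  by (simp_all only: ddir_add_dir[OF assms] ddir_scaleR_dir[OF assms] real_scaleR_def)

text \<open>Differentiating under the integral, everything except the Laplacian cancels because the kernel is
  harmonic: the tangential second derivative of \<open>v\<close> is integrated by parts over the circle.\<close>

lemma green_flux_deriv:
  assumes t: "t > 0"
  shows "(green_flux has_real_derivative
     integral {0..2*pi} (\<lambda>\<theta>. (t * ln (r/t) - \<kappa> * ((r\<^sup>2 - t\<^sup>2)/(2*r)) * cos \<theta>)
        * laplacian v (z + t *\<^sub>R unit_at e \<theta>))) (at t)"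
proof -
  note vd = v_diff[OF v]
  note vc = v_cont[OF v, of UNIV]
  let ?n = "\<lambda>\<theta>. unit_at e \<theta>"
  let ?x = "\<lambda>t \<theta>. z + t *\<^sub>R unit_at e \<theta>"
  define P where "P t \<theta> = ddir (?n \<theta>) v (?x t \<theta>)" for t \<theta>
  define Q where "Q t \<theta> = ddir (rot (?n \<theta>)) v (?x t \<theta>)" for t \<theta>
  define N where "N t \<theta> = ddir (?n \<theta>) (ddir (?n \<theta>) v) (?x t \<theta>)" for t \<theta>
  define T where "T t \<theta> = ddir (rot (?n \<theta>)) (ddir (rot (?n \<theta>)) v) (?x t \<theta>)" for t \<theta>
  define V where "V t \<theta> = v (?x t \<theta>)" for t \<theta>
  define A where "A t = t * ln (r/t)" for t
  define B where "B t = (r\<^sup>2 - t\<^sup>2)/(2*r)" for t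
  define C where "C t = (r\<^sup>2 + t\<^sup>2)/(2*r*t)" for t
  have P_eq: "P t \<theta> = cos \<theta> * ddir e v (?x t \<theta>) + sin \<theta> * ddir (rot e) v (?x t \<theta>)" for t \<theta>
    unfolding P_def by (rule ddir_unit_at(1)[OF vd(1)])
  have Q_eq: "Q t \<theta> = - sin \<theta> * ddir e v (?x t \<theta>) + cos \<theta> * ddir (rot e) v (?x t \<theta>)" for t \<theta>
    unfolding Q_def by (rule ddir_unit_at(2)[OF vd(1)])
  have dd: "ddir w (\<lambda>x. a * ddir e v x + b * ddir (rot e) v x) x
      = a * ddir w (ddir e v) x + b * ddir w (ddir (rot e) v) x" for w a b x
    by (simp add: ddir_add ddir_cmult vd)
  have ddn: "ddir w (ddir (?n \<theta>) v) x = cos \<theta> * ddir w (ddir e v) x + sin \<theta> * ddir w (ddir (rot e) v) x" for w \<theta> x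
  proof -
    have "ddir (?n \<theta>) v = (\<lambda>x. cos \<theta> * ddir e v x + sin \<theta> * ddir (rot e) v x)"
      using ddir_unit_at(1)[OF vd(1)] by blast
    then show ?thesis by (simp only: dd)
  qed
  have ddr: "ddir w (ddir (rot (?n \<theta>)) v) x = - sin \<theta> * ddir w (ddir e v) x + cos \<theta> * ddir w (ddir (rot e) v) x" for w \<theta> x
  proof -
    have "ddir (rot (?n \<theta>)) v = (\<lambda>x. (- sin \<theta>) * ddir e v x + cos \<theta> * ddir (rot e) v x)"
      using ddir_unit_at(2)[OF vd(1)] by blast
    then show ?thesis by (simp only: dd)
  qed
  have lap: "laplacian v (?x t \<theta>) = N t \<theta> + T t \<theta>" for t \<theta>
    unfolding N_def T_def by (rule laplacian_orthonormal[OF v]) (simp add: norm_unit_at e)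
  have dV: "((\<lambda>t. V t \<theta>) has_real_derivative P t \<theta>) (at t)" for t \<theta>
    unfolding V_def P_def by (rule has_derivative_line[OF vd(1)])
  have dP: "((\<lambda>t. P t \<theta>) has_real_derivative N t \<theta>) (at t)" for t \<theta>
    unfolding P_def N_def by (rule has_derivative_line[OF vd(2)])
  have dV\<theta>: "((\<lambda>\<theta>. V t \<theta>) has_real_derivative t * Q t \<theta>) (at \<theta>)" for t \<theta>
    unfolding V_def Q_def by (rule has_derivative_angle[OF vd(1)])
  have dQ\<theta>: "((\<lambda>\<theta>. Q t \<theta>) has_real_derivative - P t \<theta> + t * T t \<theta>) (at \<theta>)" for t \<theta>
  proof -
    let ?a = "\<lambda>\<theta>. ddir e v (?x t \<theta>)" and ?b = "\<lambda>\<theta>. ddir (rot e) v (?x t \<theta>)"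
    have a: "(?a has_real_derivative t * ddir (rot (?n \<theta>)) (ddir e v) (?x t \<theta>)) (at \<theta>)"
      by (rule has_derivative_angle[OF vd(2)])
    have b: "(?b has_real_derivative t * ddir (rot (?n \<theta>)) (ddir (rot e) v) (?x t \<theta>)) (at \<theta>)"
      by (rule has_derivative_angle[OF vd(2)])
    have "((\<lambda>\<theta>. (- sin \<theta>) * ?a \<theta> + cos \<theta> * ?b \<theta>) has_real_derivative
       ((- cos \<theta>) * ?a \<theta> + (t * ddir (rot (?n \<theta>)) (ddir e v) (?x t \<theta>)) * (- sin \<theta>))
       + ((- sin \<theta>) * ?b \<theta> + (t * ddir (rot (?n \<theta>)) (ddir (rot e) v) (?x t \<theta>)) * cos \<theta>)) (at \<theta>)"
      by (intro DERIV_add DERIV_mult DERIV_minus DERIV_sin DERIV_cos a b)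
    moreover have "(- cos \<theta>) * ?a \<theta> + (t * ddir (rot (?n \<theta>)) (ddir e v) (?x t \<theta>)) * (- sin \<theta>)
       + ((- sin \<theta>) * ?b \<theta> + (t * ddir (rot (?n \<theta>)) (ddir (rot e) v) (?x t \<theta>)) * cos \<theta>)
       = - P t \<theta> + t * T t \<theta>"
      by (simp add: T_def ddr P_eq algebra_simps)
    ultimately show ?thesis by (simp add: Q_eq[abs_def])
  qed
  define j where "j t \<theta> = P t \<theta> * (A t - \<kappa> * B t * cos \<theta>) - V t \<theta> * (- 1 + \<kappa> * C t * cos \<theta>)" for t \<theta>
  define j' where "j' t \<theta> = N t \<theta> * (A t - \<kappa> * B t * cos \<theta>) + P t \<theta> * (ln (r/t) - \<kappa> * (B t / t) * cos \<theta>)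
     + V t \<theta> * \<kappa> * (B t / t\<^sup>2) * cos \<theta>" for t \<theta>
  have dA: "(A has_real_derivative ln (r/t) - 1) (at t)" if "t > 0" for t
    unfolding A_def[abs_def] using that r
    by (auto intro!: derivative_eq_intros simp: field_simps power2_eq_square)
  have dB: "(B has_real_derivative - t / r) (at t)" for t
    unfolding B_def[abs_def] using r by (auto intro!: derivative_eq_intros simp: field_simps)
  have dC: "(C has_real_derivative - B t / t\<^sup>2) (at t)" if "t > 0" for t
    unfolding C_def[abs_def] B_def using that r
    by (auto intro!: derivative_eq_intros simp: field_simps power2_eq_square)
  have CB: "C t = t / r + B t / t" if "t > 0" for t
    unfolding C_def B_def using that r by (simp add: field_simps power2_eq_square)
  have dj: "((\<lambda>t. j t \<theta>) has_real_derivative j' t \<theta>) (at t)" if "t > 0" for t \<theta>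
  proof -
    have "((\<lambda>t. j t \<theta>) has_real_derivative
       (N t \<theta> * (A t - \<kappa> * B t * cos \<theta>) + ((ln (r/t) - 1) - \<kappa> * (- t/r) * cos \<theta>) * P t \<theta>)
       - (P t \<theta> * (- 1 + \<kappa> * C t * cos \<theta>) + (0 + \<kappa> * (- B t / t\<^sup>2) * cos \<theta>) * V t \<theta>)) (at t)"
      unfolding j_def
      by (intro DERIV_diff DERIV_add DERIV_mult DERIV_cmult DERIV_cmult_right DERIV_const dP dV dA dB dC that)
    then show ?thesis
      by (rule DERIV_cong) (simp add: j'_def CB[OF that] algebra_simps)
  qed
  have gf: "green_flux = (\<lambda>t. integral (cbox 0 (2*pi)) (j t))"
    by (intro ext) (simp add: green_flux_def j_def[abs_def] P_def V_def A_def B_def C_def)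
  have cs: "continuous_on A' (\<lambda>p::real\<times>real. cos (snd p))" "continuous_on A' (\<lambda>p::real\<times>real. sin (snd p))" for A'
    by (auto intro!: continuous_intros)
  have cpol: "continuous_on A' (\<lambda>p. h (z + fst p *\<^sub>R unit_at e (snd p)))" if "continuous_on UNIV h" for A' and h :: "real^2 \<Rightarrow> real"
    by (rule continuous_polar[OF that]) (auto intro!: continuous_intros)
  note cp = cpol[OF vc(1)] cpol[OF vc(2)] cpol[OF vc(3)]
  have contP: "continuous_on A' (\<lambda>p. P (fst p) (snd p))" for A'
    unfolding P_eq by (intro continuous_on_add continuous_on_mult cs cp)
  have contV: "continuous_on A' (\<lambda>p. V (fst p) (snd p))" for A'
    unfolding V_def by (rule cp)
  have contN: "continuous_on A' (\<lambda>p. N (fst p) (snd p))" for A'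
    unfolding N_def ddn ddir_unit_at(1)[OF vd(2)] by (intro continuous_on_add continuous_on_mult cs cp)
  have ct: "continuous_on ({0<..} \<times> cbox 0 (2*pi)) (\<lambda>p::real\<times>real. A (fst p))"
      "continuous_on ({0<..} \<times> cbox 0 (2*pi)) (\<lambda>p::real\<times>real. B (fst p))"
      "continuous_on ({0<..} \<times> cbox 0 (2*pi)) (\<lambda>p::real\<times>real. B (fst p) / fst p)"
      "continuous_on ({0<..} \<times> cbox 0 (2*pi)) (\<lambda>p::real\<times>real. B (fst p) / (fst p)\<^sup>2)"
      "continuous_on ({0<..} \<times> cbox 0 (2*pi)) (\<lambda>p::real\<times>real. ln (r / fst p))"
    unfolding A_def B_def using r by (auto intro!: continuous_intros)
  have contj': "continuous_on ({0<..} \<times> cbox 0 (2*pi)) (\<lambda>(t, \<theta>). j' t \<theta>)"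
    unfolding j'_def case_prod_beta
    by (intro continuous_on_add continuous_on_diff continuous_on_mult continuous_on_const cs ct contP contV contN)
  have sec: "continuous_on (cbox 0 (2*pi)) (\<lambda>\<theta>. h (t, \<theta>))" if "continuous_on UNIV h" for h :: "real \<times> real \<Rightarrow> real" and t
    by (rule continuous_on_compose2[OF that]) (auto intro!: continuous_intros)
  have contj: "continuous_on (cbox 0 (2*pi)) (j t)" for t
    unfolding j_def[abs_def] using sec[OF contP[of UNIV], of t] sec[OF contV[of UNIV], of t]
    by (auto intro!: continuous_on_diff continuous_on_mult continuous_on_const continuous_on_add continuous_on_cos continuous_on_id)
  have "(green_flux has_vector_derivative integral (cbox 0 (2*pi)) (j' t)) (at t within {0<..})"
    unfolding gf
  proof (rule leibniz_rule_vector_derivative[OF _ _ contj'])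
    show "((\<lambda>x. j x \<theta>) has_vector_derivative j' x \<theta>) (at x within {0<..})" if "x \<in> {0<..}" for x \<theta>
      using dj[of x \<theta>] that
      by (simp add: has_real_derivative_iff_has_vector_derivative[symmetric] has_field_derivative_at_within)
    show "j x integrable_on cbox 0 (2*pi)" for x by (rule integrable_continuous[OF contj])
  qed (use t in auto)
  then have main: "(green_flux has_real_derivative integral {0..2*pi} (j' t)) (at t)"
    using t at_within_open[of t "{0<..}"]
    by (simp add: has_real_derivative_iff_has_vector_derivative)
  text \<open>The angular part is a total derivative of a periodic function.\<close>
  define w where "w \<theta> = Q t \<theta> * (A t - \<kappa> * B t * cos \<theta>) - V t \<theta> * (\<kappa> * (B t / t) * sin \<theta>)" for \<theta>
  have dw: "(w has_real_derivative
      (- P t \<theta> + t * T t \<theta>) * (A t - \<kappa> * B t * cos \<theta>) - V t \<theta> * (\<kappa> * (B t / t) * cos \<theta>)) (at \<theta>)" for \<theta>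
  proof -
    have "((\<lambda>\<theta>. Q t \<theta> * (A t - \<kappa> * B t * cos \<theta>) - V t \<theta> * (\<kappa> * (B t / t) * sin \<theta>)) has_real_derivative
       ((- P t \<theta> + t * T t \<theta>) * (A t - \<kappa> * B t * cos \<theta>) + (0 - \<kappa> * B t * (- sin \<theta>)) * Q t \<theta>)
       - ((t * Q t \<theta>) * (\<kappa> * (B t / t) * sin \<theta>) + (\<kappa> * (B t / t) * cos \<theta>) * V t \<theta>)) (at \<theta>)"
      by (intro DERIV_diff DERIV_mult DERIV_cmult DERIV_const DERIV_sin DERIV_cos dV\<theta> dQ\<theta>)
    then show ?thesis
      unfolding w_def[abs_def] by (rule DERIV_cong) (use t in \<open>simp add: field_simps\<close>)
  qed
  have "w (2*pi) = w 0"
    by (simp add: w_def Q_def V_def unit_at_def)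
  then have w0: "((\<lambda>\<theta>. (- P t \<theta> + t * T t \<theta>) * (A t - \<kappa> * B t * cos \<theta>) - V t \<theta> * (\<kappa> * (B t / t) * cos \<theta>))
      has_integral 0) {0..2*pi}"
    using has_integral_antiderivative[OF _ dw, of 0 "2*pi"] by simp
  have "continuous_on (cbox 0 (2*pi)) (\<lambda>\<theta>. case (t, \<theta>) of (t, \<theta>) \<Rightarrow> j' t \<theta>)"
    by (rule continuous_on_compose2[OF contj']) (use t in \<open>auto intro!: continuous_intros\<close>)
  then have int: "j' t integrable_on {0..2*pi}"
    using integrable_continuous[of 0 "2*pi" "j' t"] by simp
  have eq: "j' t \<theta> + ((- P t \<theta> + t * T t \<theta>) * (A t - \<kappa> * B t * cos \<theta>) - V t \<theta> * (\<kappa> * (B t / t) * cos \<theta>)) / t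
     = (A t - \<kappa> * B t * cos \<theta>) * laplacian v (?x t \<theta>)" for \<theta>
  proof -
    define L where "L = ln (r/t)"
    have "A t = t * L" by (simp add: A_def L_def)
    then show ?thesis unfolding j'_def lap L_def[symmetric] using t
      by (simp add: divide_simps) (simp add: algebra_simps power2_eq_square)
  qed
  have "((\<lambda>\<theta>. (A t - \<kappa> * B t * cos \<theta>) * laplacian v (?x t \<theta>)) has_integral
      (integral {0..2*pi} (j' t) + 0 / t)) {0..2*pi}"
    using has_integral_add[OF integrable_integral[OF int] has_integral_divide[OF w0, of t]]
    unfolding eq .
  then have "integral {0..2*pi} (\<lambda>\<theta>. (A t - \<kappa> * B t * cos \<theta>) * laplacian v (?x t \<theta>)) = integral {0..2*pi} (j' t) + 0 / t"
    by (rule integral_unique)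
  then have I: "integral {0..2*pi} (j' t) = integral {0..2*pi} (\<lambda>\<theta>. (A t - \<kappa> * B t * cos \<theta>) * laplacian v (?x t \<theta>))"
    unfolding div_0 add_0_right by (rule sym)
  show ?thesis using main unfolding I unfolding A_def B_def .
qed

text \<open>As the circle shrinks, the logarithm contributes the value at the centre and the dipole \<open>1/t\<close>
  contributes the derivative there; its singularity cancels because \<open>cos\<close> has mean zero.\<close>

lemma green_flux_tendsto_0:
  "(green_flux \<longlongrightarrow> 2 * pi * v z - \<kappa> * pi * r * ddir e v z) (at_right 0)"
proof -
  note vd = v_diff[OF v]
  note vc = v_cont[OF v, of UNIV]
  let ?x = "\<lambda>t \<theta>. z + t *\<^sub>R unit_at e \<theta>"
  define a where "a = (\<lambda>x. ddir e v x)"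
  define b where "b = (\<lambda>x. ddir (rot e) v x)"
  define P where "P t \<theta> = ddir (unit_at e \<theta>) v (?x t \<theta>)" for t \<theta>
  define P0 where "P0 \<theta> = cos \<theta> * a z + sin \<theta> * b z" for \<theta>
  have P_eq: "P t \<theta> = cos \<theta> * a (?x t \<theta>) + sin \<theta> * b (?x t \<theta>)" for t \<theta>
    unfolding P_def a_def b_def by (rule ddir_unit_at(1)[OF vd(1)])
  define G where "G = \<bar>a z\<bar> + \<bar>b z\<bar>"
  have trig: "\<bar>cos \<theta> * x + sin \<theta> * y\<bar> \<le> \<bar>x\<bar> + \<bar>y\<bar>" for \<theta> x y :: real
  proof -
    have "\<bar>cos \<theta> * x\<bar> \<le> 1 * \<bar>x\<bar>" "\<bar>sin \<theta> * y\<bar> \<le> 1 * \<bar>y\<bar>"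
      unfolding abs_mult by (intro mult_right_mono; simp)+
    then show ?thesis by linarith
  qed
  have absm: "\<bar>k * x\<bar> \<le> k * y" if "0 \<le> k" "\<bar>x\<bar> \<le> y" for k x y :: real
    using that by (simp add: abs_mult mult_left_mono)
  have absum: "\<bar>x\<bar> \<le> y" if "x = a - b + c - d" "\<bar>a\<bar> \<le> A" "\<bar>b\<bar> \<le> B" "\<bar>d\<bar> \<le> D" "\<bar>c\<bar> \<le> C" "y = A + B + D + C"
    for a b c d A B C D x y :: real
    using that by linarith
  have P0G: "\<bar>P0 \<theta>\<bar> \<le> G" for \<theta> unfolding P0_def G_def by (rule trig)
  have Pclose: "\<exists>d>0. \<forall>t \<theta>. 0 \<le> t \<longrightarrow> t < d \<longrightarrow> \<bar>P t \<theta> - P0 \<theta>\<bar> \<le> h" if "h > 0" for h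
  proof -
    have "isCont a z" "isCont b z"
      using vc(2) unfolding a_def b_def by (simp_all add: continuous_on_eq_continuous_at)
    then have "\<exists>d>0. \<forall>y. dist y z < d \<longrightarrow> \<bar>a y - a z\<bar> < h/2"
        "\<exists>d>0. \<forall>y. dist y z < d \<longrightarrow> \<bar>b y - b z\<bar> < h/2"
      using that unfolding continuous_at_eps_delta dist_real_def by (meson half_gt_zero)+
    then obtain d1 d2 where d: "d1 > 0" "d2 > 0" "\<And>y. dist y z < d1 \<Longrightarrow> \<bar>a y - a z\<bar> < h/2"
        "\<And>y. dist y z < d2 \<Longrightarrow> \<bar>b y - b z\<bar> < h/2" by blast
    show ?thesis
    proof (intro exI[of _ "min d1 d2"] conjI allI impI)
      fix t \<theta> :: real assume t: "0 \<le> t" "t < min d1 d2"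
      have "dist (?x t \<theta>) z = t" using t e by (simp add: dist_norm norm_unit_at)
      then have "\<bar>a (?x t \<theta>) - a z\<bar> < h/2" "\<bar>b (?x t \<theta>) - b z\<bar> < h/2" using d t by auto
      moreover have "\<bar>P t \<theta> - P0 \<theta>\<bar> \<le> \<bar>a (?x t \<theta>) - a z\<bar> + \<bar>b (?x t \<theta>) - b z\<bar>"
        using trig[of \<theta> "a (?x t \<theta>) - a z" "b (?x t \<theta>) - b z"]
        by (simp add: P_eq P0_def algebra_simps)
      ultimately show "\<bar>P t \<theta> - P0 \<theta>\<bar> \<le> h" by linarith
    qed (use d in auto)
  qed
  define L where "L = 2 * pi * v z - \<kappa> * pi * r * ddir e v z"
  define j where "j t \<theta> = P t \<theta> * (t * ln (r/t) - \<kappa> * ((r\<^sup>2 - t\<^sup>2)/(2*r)) * cos \<theta>)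
     - v (?x t \<theta>) * (- 1 + \<kappa> * ((r\<^sup>2 + t\<^sup>2)/(2*r*t)) * cos \<theta>)" for t \<theta>
  define l where "l t \<theta> = v z - \<kappa> * r * P0 \<theta> * cos \<theta> - \<kappa> * ((r\<^sup>2 + t\<^sup>2)/(2*r*t)) * v z * cos \<theta>" for t \<theta>
  have intl: "((l t) has_integral L) {0..2*pi}" for t
  proof -
    note c0 = has_integral_cos_2pi and c2 = has_integral_cos_squared_2pi and sc = has_integral_sin_cos_2pi
    let ?C = "\<kappa> * ((r\<^sup>2 + t\<^sup>2)/(2*r*t)) * v z"
    have "((\<lambda>\<theta>. (v z - (\<kappa> * r * a z) * (cos \<theta>)\<^sup>2 - (\<kappa> * r * b z) * (sin \<theta> * cos \<theta>)) - ?C * cos \<theta>)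
       has_integral (((2*pi - 0) *\<^sub>R v z - (\<kappa> * r * a z) * pi - (\<kappa> * r * b z) * 0) - ?C * 0)) {0..2*pi}"
      by (intro has_integral_diff has_integral_mult_right c0 c2 sc has_integral_const_real[of "v z" 0 "2*pi", simplified])
         (use has_integral_const_real[of "v z" 0 "2*pi"] in simp)
    moreover have "(\<lambda>\<theta>. (v z - (\<kappa> * r * a z) * (cos \<theta>)\<^sup>2 - (\<kappa> * r * b z) * (sin \<theta> * cos \<theta>)) - ?C * cos \<theta>) = l t"
      by (simp add: l_def P0_def fun_eq_iff power2_eq_square algebra_simps)
    moreover have "(((2*pi - 0) *\<^sub>R v z - (\<kappa> * r * a z) * pi - (\<kappa> * r * b z) * 0) - ?C * 0) = L"
      by (simp add: L_def a_def)
    ultimately show ?thesis by simp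
  qed
  have contj: "continuous_on {0..2*pi} (j t)" for t
    unfolding j_def P_eq a_def b_def
    by (intro continuous_on_diff continuous_on_mult continuous_on_add continuous_on_cos continuous_on_sin
        continuous_on_const continuous_on_id continuous_polar[OF vc(1)] continuous_polar[OF vc(2)])
  have gf: "green_flux t = integral {0..2*pi} (j t)" for t
    unfolding green_flux_def j_def[abs_def] P_def ..
  define bb where "bb h t = (G + h) * \<bar>t * ln (r/t)\<bar> + \<bar>\<kappa>\<bar> * (r * h + t\<^sup>2/r * (G + h)) + t * (G + h)" for h t
  have bound: "\<bar>green_flux t - L\<bar> \<le> 2 * pi * bb h t"
    if t: "0 < t" "t < d" and d: "\<And>t \<theta>. 0 \<le> t \<Longrightarrow> t < d \<Longrightarrow> \<bar>P t \<theta> - P0 \<theta>\<bar> \<le> h" and "h > 0" for t d h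
  proof -
    have ptw: "\<bar>j t \<theta> - l t \<theta>\<bar> \<le> bb h t" for \<theta>
    proof -
      have "\<exists>s. 0 < s \<and> s < t \<and> v (?x t \<theta>) - v (?x 0 \<theta>) = (t - 0) * P s \<theta>"
        unfolding P_def by (rule MVT2[OF t(1)]) (rule has_derivative_line[OF vd(1)])
      then obtain s where s: "0 < s" "s < t" and V: "v (?x t \<theta>) = v z + t * P s \<theta>" by auto
      define p where "p = P t \<theta>" define q where "q = P s \<theta>" define c where "c = cos \<theta>"
      have p: "\<bar>p - P0 \<theta>\<bar> \<le> h" "\<bar>p\<bar> \<le> G + h" and q: "\<bar>q - P0 \<theta>\<bar> \<le> h" "\<bar>q\<bar> \<le> G + h"
        unfolding p_def q_def using d[of t \<theta>] d[of s \<theta>] P0G[of \<theta>] s t by linarith+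
      have c: "\<bar>c\<bar> \<le> 1" by (simp add: c_def)
      have Gh: "0 \<le> G + h" using p by linarith
      have "j t \<theta> - l t \<theta> = p * (t * ln (r/t)) - \<kappa> * c * (r/2 * (p - P0 \<theta>) - t\<^sup>2/(2*r) * p) + t * q
           - \<kappa> * c * (r/2 * (q - P0 \<theta>) + t\<^sup>2/(2*r) * q)"
        unfolding j_def l_def V p_def[symmetric] q_def[symmetric] c_def[symmetric] using t r
        by (simp add: field_simps power2_eq_square)
      moreover have "\<bar>p * (t * ln (r/t))\<bar> \<le> (G + h) * \<bar>t * ln (r/t)\<bar>"
        unfolding abs_mult[of p] by (intro mult_right_mono p) auto
      moreover have "\<bar>\<kappa> * c * (r/2 * (p - P0 \<theta>) - t\<^sup>2/(2*r) * p)\<bar> \<le> \<bar>\<kappa>\<bar> * (r/2 * h + t\<^sup>2/(2*r) * (G+h))"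
      proof -
        have "\<bar>r/2 * (p - P0 \<theta>)\<bar> \<le> r/2 * h" "\<bar>t\<^sup>2/(2*r) * p\<bar> \<le> t\<^sup>2/(2*r) * (G+h)"
          by (rule absm, use r in simp, use p in simp)+
        then have "\<bar>r/2 * (p - P0 \<theta>) - t\<^sup>2/(2*r) * p\<bar> \<le> r/2 * h + t\<^sup>2/(2*r) * (G+h)" by linarith
        moreover have "\<bar>\<kappa> * c\<bar> \<le> \<bar>\<kappa>\<bar>" unfolding abs_mult using c by (simp add: mult_left_le)
        ultimately show ?thesis unfolding abs_mult[of "\<kappa> * c"] by (intro mult_mono) auto
      qed
      moreover have "\<bar>\<kappa> * c * (r/2 * (q - P0 \<theta>) + t\<^sup>2/(2*r) * q)\<bar> \<le> \<bar>\<kappa>\<bar> * (r/2 * h + t\<^sup>2/(2*r) * (G+h))"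
      proof -
        have "\<bar>r/2 * (q - P0 \<theta>)\<bar> \<le> r/2 * h" "\<bar>t\<^sup>2/(2*r) * q\<bar> \<le> t\<^sup>2/(2*r) * (G+h)"
          by (rule absm, use r in simp, use q in simp)+
        then have "\<bar>r/2 * (q - P0 \<theta>) + t\<^sup>2/(2*r) * q\<bar> \<le> r/2 * h + t\<^sup>2/(2*r) * (G+h)" by linarith
        moreover have "\<bar>\<kappa> * c\<bar> \<le> \<bar>\<kappa>\<bar>" unfolding abs_mult using c by (simp add: mult_left_le)
        ultimately show ?thesis unfolding abs_mult[of "\<kappa> * c"] by (intro mult_mono) auto
      qed
      moreover have "\<bar>t * q\<bar> \<le> t * (G + h)" unfolding abs_mult using t q by (simp add: mult_left_mono)
      moreover have "bb h t = (G + h) * \<bar>t * ln (r/t)\<bar> + \<bar>\<kappa>\<bar> * (r/2 * h + t\<^sup>2/(2*r) * (G+h))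
          + \<bar>\<kappa>\<bar> * (r/2 * h + t\<^sup>2/(2*r) * (G+h)) + t * (G + h)"
        unfolding bb_def using r by (simp add: field_simps)
      ultimately show ?thesis by (rule absum)
    qed
    have B0: "0 \<le> bb h t" using ptw[of 0] by linarith
    have "((\<lambda>\<theta>. j t \<theta> - l t \<theta>) has_integral (green_flux t - L)) {0..2*pi}"
      unfolding gf by (intro has_integral_diff intl integrable_integral integrable_continuous_interval contj)
    then have "norm (green_flux t - L) \<le> bb h t * measure lborel {0..2*pi}"
      by (rule has_integral_bound_real[OF B0 finite.emptyI]) (use ptw in auto)
    then show ?thesis by (simp add: mult.commute)
  qed
  have "(green_flux \<longlongrightarrow> L) (at_right 0)"
  proof (rule tendstoI)
    fix \<epsilon> :: real assume "\<epsilon> > 0"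
    define k where "k = \<bar>\<kappa>\<bar> * r + 1"
    define h where "h = \<epsilon> / (2 * (2 * pi * k))"
    have kr: "k > 0" using r by (simp add: k_def add_nonneg_pos)
    have h: "h > 0" unfolding h_def using \<open>\<epsilon> > 0\<close> kr by simp
    obtain d where d: "d > 0" "\<And>t \<theta>. 0 \<le> t \<Longrightarrow> t < d \<Longrightarrow> \<bar>P t \<theta> - P0 \<theta>\<bar> \<le> h" using Pclose[OF h] by blast
    have "((\<lambda>t. t * ln (r/t)) \<longlongrightarrow> 0) (at_right 0)" using r by real_asymp
    then have "((\<lambda>t. 2 * pi * bb h t) \<longlongrightarrow> 2 * pi * ((G + h) * \<bar>0\<bar> + \<bar>\<kappa>\<bar> * (r * h + 0\<^sup>2/r * (G + h)) + 0 * (G + h))) (at_right 0)"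
      unfolding bb_def using r by (intro tendsto_intros) auto
    moreover have "2 * pi * ((G + h) * \<bar>0\<bar> + \<bar>\<kappa>\<bar> * (r * h + 0\<^sup>2/r * (G + h)) + 0 * (G + h)) < \<epsilon>"
    proof -
      have "2 * pi * (k * h) = \<epsilon> / 2" unfolding h_def using kr by (simp add: field_simps)
      moreover have "2 * pi * (\<bar>\<kappa>\<bar> * r * h) \<le> 2 * pi * (k * h)"
        using h unfolding k_def by (intro mult_left_mono) (auto simp: algebra_simps)
      ultimately have "2 * pi * (\<bar>\<kappa>\<bar> * r * h) < \<epsilon>" using \<open>\<epsilon> > 0\<close> by linarith
      then show ?thesis by (simp add: mult.assoc)
    qed
    ultimately have "\<forall>\<^sub>F t in at_right 0. 2 * pi * bb h t < \<epsilon>" by (rule order_tendstoD(2))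
    moreover have "\<forall>\<^sub>F t in at_right 0. 0 < t \<and> t < d"
      using d(1) unfolding eventually_at_right_field by auto
    ultimately show "\<forall>\<^sub>F t in at_right 0. dist (green_flux t) L < \<epsilon>"
      by eventually_elim (use bound d h in \<open>fastforce simp: dist_real_def\<close>)
  qed
  then show ?thesis by (simp add: L_def)
qed

text \<open>The fundamental theorem of calculus for \<open>green_flux\<close> between \<open>0\<close> and \<open>r\<close>, with a majorant \<open>\<beta>'\<close>
  of the source term. The left-hand side is the flux at \<open>r\<close>, where the kernel vanishes.\<close>

lemma green_inequality:
  assumes \<beta>: "\<And>t. 0 < t \<Longrightarrow> t \<le> r \<Longrightarrow> (\<beta> has_real_derivative \<beta>' t) (at t)"
    and \<beta>0: "(\<beta> \<longlongrightarrow> \<beta>0) (at_right 0)"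
    and le: "\<And>t. 0 < t \<Longrightarrow> t \<le> r \<Longrightarrow> integral {0..2*pi} (\<lambda>\<theta>. (t * ln (r/t) - \<kappa> * ((r\<^sup>2 - t\<^sup>2)/(2*r)) * cos \<theta>)
        * laplacian v (z + t *\<^sub>R unit_at e \<theta>)) \<le> \<beta>' t"
  shows "integral {0..2*pi} (\<lambda>\<theta>. v (z + r *\<^sub>R unit_at e \<theta>) * (1 - \<kappa> * cos \<theta>))
      \<le> 2 * pi * v z - \<kappa> * pi * r * ddir e v z + (\<beta> r - \<beta>0)"
proof -
  have Jr: "integral {0..2*pi} (\<lambda>\<theta>. v (z + r *\<^sub>R unit_at e \<theta>) * (1 - \<kappa> * cos \<theta>)) = green_flux r"
    unfolding green_flux_def using r by (intro integral_cong) (simp add: power2_eq_square field_simps)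
  have "green_flux r \<le> green_flux t + (\<beta> r - \<beta> t)" if t: "0 < t" "t < r" for t
  proof -
    have "\<beta> t - green_flux t \<le> \<beta> r - green_flux r"
    proof (rule DERIV_nonneg_imp_nondecreasing[of t r "\<lambda>t. \<beta> t - green_flux t"])
      show "t \<le> r" using t by simp
    next
      fix s assume s: "t \<le> s" "s \<le> r"
      show "\<exists>y. ((\<lambda>t. \<beta> t - green_flux t) has_real_derivative y) (at s) \<and> 0 \<le> y"
        using DERIV_diff[OF \<beta> green_flux_deriv, of s] le[of s] s t by (intro exI conjI) auto
    qed
    then show ?thesis by simp
  qed
  then have "\<forall>\<^sub>F t in at_right 0. green_flux r \<le> green_flux t + (\<beta> r - \<beta> t)"
    using r unfolding eventually_at_right_field by blast
  moreover have "((\<lambda>t. green_flux t + (\<beta> r - \<beta> t)) \<longlongrightarrow>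
      2 * pi * v z - \<kappa> * pi * r * ddir e v z + (\<beta> r - \<beta>0)) (at_right 0)"
    by (intro tendsto_intros green_flux_tendsto_0 \<beta>0)
  ultimately show ?thesis unfolding Jr by (intro tendsto_lowerbound) auto
qed

end

section \<open>Gradients of nonnegative functions with controlled Laplacian\<close>

lemma ln_le_half_diff_inverse:
  assumes "1 \<le> x" shows "ln x \<le> (x - 1 / x) / (2::real)"
proof -
  have "(\<lambda>x. (x - 1/x)/2 - ln x) 1 \<le> (\<lambda>x. (x - 1/x)/2 - ln x) x"
  proof (rule DERIV_nonneg_imp_nondecreasing[OF assms])
    fix y :: real assume y: "1 \<le> y" "y \<le> x"
    have "((\<lambda>x. (x - 1/x)/2 - ln x) has_real_derivative (1 - 1/y)\<^sup>2 / 2) (at y)"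
      using y by (auto intro!: derivative_eq_intros simp: field_simps power2_eq_square)
    then show "\<exists>d. ((\<lambda>x. (x - 1/x)/2 - ln x) has_real_derivative d) (at y) \<and> 0 \<le> d"
      by (intro exI conjI) auto
  qed
  then show ?thesis by simp
qed

lemma green_kernel_bounds:
  assumes "0 < t" "t \<le> (r::real)"
  shows "0 \<le> t * ln (r/t)" "t * ln (r/t) \<le> (r\<^sup>2 - t\<^sup>2)/(2*r)"
proof -
  show "0 \<le> t * ln (r/t)" using assms by simp
  have "t * ln (r/t) \<le> t * ((r/t - 1/(r/t))/2)"
    using assms by (intro mult_left_mono ln_le_half_diff_inverse) auto
  also have "\<dots> = (r\<^sup>2 - t\<^sup>2)/(2*r)" using assms by (simp add: field_simps power2_eq_square)
  finally show "t * ln (r/t) \<le> (r\<^sup>2 - t\<^sup>2)/(2*r)" .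
qed

lemma grad_nth: "grad v z $ 1 = ddir (axis 1 1) v z" "grad v z $ 2 = ddir (axis 2 1) v z"
  by (simp_all add: grad_def partial_eq_ddir)

lemma ex_gradient_direction:
  assumes "v differentiable (at z)"
  shows "\<exists>e. norm e = 1 \<and> ddir e v z = norm (grad v z)"
proof (cases "grad v z = 0")
  case True
  then have "ddir (axis 1 1) v z = 0" using grad_nth[of v z] by simp
  then show ?thesis using True by (intro exI[of _ "axis 1 1"]) (simp add: norm_axis_1)
next
  case False
  define e where "e = (1 / norm (grad v z)) *\<^sub>R grad v z"
  have "ddir e v z = (1 / norm (grad v z)) * (norm (grad v z))\<^sup>2"
    unfolding ddir_coordinates[OF assms, of e] norm_real2 grad_nth
    by (simp add: e_def grad_nth power2_eq_square algebra_simps)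
  then show ?thesis using False by (intro exI[of _ e]) (simp add: e_def power2_eq_square)
qed

lemma laplacian_continuous:
  assumes "smooth_on UNIV (v :: real^2 \<Rightarrow> real)" shows "continuous_on A (laplacian v)"
  unfolding laplacian_eq_ddir[abs_def] by (intro continuous_on_add v_cont(3)[OF assms])

lemma circle_integrable:
  assumes "continuous_on UNIV (h :: real^2 \<Rightarrow> real)" "continuous_on UNIV k"
  shows "(\<lambda>\<theta>. k \<theta> * h (z + t *\<^sub>R unit_at e \<theta>)) integrable_on {0..2*pi}"
  by (intro integrable_continuous_interval continuous_on_mult continuous_on_subset[OF assms(2)]
      continuous_on_compose2[OF assms(1)]) (auto intro!: continuous_intros simp: unit_at_def)

lemma circle_integral_nonneg:
  assumes "continuous_on UNIV (v :: real^2 \<Rightarrow> real)" "\<And>x. 0 \<le> v x"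
  shows "0 \<le> integral {0..2*pi} (\<lambda>\<theta>. v (z + r *\<^sub>R unit_at e \<theta>) * (1 - 1 * cos \<theta>))"
proof (rule integral_nonneg)
  have "(\<lambda>\<theta>. (1 - 1 * cos \<theta>) * v (z + r *\<^sub>R unit_at e \<theta>)) integrable_on {0..2*pi}"
    by (rule circle_integrable[OF assms(1)]) (intro continuous_intros)
  then show "(\<lambda>\<theta>. v (z + r *\<^sub>R unit_at e \<theta>) * (1 - 1 * cos \<theta>)) integrable_on {0..2*pi}"
    by (simp only: mult.commute)
qed (use assms in simp)

lemma poly_antiderivatives:
  assumes "(r::real) > 0"
  shows
    "((\<lambda>t. r * t/2 - t^3/(6*r)) has_real_derivative (r\<^sup>2 - t\<^sup>2)/(2*r)) (at t)"
    "((\<lambda>t. r * t\<^sup>2/4 - t^4/(8*r)) has_real_derivative t * ((r\<^sup>2 - t\<^sup>2)/(2*r))) (at t)"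
    "((\<lambda>t. r * t^3/6 - t^5/(10*r)) has_real_derivative t\<^sup>2 * ((r\<^sup>2 - t\<^sup>2)/(2*r))) (at t)"
proof -
  have p: "((\<lambda>t. t\<^sup>2) has_real_derivative 2 * t) (at t)" "((\<lambda>t. t^3) has_real_derivative 3 * t\<^sup>2) (at t)"
    "((\<lambda>t. t^4) has_real_derivative 4 * t^3) (at t)" "((\<lambda>t. t^5) has_real_derivative 5 * t^4) (at t)"
    using DERIV_pow[of 2 t UNIV] DERIV_pow[of 3 t UNIV] DERIV_pow[of 4 t UNIV] DERIV_pow[of 5 t UNIV] by simp_all
  show "((\<lambda>t. r * t/2 - t^3/(6*r)) has_real_derivative (r\<^sup>2 - t\<^sup>2)/(2*r)) (at t)"
    by (rule DERIV_cong[OF DERIV_diff[OF DERIV_cdivide[OF DERIV_cmult[OF DERIV_ident]] DERIV_cdivide[OF p(2)]]])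
       (use assms in \<open>simp add: field_simps power2_eq_square\<close>)
  show "((\<lambda>t. r * t\<^sup>2/4 - t^4/(8*r)) has_real_derivative t * ((r\<^sup>2 - t\<^sup>2)/(2*r))) (at t)"
    by (rule DERIV_cong[OF DERIV_diff[OF DERIV_cdivide[OF DERIV_cmult[OF p(1)]] DERIV_cdivide[OF p(3)]]])
       (use assms in \<open>simp add: field_simps power2_eq_square power3_eq_cube\<close>)
  show "((\<lambda>t. r * t^3/6 - t^5/(10*r)) has_real_derivative t\<^sup>2 * ((r\<^sup>2 - t\<^sup>2)/(2*r))) (at t)"
    by (rule DERIV_cong[OF DERIV_diff[OF DERIV_cdivide[OF DERIV_cmult[OF p(2)]] DERIV_cdivide[OF p(4)]]])
       (use assms in \<open>simp add: field_simps power2_eq_square power4_eq_xxxx\<close>)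
qed

lemma log_antiderivative:
  assumes "(t::real) > 0" "r > 0"
  shows "((\<lambda>t. t ^ Suc n * ln (r/t) / real (Suc n) + t ^ Suc n / (real (Suc n))\<^sup>2)
      has_real_derivative t ^ n * ln (r/t)) (at t)"
proof -
  have dl: "((\<lambda>t. ln (r/t)) has_real_derivative - 1/t) (at t)"
    using assms by (auto intro!: derivative_eq_intros simp: field_simps power2_eq_square)
  have dp: "((\<lambda>t. t ^ Suc n) has_real_derivative real (Suc n) * t ^ n) (at t)" for n
    using DERIV_pow[of "Suc n" t UNIV] by simp
  have D: "((\<lambda>t. t ^ Suc n * ln (r/t) / real (Suc n) + t ^ Suc n / (real (Suc n))\<^sup>2)
      has_real_derivative (real (Suc n) * t ^ n * ln (r/t) + (- 1/t) * t ^ Suc n) / real (Suc n)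
       + real (Suc n) * t ^ n / (real (Suc n))\<^sup>2) (at t)"
    by (intro DERIV_add DERIV_cdivide DERIV_mult dp dl)
  have eq: "(m * t ^ n * l + (- 1/t) * t ^ Suc n) / m + m * t ^ n / m\<^sup>2 = t ^ n * l" if "m > 0" for m l :: real
    using assms that by (simp add: field_simps power2_eq_square)
  have "real (Suc n) > 0" by simp
  from D show ?thesis unfolding eq[OF \<open>real (Suc n) > 0\<close>] .
qed

lemma log_antiderivatives:
  assumes "(t::real) > 0" "r > 0"
  shows "((\<lambda>t. t\<^sup>2 * ln (r/t) / 2 + t\<^sup>2/4) has_real_derivative t * ln (r/t)) (at t)"
    "((\<lambda>t. t^3 * ln (r/t) / 3 + t^3/9) has_real_derivative t * (t * ln (r/t))) (at t)"
    "((\<lambda>t. t^4 * ln (r/t) / 4 + t^4/16) has_real_derivative t\<^sup>2 * (t * ln (r/t))) (at t)"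
proof -
  have n: "Suc 1 = 2" "Suc 2 = 3" "Suc 3 = 4" by simp_all
  show "((\<lambda>t. t\<^sup>2 * ln (r/t) / 2 + t\<^sup>2/4) has_real_derivative t * ln (r/t)) (at t)"
    using log_antiderivative[OF assms, of 1] unfolding n by simp
  show "((\<lambda>t. t^3 * ln (r/t) / 3 + t^3/9) has_real_derivative t * (t * ln (r/t))) (at t)"
    using log_antiderivative[OF assms, of 2] unfolding n by (simp add: power2_eq_square mult.assoc)
  show "((\<lambda>t. t^4 * ln (r/t) / 4 + t^4/16) has_real_derivative t\<^sup>2 * (t * ln (r/t))) (at t)"
    using log_antiderivative[OF assms, of 3] unfolding n
    by (simp add: power2_eq_square power3_eq_cube mult.assoc)
qed

text \<open>A nonnegative function cannot have a large gradient at a point where it is small unless its Laplacian is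
  large. In Green's identity with \<open>\<kappa> = 1\<close> the outer boundary term has the nonnegative weight
  \<open>1 - cos \<theta>\<close>, so it can be dropped. The source term is estimated with \<open>A = t ln (r/t)\<close> below
  \<open>B = (r\<^sup>2 - t\<^sup>2)/(2r)\<close> by \<open>|A - B cos \<theta>| \<le> A (1 - cos \<theta>) + (B - A) |cos \<theta>|\<close>. The fraction \<open>99/140\<close>
  bounds the mean of \<open>|cos|\<close>.\<close>

lemma gradient_bound:
  fixes v :: "real^2 \<Rightarrow> real"
  assumes v: "smooth_on UNIV v" and r: "r > 0"
    and nonneg: "\<And>x. 0 \<le> v x"
    and lap: "\<And>x. norm x \<le> r \<Longrightarrow> \<bar>laplacian v (z + x)\<bar> \<le> M0 + M1 * norm x"
  shows "r * norm (grad v z) \<le> 2 * v z + 2 * (M0 * r\<^sup>2 * (1/4 + 99/140 * (1/12)) + M1 * r ^ 3 * (1/9 + 99/140 * (1/72)))"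
proof -
  obtain e where e: "norm e = 1" and g: "ddir e v z = norm (grad v z)"
    using ex_gradient_direction v_diff(1)[OF v] by blast
  \<comment> \<open>the mean over the circle of the parabola \<open>5/7 x\<^sup>2 + 7/20\<close> at \<open>x = cos \<theta>\<close>\<close>
  define c :: real where "c = 99/140"
  define \<beta> where "\<beta> t = 2 * pi * (M0 * ((1 - c) * (t\<^sup>2 * ln (r/t) / 2 + t\<^sup>2/4) + c * (r * t/2 - t^3/(6*r)))
     + M1 * ((1 - c) * (t^3 * ln (r/t) / 3 + t^3/9) + c * (r * t\<^sup>2/4 - t^4/(8*r))))" for t
  define \<beta>' where "\<beta>' t = (M0 + M1 * t) * (2 * pi * ((1 - c) * (t * ln (r/t)) + c * ((r\<^sup>2 - t\<^sup>2)/(2*r))))" for t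
  have d\<beta>: "(\<beta> has_real_derivative \<beta>' t) (at t)" if "0 < t" for t
  proof -
    have D: "(\<beta> has_real_derivative 2 * pi * (M0 * ((1 - c) * (t * ln (r/t)) + c * ((r\<^sup>2 - t\<^sup>2)/(2*r)))
       + M1 * ((1 - c) * (t * (t * ln (r/t))) + c * (t * ((r\<^sup>2 - t\<^sup>2)/(2*r)))))) (at t)"
      unfolding \<beta>_def[abs_def]
      by (intro DERIV_cmult DERIV_add log_antiderivatives[OF that r] poly_antiderivatives[OF r])
    have m: "2 * pi * (M0 * ((1 - c) * L + c * X) + M1 * ((1 - c) * (t * L) + c * (t * X)))
        = (M0 + M1 * t) * (2 * pi * ((1 - c) * L + c * X))" for L X
      by (simp add: algebra_simps)
    show ?thesis using D unfolding \<beta>'_def m .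
  qed
  have \<beta>0: "(\<beta> \<longlongrightarrow> 0) (at_right 0)"
  proof -
    have "((\<lambda>t. t\<^sup>2 * ln (r/t)) \<longlongrightarrow> 0) (at_right 0)" "((\<lambda>t. t^3 * ln (r/t)) \<longlongrightarrow> 0) (at_right 0)"
      using r by real_asymp+
    then have "(\<beta> \<longlongrightarrow> 2 * pi * (M0 * ((1 - c) * (0 / 2 + 0\<^sup>2/4) + c * (r * 0/2 - 0^3/(6*r)))
     + M1 * ((1 - c) * (0 / 3 + 0^3/9) + c * (r * 0\<^sup>2/4 - 0^4/(8*r))))) (at_right 0)"
      unfolding \<beta>_def[abs_def] using r by (intro tendsto_intros) auto
    then show ?thesis by simp
  qed
  have le: "integral {0..2*pi} (\<lambda>\<theta>. (t * ln (r/t) - 1 * ((r\<^sup>2 - t\<^sup>2)/(2*r)) * cos \<theta>)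
        * laplacian v (z + t *\<^sub>R unit_at e \<theta>)) \<le> \<beta>' t" if t: "0 < t" "t \<le> r" for t
  proof -
    define A where "A = t * ln (r/t)"
    define B where "B = (r\<^sup>2 - t\<^sup>2)/(2*r)"
    have AB: "0 \<le> A" "A \<le> B" unfolding A_def B_def by (rule green_kernel_bounds[OF t])+
    define k where "k \<theta> = A * (1 - cos \<theta>) + (B - A) * (5/7 * (cos \<theta>)\<^sup>2 + 7/20)" for \<theta>
    have kb: "\<bar>A - B * cos \<theta>\<bar> \<le> k \<theta>" for \<theta>
    proof -
      define c where "c = cos \<theta>"
      have c1: "c \<le> 1" by (simp add: c_def)
      \<comment> \<open>this parabola touches the absolute value from above at \<open>7/10\<close> and \<open>- 7/10\<close>\<close>
      have "0 \<le> 5/7 * (c - 7/10)\<^sup>2" "0 \<le> 5/7 * (c + 7/10)\<^sup>2" by simp_all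
      then have "\<bar>c\<bar> \<le> 5/7 * c\<^sup>2 + 7/20" by (simp add: power2_eq_square algebra_simps abs_le_iff)
      then have "(B - A) * \<bar>c\<bar> \<le> (B - A) * (5/7 * c\<^sup>2 + 7/20)" using AB by (intro mult_left_mono) auto
      moreover have "\<bar>(B - A) * c\<bar> = (B - A) * \<bar>c\<bar>" using AB by (simp add: abs_mult)
      moreover have "0 \<le> A * (1 - c)" using AB c1 by simp
      moreover have "A - B * c = A * (1 - c) - (B - A) * c" by (simp add: algebra_simps)
      ultimately show ?thesis unfolding k_def c_def[symmetric] by linarith
    qed
    have M: "0 \<le> M0 + M1 * t" using lap[of "t *\<^sub>R unit_at e 0"] t e by (simp add: norm_unit_at)
    have "integral {0..2*pi} (\<lambda>\<theta>. (A - B * cos \<theta>) * laplacian v (z + t *\<^sub>R unit_at e \<theta>))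
       \<le> integral {0..2*pi} (\<lambda>\<theta>. k \<theta> * (M0 + M1 * t))"
    proof (rule integral_le)
      show "(\<lambda>\<theta>. (A - B * cos \<theta>) * laplacian v (z + t *\<^sub>R unit_at e \<theta>)) integrable_on {0..2*pi}"
        by (rule circle_integrable[OF laplacian_continuous[OF v]]) (auto intro!: continuous_intros)
      show "(\<lambda>\<theta>. k \<theta> * (M0 + M1 * t)) integrable_on {0..2*pi}"
        unfolding k_def by (intro integrable_continuous_interval continuous_intros)
      fix \<theta> :: real
      have "\<bar>laplacian v (z + t *\<^sub>R unit_at e \<theta>)\<bar> \<le> M0 + M1 * t"
        using lap[of "t *\<^sub>R unit_at e \<theta>"] t e by (simp add: norm_unit_at)
      then have "\<bar>(A - B * cos \<theta>) * laplacian v (z + t *\<^sub>R unit_at e \<theta>)\<bar> \<le> k \<theta> * (M0 + M1 * t)"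
        unfolding abs_mult using kb[of \<theta>] by (intro mult_mono) auto
      then show "(A - B * cos \<theta>) * laplacian v (z + t *\<^sub>R unit_at e \<theta>) \<le> k \<theta> * (M0 + M1 * t)" by linarith
    qed
    also have "integral {0..2*pi} (\<lambda>\<theta>. k \<theta> * (M0 + M1 * t)) = \<beta>' t"
    proof -
      note c0 = has_integral_cos_2pi and c2 = has_integral_cos_squared_2pi
      have cc: "((\<lambda>\<theta>. y) has_integral 2 * pi * y) {0..2*pi}" for y :: real
        using has_integral_const_real[of y 0 "2*pi"] by simp
      have "((\<lambda>\<theta>. (A * (1 - cos \<theta>) + (B - A) * (5/7 * (cos \<theta>)\<^sup>2 + 7/20)) * (M0 + M1 * t)) has_integral
         (A * (2 * pi * 1 - 0) + (B - A) * (5/7 * pi + 2 * pi * (7/20))) * (M0 + M1 * t)) {0..2*pi}"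
        by (intro has_integral_mult_left has_integral_add has_integral_mult_right has_integral_diff c0 c2 cc)
      then have "integral {0..2*pi} (\<lambda>\<theta>. k \<theta> * (M0 + M1 * t))
          = (A * (2 * pi * 1 - 0) + (B - A) * (5/7 * pi + 2 * pi * (7/20))) * (M0 + M1 * t)"
        unfolding k_def by (rule integral_unique)
      also have "5/7 * pi + 2 * pi * (7/20) = 2 * pi * c" by (simp add: c_def)
      also have "(A * (2 * pi * 1 - 0) + (B - A) * (2 * pi * c)) * (M0 + M1 * t) = \<beta>' t"
        unfolding \<beta>'_def A_def[symmetric] B_def[symmetric] by algebra
      finally show ?thesis .
    qed
    finally show ?thesis unfolding A_def B_def by simp
  qed
  have "0 \<le> integral {0..2*pi} (\<lambda>\<theta>. v (z + r *\<^sub>R unit_at e \<theta>) * (1 - 1 * cos \<theta>))"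
    by (rule circle_integral_nonneg[OF v_cont(1)[OF v] nonneg])
  also have "\<dots> \<le> 2 * pi * v z - 1 * pi * r * ddir e v z + (\<beta> r - 0)"
    by (rule green_inequality[OF v e r d\<beta> \<beta>0 le])
  finally have "pi * (r * norm (grad v z)) \<le> pi * (2 * v z) + \<beta> r" by (simp add: g mult.assoc)
  also have "\<beta> r = pi * (2 * (M0 * r\<^sup>2 * ((1-c)/4 + c/3) + M1 * r ^ 3 * ((1-c)/9 + c/8)))"
  proof -
    have e: "ln (r/r) = 0" "r * r/2 - r^3/(6*r) = r\<^sup>2/3" "r * r\<^sup>2/4 - r^4/(8*r) = r^3/8"
      using r by (simp_all add: field_simps eval_nat_numeral)
    show ?thesis unfolding \<beta>_def e by (simp add: algebra_simps)
  qed
  finally have "pi * (r * norm (grad v z)) \<le> pi * (2 * v z + 2 * (M0 * r\<^sup>2 * ((1-c)/4 + c/3) + M1 * r ^ 3 * ((1-c)/9 + c/8)))"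
    by (simp add: distrib_left)
  then have "r * norm (grad v z) \<le> 2 * v z + 2 * (M0 * r\<^sup>2 * ((1-c)/4 + c/3) + M1 * r ^ 3 * ((1-c)/9 + c/8))"
    by simp
  moreover have "(1-c)/4 + c/3 = 1/4 + 99/140 * (1/12)" "(1-c)/9 + c/8 = 1/9 + 99/140 * (1/72)"
    by (simp_all add: c_def)
  ultimately show ?thesis by simp
qed

text \<open>The same estimate when the Laplacian is controlled by an affine function of \<open>s\<close> itself. Green's
  identity without the dipole (\<open>\<kappa> = 0\<close>) for \<open>W = a + b s\<close> bounds the growth of the circular means of \<open>W\<close>
  over radii up to \<open>r\<close>; inserted in the identity with \<open>\<kappa> = 1\<close>, it replaces a pointwise bound. Here the kernel is
  estimated by \<open>A + B\<close>, since only the circular means of \<open>W\<close> are known.\<close>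

lemma gradient_bound_self:
  fixes s :: "real^2 \<Rightarrow> real"
  assumes s: "smooth_on UNIV s" and r: "r > 0"
    and nonneg: "\<And>x. 0 \<le> s x" and ab: "a \<ge> 0" "b \<ge> 0" "\<rho> \<ge> 0"
    and lap: "\<And>x. \<bar>laplacian s x\<bar> \<le> \<rho> * (a + b * s x)"
    and small: "b * \<rho> * r\<^sup>2 / 4 \<le> \<epsilon>" "\<epsilon> < 1"
  shows "r * norm (grad s z) \<le> 2 * s z + 2 * \<rho> * (a + b * s z) * (7/12 + 31/240 * (\<epsilon> / (1 - \<epsilon>))) * r\<^sup>2"
proof -
  define W where "W x = a + b * s x" for x
  define W0 where "W0 = W z"
  have Wnn: "0 \<le> W x" for x unfolding W_def using ab nonneg[of x] by simp
  have sd: "\<And>x. s differentiable (at x)" using v_diff(1)[OF s] by blast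
  have Ws: "smooth_on UNIV W"
  proof -
    have c: "smooth_on UNIV (\<lambda>x::real^2. a)"
    proof -
      have "Ck_on k UNIV (\<lambda>x::real^2. a)" for k
      proof (cases k)
        case (Suc k)
        have "Ck_on k UNIV (\<lambda>x::real^2. 0::real)" using smooth_on_zero unfolding smooth_on_def by blast
        then show ?thesis using Suc by (simp add: ddir_const[unfolded ddir_def])
      qed simp
      then show ?thesis unfolding smooth_on_def by blast
    qed
    show ?thesis unfolding W_def[abs_def] by (intro smooth_on_add smooth_on_cmult c s open_UNIV)
  qed
  have ddW: "ddir w W = (\<lambda>x. b * ddir w s x)" for w
    unfolding W_def[abs_def] using sd by (auto simp: fun_eq_iff ddir_add ddir_const ddir_cmult)
  have lapW: "laplacian W x = b * laplacian s x" for x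
    unfolding laplacian_eq_ddir ddW by (simp add: ddir_cmult v_diff[OF s] algebra_simps)
  have lW: "laplacian W x \<le> b * \<rho> * W x" for x
  proof -
    have "laplacian s x \<le> \<rho> * W x" using lap[of x] unfolding W_def by linarith
    then show ?thesis unfolding lapW using ab by (simp add: mult.assoc mult_left_mono)
  qed
  have contW: "continuous_on UNIV W" using smooth_on_continuous[OF Ws] .
  define w where "w e t = integral {0..2*pi} (\<lambda>\<theta>. 1 * W (z + t *\<^sub>R unit_at e \<theta>))" for e t
  have w_nn: "0 \<le> w e t" for e t
    unfolding w_def by (rule integral_nonneg) (use Wnn circle_integrable[OF contW, of "\<lambda>_. 1"] in auto)
  obtain e where e: "norm e = 1" and g: "ddir e s z = norm (grad s z)"
    using ex_gradient_direction sd by blast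
  have contw: "continuous_on {0..r} (w e)"
    unfolding w_def cbox_interval[symmetric]
    by (rule integral_continuous_on_param)
       (auto simp: case_prod_unfold unit_at_def intro!: continuous_intros continuous_on_compose2[OF contW])
  have w0: "w e 0 = 2 * pi * W0"
    unfolding w_def W0_def using has_integral_const_real[of "W z" 0 "2*pi"] by (simp add: integral_unique)
  \<comment> \<open>bounding the mean in the source term by its maximum lets the estimate absorb it\<close>
  obtain t1 where t1: "0 \<le> t1" "t1 \<le> r" and wmax: "\<And>t. 0 \<le> t \<Longrightarrow> t \<le> r \<Longrightarrow> w e t \<le> w e t1"
    using continuous_attains_sup[OF _ _ contw] r by auto
  define m where "m = w e t1"
  have m0: "0 \<le> m" unfolding m_def by (rule w_nn)
  have grow: "w e r1 \<le> 2 * pi * W0 + b * \<rho> * m * (r1\<^sup>2/4)" if r1: "0 \<le> r1" "r1 \<le> r" for r1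
  proof (cases "r1 = 0")
    case True then show ?thesis using w0 by simp
  next
    case False
    with r1 have r1p: "r1 > 0" by simp
    define \<beta> where "\<beta> t = b * \<rho> * m * (t\<^sup>2 * ln (r1/t) / 2 + t\<^sup>2/4)" for t
    have "integral {0..2*pi} (\<lambda>\<theta>. W (z + r1 *\<^sub>R unit_at e \<theta>) * (1 - 0 * cos \<theta>))
      \<le> 2 * pi * W z - 0 * pi * r1 * ddir e W z + (\<beta> r1 - 0)"
    proof (rule green_inequality[OF Ws e r1p])
      fix t :: real assume t: "0 < t" "t \<le> r1"
      show "(\<beta> has_real_derivative b * \<rho> * m * (t * ln (r1/t))) (at t)"
        unfolding \<beta>_def[abs_def] by (intro DERIV_cmult log_antiderivatives t r1p)
      define A where "A = t * ln (r1/t)"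
      have A: "0 \<le> A" unfolding A_def using green_kernel_bounds(1)[OF t] .
      have "integral {0..2*pi} (\<lambda>\<theta>. A * laplacian W (z + t *\<^sub>R unit_at e \<theta>))
         \<le> integral {0..2*pi} (\<lambda>\<theta>. (A * (b * \<rho>)) * W (z + t *\<^sub>R unit_at e \<theta>))"
        by (rule integral_le[OF circle_integrable[OF laplacian_continuous[OF Ws]] circle_integrable[OF contW]])
           (use lW A in \<open>auto simp: mult.assoc intro!: mult_left_mono\<close>)
      also have "\<dots> = (A * (b * \<rho>)) * w e t" unfolding w_def by simp
      also have "\<dots> \<le> (A * (b * \<rho>)) * m"
        using A ab t r1 unfolding m_def by (intro mult_left_mono wmax) auto
      finally show "integral {0..2*pi} (\<lambda>\<theta>. (t * ln (r1/t) - 0 * ((r1\<^sup>2 - t\<^sup>2)/(2*r1)) * cos \<theta>)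
        * laplacian W (z + t *\<^sub>R unit_at e \<theta>)) \<le> b * \<rho> * m * (t * ln (r1/t))"
        by (simp add: A_def algebra_simps)
    next
      have "((\<lambda>t. t\<^sup>2 * ln (r1/t)) \<longlongrightarrow> 0) (at_right 0)" using r1p by real_asymp
      then have "(\<beta> \<longlongrightarrow> b * \<rho> * m * (0 / 2 + 0\<^sup>2/4)) (at_right 0)"
        unfolding \<beta>_def[abs_def] by (intro tendsto_intros) auto
      then show "(\<beta> \<longlongrightarrow> 0) (at_right 0)" by simp
    qed
    moreover have "\<beta> r1 = b * \<rho> * m * (r1\<^sup>2/4)" unfolding \<beta>_def using r1p by simp
    ultimately show ?thesis unfolding w_def W0_def by simp
  qed
  have m_le: "m * (1 - \<epsilon>) \<le> 2 * pi * W0"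
  proof -
    have "t1\<^sup>2 \<le> r\<^sup>2" using t1 by (simp add: power_mono)
    then have "b * \<rho> * t1\<^sup>2 / 4 \<le> \<epsilon>" using small(1) ab mult_left_mono[of "t1\<^sup>2" "r\<^sup>2" "b * \<rho>"] by simp
    then have "m * (b * \<rho> * t1\<^sup>2 / 4) \<le> m * \<epsilon>" using m0 by (rule mult_left_mono)
    then show ?thesis using grow[OF t1] unfolding m_def[symmetric] by (simp add: algebra_simps)
  qed
  define k where "k = \<epsilon> / (1 - \<epsilon>) / r\<^sup>2"
  have eps0: "0 \<le> \<epsilon>" using small ab r by (meson mult_nonneg_nonneg order_trans zero_le_power2 divide_nonneg_pos zero_less_numeral)
  have k0: "0 \<le> k" unfolding k_def using eps0 small by simp
  have W0nn: "0 \<le> W0" unfolding W0_def by (rule Wnn)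
  have wb: "w e t \<le> 2 * pi * W0 * (1 + k * t\<^sup>2)" if "0 \<le> t" "t \<le> r" for t
  proof -
    have "b * \<rho> / 4 \<le> \<epsilon> / r\<^sup>2" using small(1) r by (simp add: field_simps)
    moreover have "m \<le> 2 * pi * W0 / (1 - \<epsilon>)" using m_le small by (simp add: field_simps)
    ultimately have "(b * \<rho> / 4) * m \<le> (\<epsilon> / r\<^sup>2) * (2 * pi * W0 / (1 - \<epsilon>))"
      using m0 eps0 by (intro mult_mono) auto
    then have "(b * \<rho> / 4) * m * t\<^sup>2 \<le> (\<epsilon> / r\<^sup>2) * (2 * pi * W0 / (1 - \<epsilon>)) * t\<^sup>2"
      by (rule mult_right_mono) simp
    also have "(\<epsilon> / r\<^sup>2) * (2 * pi * W0 / (1 - \<epsilon>)) * t\<^sup>2 = 2 * pi * W0 * (k * t\<^sup>2)" unfolding k_def by (simp add: ac_simps)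
    finally show ?thesis using grow[OF that] by (simp add: algebra_simps)
  qed
  define \<beta> where "\<beta> t = 2 * pi * \<rho> * W0 * ((t\<^sup>2 * ln (r/t) / 2 + t\<^sup>2/4) + (r * t/2 - t^3/(6*r))
     + k * ((t^4 * ln (r/t) / 4 + t^4/16) + (r * t^3/6 - t^5/(10*r))))" for t
  define \<beta>' where "\<beta>' t = 2 * pi * \<rho> * W0 * (t * ln (r/t) + (r\<^sup>2 - t\<^sup>2)/(2*r)
     + k * (t\<^sup>2 * (t * ln (r/t)) + t\<^sup>2 * ((r\<^sup>2 - t\<^sup>2)/(2*r))))" for t
  have "0 \<le> integral {0..2*pi} (\<lambda>\<theta>. s (z + r *\<^sub>R unit_at e \<theta>) * (1 - 1 * cos \<theta>))"
    by (rule circle_integral_nonneg[OF v_cont(1)[OF s] nonneg])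
  also have "\<dots> \<le> 2 * pi * s z - 1 * pi * r * ddir e s z + (\<beta> r - 0)"
  proof (rule green_inequality[OF s e r])
    fix t :: real assume t: "0 < t" "t \<le> r"
    show "(\<beta> has_real_derivative \<beta>' t) (at t)"
      unfolding \<beta>_def[abs_def] \<beta>'_def
      by (intro DERIV_cmult DERIV_add log_antiderivatives poly_antiderivatives t r)
    define A where "A = t * ln (r/t)"
    define B where "B = (r\<^sup>2 - t\<^sup>2)/(2*r)"
    have AB: "0 \<le> A" "A \<le> B" unfolding A_def B_def by (rule green_kernel_bounds[OF t])+
    have "integral {0..2*pi} (\<lambda>\<theta>. (A - 1 * B * cos \<theta>) * laplacian s (z + t *\<^sub>R unit_at e \<theta>))
       \<le> integral {0..2*pi} (\<lambda>\<theta>. ((A + B) * \<rho>) * W (z + t *\<^sub>R unit_at e \<theta>))"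
    proof (rule integral_le[OF circle_integrable[OF laplacian_continuous[OF s]] circle_integrable[OF contW]])
      fix \<theta> :: real
      let ?x = "z + t *\<^sub>R unit_at e \<theta>"
      have "\<bar>B * cos \<theta>\<bar> \<le> B * 1" unfolding abs_mult using AB by (intro mult_mono) auto
      then have "\<bar>A - 1 * B * cos \<theta>\<bar> \<le> A + B" using AB by simp
      then have "\<bar>(A - 1 * B * cos \<theta>) * laplacian s ?x\<bar> \<le> (A + B) * (\<rho> * W ?x)"
        unfolding abs_mult W_def using lap AB by (intro mult_mono) auto
      then show "(A - 1 * B * cos \<theta>) * laplacian s ?x \<le> ((A + B) * \<rho>) * W ?x" by (simp add: mult.assoc)
    qed (auto intro!: continuous_intros)
    also have "\<dots> = ((A + B) * \<rho>) * w e t" unfolding w_def by simp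
    also have "\<dots> \<le> ((A + B) * \<rho>) * (2 * pi * W0 * (1 + k * t\<^sup>2))"
      using AB ab t by (intro mult_left_mono wb) auto
    also have "\<dots> = \<beta>' t" unfolding \<beta>'_def A_def[symmetric] B_def[symmetric] by (simp add: algebra_simps)
    finally show "integral {0..2*pi} (\<lambda>\<theta>. (t * ln (r/t) - 1 * ((r\<^sup>2 - t\<^sup>2)/(2*r)) * cos \<theta>)
        * laplacian s (z + t *\<^sub>R unit_at e \<theta>)) \<le> \<beta>' t" unfolding A_def B_def by simp
  next
    have "((\<lambda>t. t\<^sup>2 * ln (r/t)) \<longlongrightarrow> 0) (at_right 0)" "((\<lambda>t. t^4 * ln (r/t)) \<longlongrightarrow> 0) (at_right 0)"
      using r by real_asymp+
    then have "(\<beta> \<longlongrightarrow> 2 * pi * \<rho> * W0 * ((0 / 2 + 0\<^sup>2/4) + (r * 0/2 - 0^3/(6*r))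
       + k * ((0 / 4 + 0^4/16) + (r * 0^3/6 - 0^5/(10*r))))) (at_right 0)"
      unfolding \<beta>_def[abs_def] using r by (intro tendsto_intros) auto
    then show "(\<beta> \<longlongrightarrow> 0) (at_right 0)" by simp
  qed
  finally have "pi * (r * norm (grad s z)) \<le> pi * (2 * s z) + \<beta> r" by (simp add: g mult.assoc)
  also have "\<beta> r = pi * (2 * \<rho> * W0 * (7/12 + 31/240 * (\<epsilon> / (1 - \<epsilon>))) * r\<^sup>2)"
  proof -
    have e: "ln (r/r) = 0" "r * r/2 - r^3/(6*r) = r\<^sup>2/3" "r * r^3/6 - r^5/(10*r) = r\<^sup>2 * r\<^sup>2/15"
      "r^4/16 = r\<^sup>2 * r\<^sup>2/16" using r by (simp_all add: field_simps eval_nat_numeral)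
    have "k * r\<^sup>2 = \<epsilon> / (1 - \<epsilon>)" unfolding k_def using r by simp
    then have k: "k * (r\<^sup>2 * r\<^sup>2) = \<epsilon> / (1 - \<epsilon>) * r\<^sup>2" by (simp only: mult.assoc[symmetric])
    have "\<beta> r = 2 * pi * \<rho> * W0 * (7/12 * r\<^sup>2 + 31/240 * (k * (r\<^sup>2 * r\<^sup>2)))"
      unfolding \<beta>_def e by (simp add: algebra_simps)
    then show ?thesis unfolding k by (simp add: algebra_simps)
  qed
  finally have "pi * (r * norm (grad s z)) \<le> pi * (2 * s z + 2 * \<rho> * W0 * (7/12 + 31/240 * (\<epsilon> / (1 - \<epsilon>))) * r\<^sup>2)"
    by (simp add: distrib_left)
  then show ?thesis unfolding W0_def W_def by simp
qed

section \<open>The vorticity equation and the enstrophy balance\<close>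

lemma Ck_on_Suc_imp: "Ck_on (Suc k) S f \<Longrightarrow> Ck_on k S f"
proof (induction k arbitrary: f)
  case 0
  then show ?case
    by (auto intro!: continuous_at_imp_continuous_on differentiable_imp_continuous_within)
next
  case (Suc k)
  then show ?case by (metis Ck_on.simps(2))
qed

lemma Ck_on_mult:
  fixes f g :: "'a::euclidean_space \<Rightarrow> real"
  assumes "open S" shows "Ck_on k S f \<Longrightarrow> Ck_on k S g \<Longrightarrow> Ck_on k S (\<lambda>x. f x * g x)"
proof (induction k arbitrary: f g)
  case 0
  then show ?case by (simp add: continuous_on_mult)
next
  case (Suc k)
  have "Ck_on k S (ddir v (\<lambda>x. f x * g x))" for v
  proof (rule Ck_on_cong[OF assms])
    show "Ck_on k S (\<lambda>x. f x * ddir v g x + ddir v f x * g x)"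
      using Suc.prems Ck_on_Suc_imp[OF Suc.prems(1)] Ck_on_Suc_imp[OF Suc.prems(2)]
      by (intro Ck_on_add[OF assms] Suc.IH) (auto simp: ddir_def[abs_def])
  qed (use Suc.prems in \<open>simp add: ddir_mult\<close>)
  then show ?case using Suc.prems by (auto simp: ddir_def[abs_def])
qed

lemma smooth_on_mult:
  fixes f g :: "'a::euclidean_space \<Rightarrow> real"
  shows "open S \<Longrightarrow> smooth_on S f \<Longrightarrow> smooth_on S g \<Longrightarrow> smooth_on S (\<lambda>x. f x * g x)"
  unfolding smooth_on_def using Ck_on_mult by blast

lemma ddir_compose_linear:
  assumes "bounded_linear L" "f differentiable (at (L x))"
  shows "ddir v (\<lambda>x. f (L x)) x = ddir (L v) f (L x)" "(\<lambda>x. f (L x)) differentiable (at x)"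
proof -
  have "((\<lambda>x. f (L x)) has_derivative (\<lambda>v. ddir (L v) f (L x))) (at x)"
    by (rule has_derivative_compose[OF bounded_linear_imp_has_derivative[OF assms(1)] has_derivative_ddir[OF assms(2)]])
  then show "ddir v (\<lambda>x. f (L x)) x = ddir (L v) f (L x)" "(\<lambda>x. f (L x)) differentiable (at x)"
    by (auto simp: ddir_eqI differentiable_def)
qed

lemma smooth_on_compose_linear:
  fixes f :: "'b::euclidean_space \<Rightarrow> real"
  assumes L: "bounded_linear (L :: 'a::euclidean_space \<Rightarrow> 'b)" and f: "smooth_on UNIV f"
  shows "smooth_on UNIV (\<lambda>x. f (L x))"
proof -
  have "Ck_on k UNIV f \<Longrightarrow> Ck_on k UNIV (\<lambda>x. f (L x))" for k and f :: "'b \<Rightarrow> real"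
  proof (induction k arbitrary: f)
    case 0
    then show ?case
      by (auto intro: continuous_on_compose2[OF _ bounded_linear.continuous_on[OF L continuous_on_id]])
  next
    case (Suc k)
    have d: "f differentiable (at y)" for y using Suc.prems by auto
    have "Ck_on k UNIV (ddir v (\<lambda>x. f (L x)))" for v
      unfolding ddir_compose_linear(1)[OF L d, abs_def]
      using Suc.prems by (intro Suc.IH) (auto simp: ddir_def[abs_def])
    then show ?case using ddir_compose_linear(2)[OF L d] by (auto simp: ddir_def[abs_def])
  qed
  then show ?thesis using f unfolding smooth_on_def by blast
qed

abbreviation "dt \<equiv> ((1, 0) :: real \<times> (real^2))"
abbreviation "dx j \<equiv> ((0, axis j 1) :: real \<times> (real^2))"

lemma ddir_slice:
  assumes "f differentiable (at (t, x))"
  shows "partial j (\<lambda>y. f (t, y)) x = ddir (dx j) f (t, x)"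
    and "vector_derivative (\<lambda>s. f (s, x)) (at t) = ddir dt f (t, x)"
proof -
  have "((\<lambda>y. f (t, y)) has_derivative (\<lambda>v. ddir (0, v) f (t, x))) (at x)"
    by (rule has_derivative_compose[OF has_derivative_Pair[OF has_derivative_const has_derivative_ident]
        has_derivative_ddir[OF assms]])
  then show "partial j (\<lambda>y. f (t, y)) x = ddir (dx j) f (t, x)"
    unfolding partial_eq_ddir by (rule ddir_eqI)
  have "((\<lambda>s. f (s, x)) has_derivative (\<lambda>h. ddir (h, 0) f (t, x))) (at t)"
    by (rule has_derivative_compose[OF has_derivative_Pair[OF has_derivative_ident has_derivative_const]
        has_derivative_ddir[OF assms]])
  moreover have "(\<lambda>h. ddir (h, 0) f (t, x)) = (\<lambda>h. h *\<^sub>R ddir dt f (t, x))"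
  proof
    show "ddir (h, 0) f (t, x) = h *\<^sub>R ddir dt f (t, x)" for h
      unfolding ddir_scaleR_dir[OF assms, symmetric] by simp
  qed
  ultimately have "((\<lambda>s. f (s, x)) has_vector_derivative ddir dt f (t, x)) (at t)"
    by (simp only: has_vector_derivative_def)
  then show "vector_derivative (\<lambda>s. f (s, x)) (at t) = ddir dt f (t, x)"
    by (rule vector_derivative_at)
qed

locale nse_flow =
  fixes \<nu> T :: real and \<Omega> :: "(real^2) set" and u :: "real \<Rightarrow> real^2 \<Rightarrow> real^2"
    and p :: "real \<Rightarrow> real^2 \<Rightarrow> real" and \<eta> :: "real \<Rightarrow> real"
  assumes \<Omega>: "open \<Omega>" and sol: "smooth_NSE_solution \<nu> \<Omega> u p"
    and \<eta>: "test_function {0<..<2 * T} \<eta>"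
begin

definition "cyl = {0::real<..} \<times> \<Omega>"
definition "vel k = (\<lambda>q. u (fst q) (snd q) $ k)"
definition "prs = (\<lambda>q. p (fst q) (snd q))"
definition "vort = (\<lambda>q. ddir (dx 1) (vel 2) q - ddir (dx 2) (vel 1) q)"

lemma open_cyl: "open cyl"
  unfolding cyl_def by (intro open_Times \<Omega> open_greaterThan)

lemma smooth_U: "smooth_on cyl (\<lambda>q. u (fst q) (snd q))"
  using sol by (simp add: smooth_NSE_solution_def cyl_def case_prod_unfold)

lemma smooth_vel: "smooth_on cyl (vel k)"
  unfolding vel_def by (rule smooth_on_linear[OF open_cyl bounded_linear_vec_nth smooth_U])

lemma smooth_prs: "smooth_on cyl prs"
  using sol by (simp add: smooth_NSE_solution_def cyl_def case_prod_unfold prs_def)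

lemma smooth_vort: "smooth_on cyl vort"
  unfolding vort_def by (intro smooth_on_diff open_cyl smooth_on_ddir smooth_vel)

lemmas dvel = smooth_on_differentiable[OF smooth_vel]
lemmas ddvel = smooth_on_differentiable[OF smooth_on_ddir[OF smooth_vel]]
lemmas dddvel = smooth_on_differentiable[OF smooth_on_ddir[OF smooth_on_ddir[OF smooth_vel]]]

lemma open_\<Omega>_slice:
  assumes "(t, x) \<in> cyl" shows "t > 0" "x \<in> \<Omega>" "\<And>y. y \<in> \<Omega> \<Longrightarrow> (t, y) \<in> cyl"
  using assms by (auto simp: cyl_def)

lemma partial_u:
  assumes "(t, x) \<in> cyl"
  shows "partial j (u t) x = ddir (dx j) (\<lambda>q. u (fst q) (snd q)) (t, x)"
  using ddir_slice(1)[OF smooth_on_differentiable[OF smooth_U assms], of j] by simp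

lemma ddir_U_nth:
  assumes "q \<in> cyl"
  shows "ddir v (\<lambda>q. u (fst q) (snd q)) q $ k = ddir v (vel k) q"
  unfolding vel_def
  by (rule ddir_linear[OF bounded_linear_vec_nth smooth_on_differentiable[OF smooth_U assms], symmetric])

lemma partial_u_nth:
  assumes "(t, x) \<in> cyl" shows "partial j (\<lambda>y. u t y $ k) x = ddir (dx j) (vel k) (t, x)"
  using ddir_slice(1)[OF dvel[OF assms], of j k] by (simp add: vel_def)

lemma vorticity_eq: "(t, x) \<in> cyl \<Longrightarrow> vorticity (u t) x = vort (t, x)"
  by (simp add: vorticity_def vort_def partial_u_nth)

lemma laplacian_u_nth:
  assumes q: "(t, x) \<in> cyl"
  shows "laplacian (u t) x $ k = ddir (dx 1) (ddir (dx 1) (vel k)) (t, x) + ddir (dx 2) (ddir (dx 2) (vel k)) (t, x)"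
proof -
  have "partial j (partial j (u t)) x $ k = ddir (dx j) (ddir (dx j) (vel k)) (t, x)" for j
  proof -
    have "partial j (partial j (u t)) x = partial j (\<lambda>y. ddir (dx j) (\<lambda>q. u (fst q) (snd q)) (t, y)) x"
      unfolding partial_eq_ddir
      by (rule ddir_cong[OF \<Omega> open_\<Omega>_slice(2)[OF q]])
         (use partial_u open_\<Omega>_slice(3)[OF q] in \<open>simp add: partial_eq_ddir\<close>)
    also have "\<dots> = ddir (dx j) (ddir (dx j) (\<lambda>q. u (fst q) (snd q))) (t, x)"
      by (rule ddir_slice(1)[OF smooth_on_differentiable[OF smooth_on_ddir[OF smooth_U] q]])
    also have "\<dots> $ k = ddir (dx j) (\<lambda>q. ddir (dx j) (\<lambda>q. u (fst q) (snd q)) q $ k) (t, x)"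
      by (rule ddir_linear[OF bounded_linear_vec_nth smooth_on_differentiable[OF smooth_on_ddir[OF smooth_U] q], symmetric])
    also have "\<dots> = ddir (dx j) (ddir (dx j) (vel k)) (t, x)"
      by (rule ddir_cong[OF open_cyl q]) (rule ddir_U_nth)
    finally show ?thesis .
  qed
  then show ?thesis by (simp add: laplacian_def sum_2)
qed

lemma momentum:
  assumes q: "q \<in> cyl"
  shows "ddir dt (vel k) q - \<nu> * (ddir (dx 1) (ddir (dx 1) (vel k)) q + ddir (dx 2) (ddir (dx 2) (vel k)) q)
      + (vel 1 q * ddir (dx 1) (vel k) q + vel 2 q * ddir (dx 2) (vel k) q) + ddir (dx k) prs q = 0"
    and incompressible: "ddir (dx 1) (vel 1) q + ddir (dx 2) (vel 2) q = 0"
proof -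
  obtain t x where qt: "q = (t, x)" by (cases q)
  have d: "(t, x) \<in> cyl" using q qt by simp
  have eq: "vector_derivative (\<lambda>s. u s x) (at t) - \<nu> *\<^sub>R laplacian (u t) x
          + advect (u t x) (u t) x + grad (p t) x = 0" "div_op (u t) x = 0"
    using sol open_\<Omega>_slice[OF d] by (auto simp: smooth_NSE_solution_def)
  have "vector_derivative (\<lambda>s. u s x) (at t) = ddir dt (\<lambda>q. u (fst q) (snd q)) (t, x)"
    using ddir_slice(2)[OF smooth_on_differentiable[OF smooth_U d]] by simp
  then have 1: "vector_derivative (\<lambda>s. u s x) (at t) $ k = ddir dt (vel k) (t, x)"
    using ddir_U_nth[OF d] by simp
  have 2: "advect (u t x) (u t) x $ k = vel 1 (t, x) * ddir (dx 1) (vel k) (t, x) + vel 2 (t, x) * ddir (dx 2) (vel k) (t, x)"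
    by (simp add: advect_def sum_2 partial_u[OF d] ddir_U_nth[OF d]) (simp add: vel_def)
  have 3: "grad (p t) x $ k = ddir (dx k) prs (t, x)"
    using ddir_slice(1)[OF smooth_on_differentiable[OF smooth_prs d], of k] by (simp add: grad_def prs_def)
  have "(vector_derivative (\<lambda>s. u s x) (at t) - \<nu> *\<^sub>R laplacian (u t) x
          + advect (u t x) (u t) x + grad (p t) x) $ k = 0" using eq(1) by simp
  then show "ddir dt (vel k) q - \<nu> * (ddir (dx 1) (ddir (dx 1) (vel k)) q + ddir (dx 2) (ddir (dx 2) (vel k)) q)
      + (vel 1 q * ddir (dx 1) (vel k) q + vel 2 q * ddir (dx 2) (vel k) q) + ddir (dx k) prs q = 0"
    by (simp add: 1 2 3 laplacian_u_nth[OF d] qt)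
  show "ddir (dx 1) (vel 1) q + ddir (dx 2) (vel 2) q = 0"
    using eq(2) by (simp add: div_op_def sum_2 partial_u_nth[OF d] qt)
qed

lemma commute:
  assumes "smooth_on cyl f" "q \<in> cyl"
  shows "ddir v (ddir w f) q = ddir w (ddir v (f :: _ \<Rightarrow> real)) q"
  by (rule smooth_ddir_commute[OF open_cyl assms(2,1)])

lemma commute3:
  assumes f: "smooth_on cyl (f :: _ \<Rightarrow> real)" and q: "q \<in> cyl"
  shows "ddir v (ddir w (ddir w f)) q = ddir w (ddir w (ddir v f)) q"
proof -
  have "ddir v (ddir w (ddir w f)) q = ddir w (ddir v (ddir w f)) q"
    by (rule commute[OF smooth_on_ddir[OF f] q])
  also have "\<dots> = ddir w (ddir w (ddir v f)) q"
    by (rule ddir_cong[OF open_cyl q]) (rule commute[OF f])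
  finally show ?thesis .
qed

lemma ddir_momentum:
  assumes q: "q \<in> cyl"
  shows "ddir v (ddir dt (vel k)) q - \<nu> * (ddir v (ddir (dx 1) (ddir (dx 1) (vel k))) q + ddir v (ddir (dx 2) (ddir (dx 2) (vel k))) q)
      + (vel 1 q * ddir v (ddir (dx 1) (vel k)) q + ddir v (vel 1) q * ddir (dx 1) (vel k) q
        + (vel 2 q * ddir v (ddir (dx 2) (vel k)) q + ddir v (vel 2) q * ddir (dx 2) (vel k) q)) + ddir v (ddir (dx k) prs) q = 0"
proof -
  note d = dvel[OF q] ddvel[OF q] dddvel[OF q] smooth_on_differentiable[OF smooth_on_ddir[OF smooth_prs] q]
  define f1 where "f1 = ddir dt (vel k)"
  define f2 where "f2 = ddir (dx 1) (ddir (dx 1) (vel k))"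
  define f3 where "f3 = ddir (dx 2) (ddir (dx 2) (vel k))"
  define f4 where "f4 = ddir (dx 1) (vel k)"
  define f5 where "f5 = ddir (dx 2) (vel k)"
  define f6 where "f6 = ddir (dx k) prs"
  have df: "f1 differentiable (at q)" "f2 differentiable (at q)" "f3 differentiable (at q)"
    "f4 differentiable (at q)" "f5 differentiable (at q)" "f6 differentiable (at q)"
    unfolding f1_def f2_def f3_def f4_def f5_def f6_def by (rule d)+
  let ?E = "\<lambda>q. f1 q - \<nu> * (f2 q + f3 q) + (vel 1 q * f4 q + vel 2 q * f5 q) + f6 q"
  have "ddir v ?E q = ddir v (\<lambda>_. 0) q"
    by (rule ddir_cong[OF open_cyl q]) (use momentum(1) in \<open>simp add: f1_def f2_def f3_def f4_def f5_def f6_def\<close>)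
  moreover have "ddir v ?E q = ddir v f1 q - \<nu> * (ddir v f2 q + ddir v f3 q)
      + (vel 1 q * ddir v f4 q + ddir v (vel 1) q * f4 q + (vel 2 q * ddir v f5 q + ddir v (vel 2) q * f5 q)) + ddir v f6 q"
    using df d(1) by (simp add: ddir_add ddir_diff ddir_mult ddir_cmult ddir_const)
  ultimately show ?thesis
    by (simp add: ddir_const f1_def f2_def f3_def f4_def f5_def f6_def)
qed

text \<open>The curl of the momentum equation: the pressure drops out by symmetry of second derivatives, and
  the stretching terms cancel in two dimensions by incompressibility.\<close>

lemma vorticity_equation:
  assumes q: "q \<in> cyl"
  shows "ddir dt vort q - \<nu> * (ddir (dx 1) (ddir (dx 1) vort) q + ddir (dx 2) (ddir (dx 2) vort) q)
     + (vel 1 q * ddir (dx 1) vort q + vel 2 q * ddir (dx 2) vort q) = 0"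
proof -
  note s = smooth_vel
  have dv: "ddir v vort q = ddir v (ddir (dx 1) (vel 2)) q - ddir v (ddir (dx 2) (vel 1)) q" if "q \<in> cyl" for v q
    unfolding vort_def by (rule ddir_diff[OF ddvel[OF that] ddvel[OF that]])
  have ddv: "ddir v (ddir v vort) q = ddir (dx 1) (ddir v (ddir v (vel 2))) q - ddir (dx 2) (ddir v (ddir v (vel 1))) q" for v
  proof -
    have "ddir v (ddir v vort) q = ddir v (\<lambda>q. ddir v (ddir (dx 1) (vel 2)) q - ddir v (ddir (dx 2) (vel 1)) q) q"
      by (rule ddir_cong[OF open_cyl q]) (rule dv)
    also have "\<dots> = ddir v (ddir v (ddir (dx 1) (vel 2))) q - ddir v (ddir v (ddir (dx 2) (vel 1))) q"
      by (rule ddir_diff[OF dddvel[OF q] dddvel[OF q]])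
    finally show ?thesis by (simp only: commute3[OF s q])
  qed
  have e2: "ddir (dx 1) (ddir dt (vel 2)) q = ddir dt (ddir (dx 1) (vel 2)) q"
    "ddir (dx 2) (ddir dt (vel 1)) q = ddir dt (ddir (dx 2) (vel 1)) q"
    "ddir (dx 1) (ddir (dx 2) (vel 2)) q = ddir (dx 2) (ddir (dx 1) (vel 2)) q"
    "ddir (dx 2) (ddir (dx 1) (vel 1)) q = ddir (dx 1) (ddir (dx 2) (vel 1)) q"
    "ddir (dx 2) (ddir (dx 1) prs) q = ddir (dx 1) (ddir (dx 2) prs) q"
    by (rule commute[OF s q] commute[OF smooth_prs q])+
  have i: "ddir (dx 1) (vel 1) q = - ddir (dx 2) (vel 2) q" using incompressible[OF q] by simp
  show ?thesis
    using ddir_momentum[OF q, of "dx 1" 2] ddir_momentum[OF q, of "dx 2" 1]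
    unfolding dv[OF q] ddv e2 i by (simp add: algebra_simps)
qed

definition "win = {0<..<2 * T} \<times> \<Omega>"

lemma win: "win \<subseteq> cyl" "win \<in> sets borel"
proof -
  show "win \<subseteq> cyl" by (auto simp: win_def cyl_def)
  have "open win" unfolding win_def by (intro open_Times \<Omega> open_greaterThanLessThan)
  then show "win \<in> sets borel" by simp
qed

lemma \<eta>_facts:
  shows "smooth_on UNIV \<eta>" "deriv \<eta> t = ddir 1 \<eta> t"
proof -
  show s: "smooth_on UNIV \<eta>" using \<eta> by (simp add: test_function_def)
  have "(\<eta> has_derivative (\<lambda>h. ddir h \<eta> t)) (at t)"
    by (rule has_derivative_ddir[OF smooth_on_differentiable[OF s]]) simp
  moreover have "(\<lambda>h. ddir h \<eta> t) = (*) (ddir 1 \<eta> t)"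
  proof
    show "ddir h \<eta> t = ddir 1 \<eta> t * h" for h
      using ddir_scaleR_dir[OF smooth_on_differentiable[OF s UNIV_I], of h 1 t] by simp
  qed
  ultimately have "(\<eta> has_real_derivative ddir 1 \<eta> t) (at t)" by (simp add: has_field_derivative_def)
  then show "deriv \<eta> t = ddir 1 \<eta> t" by (rule DERIV_imp_deriv)
qed

text \<open>The four integrands of the argument, as functions of \<open>q = (t, x)\<close>. The last one is the divergence of
  \<open>\<eta> w\<^sup>2 \<nabla>\<Phi>\<close>, with \<open>w\<close> the vorticity.\<close>

definition "flux_density \<Phi> = (\<lambda>q. 1/2 * (vort q)\<^sup>2 * (\<eta> (fst q) *
    (vel 1 q * ddir (axis 1 1) \<Phi> (snd q) + vel 2 q * ddir (axis 2 1) \<Phi> (snd q))))"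
definition "dissipation_density \<Phi> = (\<lambda>q. ((ddir (dx 1) vort q)\<^sup>2 + (ddir (dx 2) vort q)\<^sup>2) * (\<eta> (fst q) * \<Phi> (snd q)))"
definition "error_density \<Phi> = (\<lambda>q. 1/2 * (vort q)\<^sup>2 * (deriv \<eta> (fst q) * \<Phi> (snd q) + \<nu> * (\<eta> (fst q) * laplacian \<Phi> (snd q))))"
definition "cross_density \<Phi> = (\<lambda>q. \<eta> (fst q) * (2 * vort q * (ddir (dx 1) vort q * ddir (axis 1 1) \<Phi> (snd q)
    + ddir (dx 2) vort q * ddir (axis 2 1) \<Phi> (snd q)) + (vort q)\<^sup>2 * laplacian \<Phi> (snd q)))"

context
  fixes \<Phi> :: "real^2 \<Rightarrow> real"
  assumes \<Phi>: "test_function \<Omega> \<Phi>"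
begin

definition "supp = closure {t. \<eta> t \<noteq> 0} \<times> closure {x. \<Phi> x \<noteq> 0}"

lemma supp: "compact supp" "supp \<subseteq> win"
  using \<eta> \<Phi> unfolding test_function_def supp_def win_def by (auto intro: compact_Times)

lemma \<Phi>_smooth: "smooth_on UNIV \<Phi>"
  using \<Phi> by (simp add: test_function_def)

lemma outside_supp:
  assumes "q \<notin> supp"
  shows "\<eta> (fst q) = 0 \<and> deriv \<eta> (fst q) = 0 \<or>
    \<Phi> (snd q) = 0 \<and> ddir v \<Phi> (snd q) = 0 \<and> laplacian \<Phi> (snd q) = 0"
proof (cases "fst q \<in> closure {t. \<eta> t \<noteq> 0}")
  case False
  have z: "\<eta> t = 0" if "t \<notin> closure {t. \<eta> t \<noteq> 0}" for t
    using that closure_subset[of "{t. \<eta> t \<noteq> 0}"] by blast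
  have "ddir 1 \<eta> (fst q) = 0" by (rule ddir_zero_outside[OF closed_closure z False])
  then show ?thesis using z[OF False] by (simp only: \<eta>_facts(2) simp_thms)
next
  case True
  then have sq: "snd q \<notin> closure {x. \<Phi> x \<noteq> 0}" using assms by (cases q) (auto simp: supp_def)
  have z: "\<Phi> x = 0" if "x \<notin> closure {x. \<Phi> x \<noteq> 0}" for x
    using that closure_subset[of "{x. \<Phi> x \<noteq> 0}"] by blast
  have z1: "ddir v \<Phi> x = 0" if "x \<notin> closure {x. \<Phi> x \<noteq> 0}" for x v
    using ddir_zero_outside[OF closed_closure z that] .
  have z2: "ddir v (ddir v \<Phi>) x = 0" if "x \<notin> closure {x. \<Phi> x \<noteq> 0}" for x v
    using ddir_zero_outside[OF closed_closure z1 that] .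
  show ?thesis by (simp only: laplacian_eq_ddir z[OF sq] z1[OF sq] z2[OF sq]) simp
qed

lemma set_integrable_win:
  assumes "continuous_on cyl h" "\<And>q. q \<notin> supp \<Longrightarrow> h q = (0::real)"
  shows "set_integrable lborel win h"
proof -
  have "integrable lborel (\<lambda>q. indicator supp q *\<^sub>R h q)"
    using supp win(1) by (intro borel_integrable_compact continuous_on_subset[OF assms(1)]) auto
  moreover have "(\<lambda>q. indicator supp q *\<^sub>R h q) = (\<lambda>q. indicator win q *\<^sub>R h q)"
  proof
    show "indicator supp q *\<^sub>R h q = indicator win q *\<^sub>R h q" for q
      using assms(2)[of q] supp(2) by (cases "q \<in> supp") auto
  qed
  ultimately show ?thesis unfolding set_integrable_def by metis
qed

lemma cont_pieces:
  "continuous_on cyl vort" "continuous_on cyl (ddir v vort)" "continuous_on cyl (vel k)"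
  "continuous_on cyl (\<lambda>q. \<eta> (fst q))" "continuous_on cyl (\<lambda>q. deriv \<eta> (fst q))"
  "continuous_on cyl (\<lambda>q. \<Phi> (snd q))" "continuous_on cyl (\<lambda>q. ddir w \<Phi> (snd q))" "continuous_on cyl (\<lambda>q. laplacian \<Phi> (snd q))"
proof -
  have c: "continuous_on cyl (\<lambda>q. f (fst q))" if "continuous_on UNIV f" for f :: "real \<Rightarrow> real"
    by (rule continuous_on_compose2[OF that]) (auto intro!: continuous_intros)
  have d: "continuous_on cyl (\<lambda>q. f (snd q))" if "continuous_on UNIV f" for f :: "real^2 \<Rightarrow> real"
    by (rule continuous_on_compose2[OF that]) (auto intro!: continuous_intros)
  note s = smooth_on_continuous smooth_on_ddir
  show "continuous_on cyl vort" "continuous_on cyl (ddir v vort)" "continuous_on cyl (vel k)"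
    by (rule s(1) smooth_vort smooth_vel s(2))+
  show "continuous_on cyl (\<lambda>q. \<eta> (fst q))" by (rule c[OF s(1)[OF \<eta>_facts(1)]])
  show "continuous_on cyl (\<lambda>q. deriv \<eta> (fst q))" unfolding \<eta>_facts(2) by (rule c[OF s(1)[OF s(2)[OF \<eta>_facts(1)]]])
  show "continuous_on cyl (\<lambda>q. \<Phi> (snd q))" by (rule d[OF s(1)[OF \<Phi>_smooth]])
  show "continuous_on cyl (\<lambda>q. ddir w \<Phi> (snd q))" by (rule d[OF s(1)[OF s(2)[OF \<Phi>_smooth]]])
  show "continuous_on cyl (\<lambda>q. laplacian \<Phi> (snd q))" by (rule d[OF laplacian_continuous[OF \<Phi>_smooth]])
qed

lemma integrable_densities:
  "set_integrable lborel win (flux_density \<Phi>)" "set_integrable lborel win (dissipation_density \<Phi>)"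
  "set_integrable lborel win (error_density \<Phi>)" "set_integrable lborel win (cross_density \<Phi>)"
proof -
  note o = outside_supp[of _ "axis 1 1"] outside_supp[of _ "axis 2 1"]
  show "set_integrable lborel win (flux_density \<Phi>)"
  proof (rule set_integrable_win)
    show "continuous_on cyl (flux_density \<Phi>)" unfolding flux_density_def
      by (intro continuous_on_mult continuous_on_add continuous_on_power continuous_on_const cont_pieces)
    show "flux_density \<Phi> q = 0" if "q \<notin> supp" for q using o[OF that] by (auto simp: flux_density_def)
  qed
  show "set_integrable lborel win (dissipation_density \<Phi>)"
  proof (rule set_integrable_win)
    show "continuous_on cyl (dissipation_density \<Phi>)" unfolding dissipation_density_def
      by (intro continuous_on_mult continuous_on_add continuous_on_power continuous_on_const cont_pieces)
    show "dissipation_density \<Phi> q = 0" if "q \<notin> supp" for q using o[OF that] by (auto simp: dissipation_density_def)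
  qed
  show "set_integrable lborel win (error_density \<Phi>)"
  proof (rule set_integrable_win)
    show "continuous_on cyl (error_density \<Phi>)" unfolding error_density_def
      by (intro continuous_on_mult continuous_on_add continuous_on_power continuous_on_const cont_pieces)
    show "error_density \<Phi> q = 0" if "q \<notin> supp" for q using o[OF that] by (auto simp: error_density_def)
  qed
  show "set_integrable lborel win (cross_density \<Phi>)"
  proof (rule set_integrable_win)
    show "continuous_on cyl (cross_density \<Phi>)" unfolding cross_density_def
      by (intro continuous_on_mult continuous_on_add continuous_on_power continuous_on_const cont_pieces)
    show "cross_density \<Phi> q = 0" if "q \<notin> supp" for q using o[OF that] by (auto simp: cross_density_def)
  qed
qed

lemma smooth_pieces:
  "smooth_on cyl (\<lambda>q. \<eta> (fst q))" "smooth_on cyl (\<lambda>q. \<Phi> (snd q))"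
  "smooth_on cyl (\<lambda>q. ddir w \<Phi> (snd q))"
  by (rule smooth_on_subset[OF smooth_on_compose_linear[OF bounded_linear_fst \<eta>_facts(1)] subset_UNIV]
      smooth_on_subset[OF smooth_on_compose_linear[OF bounded_linear_snd \<Phi>_smooth] subset_UNIV]
      smooth_on_subset[OF smooth_on_compose_linear[OF bounded_linear_snd smooth_on_ddir[OF \<Phi>_smooth]] subset_UNIV])+

lemma ddir_pieces:
  "ddir (a, v) (\<lambda>q::real\<times>(real^2). \<eta> (fst q)) q = ddir a \<eta> (fst q)"
  "ddir (a, v) (\<lambda>q::real\<times>(real^2). \<Phi> (snd q)) q = ddir v \<Phi> (snd q)"
  "ddir (a, v) (\<lambda>q::real\<times>(real^2). ddir w \<Phi> (snd q)) q = ddir v (ddir w \<Phi>) (snd q)"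
  using ddir_compose_linear(1)[OF bounded_linear_fst, of \<eta> q "(a, v)"]
    ddir_compose_linear(1)[OF bounded_linear_snd, of \<Phi> q "(a, v)"]
    ddir_compose_linear(1)[OF bounded_linear_snd, of "ddir w \<Phi>" q "(a, v)"]
    smooth_on_differentiable[OF \<eta>_facts(1)] v_diff[OF \<Phi>_smooth] by simp_all

lemma ddir_dir_zero: "f differentiable (at x) \<Longrightarrow> ddir 0 f x = 0"
  using ddir_scaleR_dir[of f x 0 0] by simp

lemma integral_divergence:
  assumes "smooth_on cyl (F :: _ \<Rightarrow> real)" "\<And>q. q \<notin> supp \<Longrightarrow> F q = 0"
  shows "set_integrable lborel win (ddir v F)" "(LINT q:win|lborel. ddir v F q) = 0"
proof -
  have "integrable lborel (ddir v F) \<and> (\<integral>x. ddir v F x \<partial>lborel) = 0"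
  proof (rule integral_ddir_eq_0_on[OF open_cyl _ supp(1) assms(2)])
    show "continuous_on cyl (ddir v F)" by (rule smooth_on_continuous[OF smooth_on_ddir[OF assms(1)]])
  qed (use supp(2) win(1) smooth_on_differentiable[OF assms(1)] in auto)
  moreover have "(\<lambda>q. indicator win q *\<^sub>R ddir v F q) = ddir v F"
  proof -
    have "ddir v F q = 0" if "q \<notin> supp" for q
      by (rule ddir_zero_outside[OF compact_imp_closed[OF supp(1)] assms(2) that])
    then show ?thesis using supp(2) by (auto simp: fun_eq_iff indicator_def)
  qed
  ultimately show "set_integrable lborel win (ddir v F)" "(LINT q:win|lborel. ddir v F q) = 0"
    by (simp_all add: set_integrable_def set_lebesgue_integral_def)
qed

text \<open>The integrand is a spatial divergence with compact support. This null integral is what makes the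
  completion of squares possible later.\<close>

lemma cross_integral: "(LINT q:win|lborel. cross_density \<Phi> q) = 0"
proof -
  define F where "F j = (\<lambda>q. \<eta> (fst q) * (vort q * vort q) * ddir (axis j 1) \<Phi> (snd q))" for j
  have s: "smooth_on cyl (F j)" for j
    unfolding F_def by (intro smooth_on_mult open_cyl smooth_pieces smooth_vort)
  have z: "F j q = 0" if "q \<notin> supp" for j q
    using outside_supp[OF that, of "axis j 1"] by (auto simp: F_def)
  have "cross_density \<Phi> q = ddir (dx 1) (F 1) q + ddir (dx 2) (F 2) q" if q: "q \<in> win" for q
  proof -
    have qc: "q \<in> cyl" using q win(1) by blast
    have d: "(\<lambda>q. \<eta> (fst q)) differentiable (at q)" "vort differentiable (at q)"
        "(\<lambda>q. ddir w \<Phi> (snd q)) differentiable (at q)" for w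
      by (rule smooth_on_differentiable[OF _ qc], rule smooth_pieces smooth_vort)+
    have "ddir (dx j) (F j) q = \<eta> (fst q) * (vort q * vort q) * ddir (axis j 1) (ddir (axis j 1) \<Phi>) (snd q)
       + \<eta> (fst q) * (2 * vort q * ddir (dx j) vort q) * ddir (axis j 1) \<Phi> (snd q)" for j
      unfolding F_def using d
      by (simp add: ddir_mult ddir_pieces ddir_dir_zero smooth_on_differentiable[OF \<eta>_facts(1)])
    then show ?thesis
      by (simp add: cross_density_def laplacian_eq_ddir power2_eq_square algebra_simps)
  qed
  then have "(LINT q:win|lborel. cross_density \<Phi> q) = (LINT q:win|lborel. ddir (dx 1) (F 1) q + ddir (dx 2) (F 2) q)"
    using win(2) by (intro set_lebesgue_integral_cong) auto
  also have "\<dots> = 0"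
    using integral_divergence[OF s z] by (subst set_integral_add(2)) auto
  finally show ?thesis .
qed

text \<open>The vorticity equation multiplied by \<open>w \<eta> \<Phi>\<close>: the difference of the two sides is the space-time divergence
  of \<open>F0\<close>, \<open>F 1\<close>, \<open>F 2\<close>.\<close>

lemma energy_identity:
  "(LINT q:win|lborel. flux_density \<Phi> q) =
     \<nu> * (LINT q:win|lborel. dissipation_density \<Phi> q) - (LINT q:win|lborel. error_density \<Phi> q)"
proof -
  define h :: real where "h = 1/2"
  define F0 where "F0 = (\<lambda>q. h * ((vort q * vort q) * (\<eta> (fst q) * \<Phi> (snd q))))"
  define F where "F j = (\<lambda>q. h * ((vort q * vort q) * ((\<eta> (fst q) * \<Phi> (snd q)) * vel j q))
     + ((h * \<nu>) * (\<eta> (fst q) * ((vort q * vort q) * ddir (axis j 1) \<Phi> (snd q)))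
      - \<nu> * (vort q * (ddir (dx j) vort q * (\<eta> (fst q) * \<Phi> (snd q))))))" for j
  have s0: "smooth_on cyl F0"
    unfolding F0_def by (intro smooth_on_cmult smooth_on_mult open_cyl smooth_pieces smooth_vort)
  have s: "smooth_on cyl (F j)" for j
    unfolding F_def by (intro smooth_on_add smooth_on_diff smooth_on_cmult smooth_on_mult open_cyl smooth_pieces
        smooth_vort smooth_vel smooth_on_ddir)
  have z0: "F0 q = 0" if "q \<notin> supp" for q
    using outside_supp[OF that] by (auto simp: F0_def)
  have z: "F j q = 0" if "q \<notin> supp" for j q
    using outside_supp[OF that, of "axis j 1"] by (auto simp: F_def)
  have "flux_density \<Phi> q = (ddir dt F0 q + (ddir (dx 1) (F 1) q + ddir (dx 2) (F 2) q))
      + \<nu> * dissipation_density \<Phi> q - error_density \<Phi> q" if q: "q \<in> win" for q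
  proof -
    have qc: "q \<in> cyl" using q win(1) by blast
    have d: "(\<lambda>q. \<eta> (fst q)) differentiable (at q)" "vort differentiable (at q)" "(\<lambda>q. \<Phi> (snd q)) differentiable (at q)"
        "(\<lambda>q. ddir w \<Phi> (snd q)) differentiable (at q)" "ddir v vort differentiable (at q)" "vel k differentiable (at q)" for w v k
      by (rule smooth_on_differentiable[OF _ qc], rule smooth_pieces smooth_vort smooth_vel smooth_on_ddir[OF smooth_vort])+
    define W where "W = vort q" define e where "e = \<eta> (fst q)" define f where "f = \<Phi> (snd q)"
    define e' where "e' = ddir 1 \<eta> (fst q)"
    have dt0: "ddir dt F0 q = W * ddir dt vort q * (e * f) * (2 * h) + h * (W * W) * (e' * f)"
      unfolding F0_def using d
      by (simp add: ddir_mult ddir_const ddir_pieces ddir_dir_zero v_diff[OF \<Phi>_smooth]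
          W_def[symmetric] e_def[symmetric] f_def[symmetric] e'_def[symmetric]) (simp add: algebra_simps)
    have dj: "ddir (dx j) (F j) q = W * ddir (dx j) vort q * (e * f * vel j q) * (2 * h)
        + h * (W * W) * e * (ddir (axis j 1) \<Phi> (snd q) * vel j q + f * ddir (dx j) (vel j) q)
        + h * \<nu> * e * (W * W) * ddir (axis j 1) (ddir (axis j 1) \<Phi>) (snd q)
        + (2 * h - 1) * \<nu> * e * W * ddir (dx j) vort q * ddir (axis j 1) \<Phi> (snd q)
        - \<nu> * (e * f) * ((ddir (dx j) vort q)\<^sup>2 + W * ddir (dx j) (ddir (dx j) vort) q)" for j
      unfolding F_def using d
      by (simp add: ddir_add ddir_diff ddir_mult ddir_const ddir_pieces ddir_dir_zero smooth_on_differentiable[OF \<eta>_facts(1)]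
          W_def[symmetric] e_def[symmetric] f_def[symmetric] power2_eq_square) (simp add: algebra_simps)
    have vt: "ddir dt vort q = \<nu> * (ddir (dx 1) (ddir (dx 1) vort) q + ddir (dx 2) (ddir (dx 2) vort) q)
     - (vel 1 q * ddir (dx 1) vort q + vel 2 q * ddir (dx 2) vort q)" using vorticity_equation[OF qc] by simp
    have i: "ddir (dx 1) (vel 1) q = - ddir (dx 2) (vel 2) q" using incompressible[OF qc] by simp
    show ?thesis
      unfolding dt0 dj vt i flux_density_def dissipation_density_def error_density_def \<eta>_facts(2)
        laplacian_eq_ddir W_def[symmetric] e_def[symmetric] f_def[symmetric] e'_def[symmetric] h_def
      by (simp add: power2_eq_square algebra_simps)
  qed
  then have "(LINT q:win|lborel. flux_density \<Phi> q) = (LINT q:win|lborel. (ddir dt F0 q + (ddir (dx 1) (F 1) q + ddir (dx 2) (F 2) q))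
      + \<nu> * dissipation_density \<Phi> q - error_density \<Phi> q)"
    using win(2) by (intro set_lebesgue_integral_cong) auto
  also have "\<dots> = \<nu> * (LINT q:win|lborel. dissipation_density \<Phi> q) - (LINT q:win|lborel. error_density \<Phi> q)"
    using integral_divergence[OF s z] integral_divergence[OF s0 z0] integrable_densities
    by (simp add: set_integral_add set_integral_diff)
  finally show ?thesis .
qed

end

lemma densities_eq:
  assumes "smooth_on UNIV \<Phi>"
  shows "enstrophy_flux T \<Omega> u (\<lambda>t x. \<eta> t * \<Phi> x) = 1 / T * (LINT q:win|lborel. flux_density \<Phi> q)"
    and "avg_palinstrophy T \<Omega> u (\<lambda>t x. \<eta> t * \<Phi> x) = 1 / T * (LINT q:win|lborel. dissipation_density \<Phi> q)"
    and "avg_enstrophy \<delta> T \<Omega> u (\<lambda>t x. \<eta> t * \<Phi> x) = 1 / T * (LINT q:win|lborel. 1/2 * (vort q)\<^sup>2 * (\<eta> (fst q) * \<Phi> (snd q)) powr (2 * \<delta> - 1))"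
proof -
  have gr: "grad (\<lambda>x. \<eta> t * \<Phi> x) x $ j = \<eta> t * ddir (axis j 1) \<Phi> x" for t x j
    by (simp add: grad_def partial_eq_ddir ddir_cmult v_diff[OF assms])
  have gv: "grad (vorticity (u t)) x $ j = ddir (dx j) vort (t, x)" if q: "(t, x) \<in> cyl" for t x j
  proof -
    have "partial j (vorticity (u t)) x = partial j (\<lambda>y. vort (t, y)) x"
      unfolding partial_eq_ddir
      by (rule ddir_cong[OF \<Omega> open_\<Omega>_slice(2)[OF q]]) (rule vorticity_eq[OF open_\<Omega>_slice(3)[OF q]])
    then show ?thesis
      by (simp add: grad_def ddir_slice(1)[OF smooth_on_differentiable[OF smooth_vort q]])
  qed
  have "(1/2 * \<bar>vorticity (u t) x\<bar>\<^sup>2 * (u t x \<bullet> grad (\<lambda>x. \<eta> t * \<Phi> x) x)) = flux_density \<Phi> (t, x)" if "(t, x) \<in> win" for t x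
  proof -
    have q: "(t, x) \<in> cyl" using that win(1) by blast
    have "u t x \<bullet> grad (\<lambda>x. \<eta> t * \<Phi> x) x = \<eta> t * (vel 1 (t, x) * ddir (axis 1 1) \<Phi> x + vel 2 (t, x) * ddir (axis 2 1) \<Phi> x)"
      unfolding inner_vec_def sum_2 gr by (simp add: vel_def algebra_simps)
    then show ?thesis by (simp add: vorticity_eq[OF q] flux_density_def)
  qed
  then show "enstrophy_flux T \<Omega> u (\<lambda>t x. \<eta> t * \<Phi> x) = 1 / T * (LINT q:win|lborel. flux_density \<Phi> q)"
    unfolding enstrophy_flux_def win_def[symmetric] using win(2)
    by (intro arg_cong[where f = "\<lambda>x. 1 / T * x"] set_lebesgue_integral_cong) auto
  have "(norm (grad (vorticity (u t)) x))\<^sup>2 * (\<eta> t * \<Phi> x) = dissipation_density \<Phi> (t, x)" if "(t, x) \<in> win" for t x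
    using that win(1) by (auto simp: norm_real2 gv dissipation_density_def subset_iff)
  then show "avg_palinstrophy T \<Omega> u (\<lambda>t x. \<eta> t * \<Phi> x) = 1 / T * (LINT q:win|lborel. dissipation_density \<Phi> q)"
    unfolding avg_palinstrophy_def win_def[symmetric] using win(2)
    by (intro arg_cong[where f = "\<lambda>x. 1 / T * x"] set_lebesgue_integral_cong) auto
  show "avg_enstrophy \<delta> T \<Omega> u (\<lambda>t x. \<eta> t * \<Phi> x) = 1 / T * (LINT q:win|lborel. 1/2 * (vort q)\<^sup>2 * (\<eta> (fst q) * \<Phi> (snd q)) powr (2 * \<delta> - 1))"
    unfolding avg_enstrophy_def win_def[symmetric] using win
    by (intro arg_cong[where f = "\<lambda>x. 1 / T * x"] set_lebesgue_integral_cong) (auto simp: vorticity_eq subset_iff)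
qed

end

section \<open>Geometry of the covering\<close>

text \<open>Pointwise information about the cut-offs is available only off a closed set without interior points; this
  lemma transports inequalities between continuous functions across it.\<close>

lemma le_by_density:
  fixes f g :: "'a::topological_space \<Rightarrow> real"
  assumes "interior B = {}" "open V" "z \<in> V" "continuous_on V f" "continuous_on V g"
    and le: "\<And>y. y \<in> V \<Longrightarrow> y \<notin> B \<Longrightarrow> f y \<le> g y"
  shows "f z \<le> g z"
proof (rule ccontr)
  assume "\<not> f z \<le> g z"
  let ?W = "{y \<in> V. 0 < f y - g y}"
  have "open ?W"
  proof -
    have "continuous_on V (\<lambda>y. f y - g y)" using assms by (intro continuous_on_diff)
    then have "open ((\<lambda>y. f y - g y) -` {0<..} \<inter> V)"
      using assms(2) continuous_on_open_vimage[of V] open_greaterThan by blast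
    moreover have "(\<lambda>y. f y - g y) -` {0<..} \<inter> V = ?W" by auto
    ultimately show ?thesis by simp
  qed
  moreover have "?W \<subseteq> B" using le by force
  ultimately have "?W \<subseteq> interior B" by (rule interior_maximal[rotated])
  then show False using assms \<open>\<not> f z \<le> g z\<close> by auto
qed

lemma interior_finite_Union_empty:
  assumes "finite F" "\<And>S. S \<in> F \<Longrightarrow> closed S \<and> interior S = {}"
  shows "interior (\<Union>F) = {}"
  using assms
proof (induction F)
  case (insert S F)
  have "closed (\<Union>F)" using insert by (intro closed_Union) auto
  then show ?case using interior_closed_Un_empty_interior[of "\<Union>F" S] insert by (simp add: Un_commute)
qed simp

lemma inner_real2: "(x::real^2) \<bullet> y = x$1 * y$1 + x$2 * y$2"
  by (simp add: inner_vec_def sum_2)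

text \<open>Inside a ball of such points, average the equation over \<open>z + w\<close> and \<open>z - w\<close> with \<open>w\<close> orthogonal
  to \<open>z\<close>: the left side is linear, whereas both norms on the right exceed \<open>norm z\<close>.\<close>

lemma interior_cone_empty:
  fixes a :: "real^2"
  assumes "k > 0"
  shows "interior {z. a \<bullet> z = k * norm z} = {}"
proof (rule ccontr)
  assume "interior {z. a \<bullet> z = k * norm z} \<noteq> {}"
  then obtain z0 where "z0 \<in> interior {z. a \<bullet> z = k * norm z}" by blast
  then obtain r where r: "r > 0" "ball z0 r \<subseteq> {z. a \<bullet> z = k * norm z}"
    unfolding mem_interior by blast
  obtain z r' where z: "z \<noteq> 0" "r' > 0" "ball z r' \<subseteq> {z. a \<bullet> z = k * norm z}"
  proof (cases "z0 = 0")
    case False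
    then show ?thesis using that r by blast
  next
    case True
    let ?z = "(r/2) *\<^sub>R (axis 1 1 :: real^2)"
    have nz: "norm ?z = r/2" using r by (simp add: norm_axis_1)
    have "ball ?z (r/2) \<subseteq> ball z0 r"
      unfolding True ball_subset_ball_iff using r(1) by (simp add: dist_norm norm_axis_1)
    then have "ball ?z (r/2) \<subseteq> {z. a \<bullet> z = k * norm z}" using r(2) by (rule order_trans)
    moreover have "?z \<noteq> 0" using r by (simp add: axis_eq_0_iff)
    moreover have "r/2 > 0" using r by simp
    ultimately show ?thesis using that by blast
  qed
  define h where "h = r' / (2 * norm z)"
  define w where "w = h *\<^sub>R rot z"
  have h: "h > 0" using z by (simp add: h_def)
  have nr: "norm (rot z) = norm z"
  proof -
    have "(norm (rot z))\<^sup>2 = (norm z)\<^sup>2" unfolding norm_real2 by simp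
    then show ?thesis by simp
  qed
  have nw: "norm w = r'/2" using z h by (simp add: w_def nr h_def)
  have zw: "(norm (z + w))\<^sup>2 = (1 + h\<^sup>2) * (norm z)\<^sup>2" "(norm (z - w))\<^sup>2 = (1 + h\<^sup>2) * (norm z)\<^sup>2"
  proof -
    have "(a - h * b)\<^sup>2 + (b + h * a)\<^sup>2 = (1 + h\<^sup>2) * (a\<^sup>2 + b\<^sup>2)"
      "(a + h * b)\<^sup>2 + (b - h * a)\<^sup>2 = (1 + h\<^sup>2) * (a\<^sup>2 + b\<^sup>2)" for a b :: real by algebra+
    then show "(norm (z + w))\<^sup>2 = (1 + h\<^sup>2) * (norm z)\<^sup>2" "(norm (z - w))\<^sup>2 = (1 + h\<^sup>2) * (norm z)\<^sup>2"
      unfolding norm_real2 w_def by simp_all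
  qed
  have "z + w \<in> ball z r'" "z - w \<in> ball z r'" "z \<in> ball z r'" using nw z by (simp_all add: dist_norm)
  then have e: "a \<bullet> (z + w) = k * norm (z + w)" "a \<bullet> (z - w) = k * norm (z - w)" "a \<bullet> z = k * norm z"
    using subsetD[OF z(3)] by simp_all
  have lt: "norm z < norm (z + w)" "norm z < norm (z - w)"
  proof -
    have "(norm z)\<^sup>2 < (1 + h\<^sup>2) * (norm z)\<^sup>2" using h z by (simp add: distrib_right)
    then have l: "(norm z)\<^sup>2 < (norm (z + w))\<^sup>2" "(norm z)\<^sup>2 < (norm (z - w))\<^sup>2" using zw by simp_all
    show "norm z < norm (z + w)" by (rule power2_less_imp_less[OF l(1) norm_ge_zero])
    show "norm z < norm (z - w)" by (rule power2_less_imp_less[OF l(2) norm_ge_zero])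
  qed
  have "k * norm (z + w) + k * norm (z - w) = 2 * (k * norm z)"
    using e by (simp add: inner_add_right inner_diff_right)
  moreover have "k * norm z < k * norm (z + w)" "k * norm z < k * norm (z - w)"
    using lt assms by simp_all
  ultimately show False by linarith
qed

lemma interior_frontier_closed:
  assumes "closed S" shows "interior (frontier S) = {}"
proof -
  have "frontier S \<subseteq> S" using assms by (simp add: frontier_subset_closed)
  then have "interior (frontier S) \<subseteq> interior S" by (rule interior_mono)
  moreover have "interior (frontier S) \<subseteq> frontier S" by (rule interior_subset)
  ultimately show ?thesis by (auto simp: frontier_def)
qed

lemma interior_sphere_empty: "interior (sphere (0::real^2) r) = {}"
  using interior_frontier_closed[OF closed_cball, of "0::real^2" r] by (simp only: frontier_cball)

text \<open>Moving a point of the circle outwards along its ray increases the distance to every point of the disc. This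
  lets shells met in the annulus be traced back to the circle.\<close>

lemma dist_radial:
  fixes x y :: "real^2"
  assumes y: "norm y = R0" and x: "norm x \<le> R0" and s: "1 \<le> s"
  shows "dist x y \<le> dist x (s *\<^sub>R y)" "1 < s \<Longrightarrow> R0 > 0 \<Longrightarrow> dist x y < dist x (s *\<^sub>R y)"
proof -
  have xy: "x \<bullet> y \<le> R0 * R0"
    using norm_cauchy_schwarz[of x y] x y by (metis mult_right_mono norm_ge_zero order_trans)
  have e: "(dist x (s *\<^sub>R y))\<^sup>2 = (dist x y)\<^sup>2 + (s - 1) * ((s + 1) * (R0 * R0) - 2 * (x \<bullet> y))"
  proof -
    have "R0 * R0 = y \<bullet> y" using y power2_norm_eq_inner[of y] by (simp add: power2_eq_square)
    then show ?thesis
      unfolding dist_norm power2_norm_eq_inner by (simp add: inner_diff_left inner_diff_right inner_commute algebra_simps)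
  qed
  have "0 \<le> (s - 1) * (R0 * R0)" using s by simp
  then have g: "2 * (R0 * R0) \<le> (s + 1) * (R0 * R0)" by (simp add: algebra_simps)
  then have "0 \<le> (s - 1) * ((s + 1) * (R0 * R0) - 2 * (x \<bullet> y))" using s xy by simp
  then have "(dist x y)\<^sup>2 \<le> (dist x (s *\<^sub>R y))\<^sup>2" using e by simp
  then show "dist x y \<le> dist x (s *\<^sub>R y)" by (rule power2_le_imp_le) simp
  assume "1 < s" "R0 > 0"
  then have "0 < (s - 1) * (R0 * R0)" by simp
  then have "2 * (R0 * R0) < (s + 1) * (R0 * R0)" by (simp add: algebra_simps)
  then have "0 < (s - 1) * ((s + 1) * (R0 * R0) - 2 * (x \<bullet> y))" using \<open>1 < s\<close> xy by simp
  then have "(dist x y)\<^sup>2 < (dist x (s *\<^sub>R y))\<^sup>2" using e by simp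
  then show "dist x y < dist x (s *\<^sub>R y)" by (rule power2_less_imp_less) simp
qed

locale shell_family =
  fixes \<delta> C0 K1 K2 R0 R :: real and \<psi>0 :: "real^2 \<Rightarrow> real" and n :: nat
    and x :: "nat \<Rightarrow> real^2" and \<psi> :: "nat \<Rightarrow> real^2 \<Rightarrow> real"
  assumes R0: "R0 > 0" and R: "R > 0" and C0: "C0 > 0" and \<delta>: "1/2 \<le> \<delta>" "\<delta> < 1"
    and ball_cut: "ball_cutoff \<delta> C0 R0 \<psi>0"
    and cover: "optimal_covering K1 K2 R0 R n x"
    and shell_cut: "\<And>i. i \<in> {1..n} \<Longrightarrow> shell_cutoff \<delta> C0 R0 \<psi>0 (x i) R (\<psi> i)"
begin

lemma psi0: "smooth_on UNIV \<psi>0" "0 \<le> \<psi>0 z" "\<psi>0 z \<le> 1" "z \<in> ball 0 R0 \<Longrightarrow> \<psi>0 z = 1"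
  using ball_cut by (auto simp: ball_cutoff_def test_function_def)

lemma psi0_support: "\<psi>0 z \<noteq> 0 \<Longrightarrow> norm z < 2 * R0"
proof -
  assume "\<psi>0 z \<noteq> 0"
  then have "z \<in> closure {z. \<psi>0 z \<noteq> 0}" using closure_subset by fastforce
  then show ?thesis using ball_cut by (auto simp: ball_cutoff_def test_function_def)
qed

lemma psi: "i \<in> {1..n} \<Longrightarrow> smooth_on UNIV (\<psi> i)" "i \<in> {1..n} \<Longrightarrow> 0 \<le> \<psi> i z" "i \<in> {1..n} \<Longrightarrow> \<psi> i z \<le> \<psi>0 z"
  using shell_cut by (auto simp: shell_cutoff_def)

lemma center: assumes "i \<in> {1..n}" shows "norm (x i) + R \<le> R0"
proof -
  have "ball (x i) R \<subseteq> ball 0 R0" using cover assms by (auto simp: optimal_covering_def)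
  then show ?thesis using R by (simp add: ball_subset_ball_iff)
qed

text \<open>The origin lies in some shell, at distance more than \<open>R\<close> from its centre, whereas the centre has distance at
  least \<open>R\<close> from the circle.\<close>

lemma R_less: "2 * R < R0"
proof -
  have "(0::real^2) \<in> ball 0 R0" using R0 by simp
  then obtain i where i: "i \<in> {1..n}" "0 \<in> shell (x i) (2 * R) R"
    using cover unfolding optimal_covering_def by blast
  then have "R < norm (x i)" by (simp add: shell_def)
  then show ?thesis using center[OF i(1)] by simp
qed

lemma open_shell: "open (shell (a :: real^2) r1 r2)"
proof -
  have "shell a r1 r2 = {y. r2 < dist a y} \<inter> {y. dist a y < r1}" by (auto simp: shell_def)
  then show ?thesis by (simp add: open_Int open_Collect_less continuous_intros)
qed

definition radial :: "real^2 \<Rightarrow> real^2" where "radial z = (R0 / norm z) *\<^sub>R z"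

lemma radial:
  assumes "z \<noteq> 0" shows "norm (radial z) = R0" "z = (norm z / R0) *\<^sub>R radial z"
  using assms R0 by (simp_all add: radial_def)

lemma cone_over_iff:
  assumes "R0 \<le> norm z" "norm z \<le> 2 * R0"
  shows "z \<in> cone_over R0 a r \<longleftrightarrow> dist a (radial z) < r"
proof
  have nz: "z \<noteq> 0" using assms R0 by auto
  assume "z \<in> cone_over R0 a r"
  then obtain s y where sy: "z = s *\<^sub>R y" "norm y = R0" "dist a y < r" "1 \<le> s" by (auto simp: cone_over_def)
  then have "radial z = y" using R0 by (simp add: radial_def)
  then show "dist a (radial z) < r" using sy by simp
next
  have nz: "z \<noteq> 0" using assms R0 by auto
  assume d: "dist a (radial z) < r"
  show "z \<in> cone_over R0 a r" unfolding cone_over_def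
  proof (intro CollectI exI conjI)
    show "z = (norm z / R0) *\<^sub>R radial z" by (rule radial(2)[OF nz])
    show "radial z \<in> sphere 0 R0 \<inter> ball a r" using d radial(1)[OF nz] by simp
  qed (use assms R0 in \<open>simp_all add: field_simps\<close>)
qed

lemma dist_center_sphere:
  assumes "i \<in> {1..n}" "norm y = R0" shows "R \<le> dist (x i) y"
  using center[OF assms(1)] norm_triangle_ineq2[of y "x i"] assms(2) by (simp add: dist_norm norm_minus_commute)

text \<open>The support of \<open>\<psi> i\<close> is located through the radial projection to the circle, so that points of the
  annulus can be counted by the multiplicity assumption, which concerns the ball only.\<close>

lemma support_shell:
  assumes i: "i \<in> {1..n}" and nz: "\<psi> i z \<noteq> 0"
  shows "norm z < R0 \<Longrightarrow> z \<in> shell (x i) (4 * R) (R / 2)"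
    and "R0 \<le> norm z \<Longrightarrow> radial z \<in> shell (x i) (4 * R) (R / 2)"
proof -
  have cut: "shell_cutoff \<delta> C0 R0 \<psi>0 (x i) R (\<psi> i)" by (rule shell_cut[OF i])
  have p0: "\<psi>0 z \<noteq> 0" using psi(2,3)[OF i, of z] nz by auto
  have zc: "z \<in> closure {z. \<psi> i z \<noteq> 0}" using nz closure_subset by fastforce
  show "norm z < R0 \<Longrightarrow> z \<in> shell (x i) (4 * R) (R / 2)"
    using cut nz zc unfolding shell_cutoff_def test_function_def
    by (cases "shell (x i) (2 * R) R \<subseteq> ball 0 R0") auto
  assume ge: "R0 \<le> norm z"
  have le: "norm z \<le> 2 * R0" using psi0_support[OF p0] by simp
  have z0: "z \<noteq> 0" using ge R0 by auto
  have "dist (x i) (radial z) < 4 * R"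
  proof (cases "shell (x i) (2 * R) R \<subseteq> ball 0 R0")
    case True
    then have "z \<in> shell (x i) (4 * R) (R / 2)"
      using cut zc unfolding shell_cutoff_def test_function_def by auto
    then have "dist (x i) z < 4 * R" by (simp add: shell_def)
    moreover have "dist (x i) (radial z) \<le> dist (x i) ((norm z / R0) *\<^sub>R radial z)"
      by (rule dist_radial(1)[OF radial(1)[OF z0]]) (use center[OF i] R ge R0 in auto)
    ultimately show ?thesis using radial(2)[OF z0] by simp
  next
    case False
    then have "z \<in> cone_over R0 (x i) (4 * R)" using cut nz ge le unfolding shell_cutoff_def by auto
    then show ?thesis using cone_over_iff[OF ge le] by simp
  qed
  then show "radial z \<in> shell (x i) (4 * R) (R / 2)"
    using dist_center_sphere[OF i radial(1)[OF z0]] R by (simp add: shell_def)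
qed

text \<open>The multiplicity assumption carries over from the ball to the annulus: the shells are open, so those that
  contain a point of the circle also contain a common nearby point inside the ball.\<close>

lemma multiplicity: "real (card {i \<in> {1..n}. \<psi> i z \<noteq> 0}) \<le> K2"
proof -
  let ?N = "{i \<in> {1..n}. \<psi> i z \<noteq> 0}"
  obtain y where y: "y \<in> ball 0 R0" "\<And>i. i \<in> ?N \<Longrightarrow> y \<in> shell (x i) (4 * R) (R / 2)"
  proof (cases "norm z < R0")
    case True
    then show ?thesis using that[of z] support_shell(1) by auto
  next
    case False
    let ?S = "\<Inter>i\<in>?N. shell (x i) (4 * R) (R / 2)"
    have "open ?S" by (intro open_INT) (auto intro: open_shell)
    moreover have "radial z \<in> ?S" using support_shell(2) False by auto
    moreover have "radial z \<in> closure (ball 0 R0)"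
      using radial(1)[of z] False R0 by (cases "z = 0") auto
    ultimately obtain y where "y \<in> ball 0 R0" "y \<in> ?S"
      using closure_iff_nhds_not_empty[of "radial z" "ball 0 R0"] by blast
    then show ?thesis using that by blast
  qed
  have "card ?N \<le> card {i \<in> {1..n}. y \<in> shell (x i) (4 * R) (R / 2)}"
    using y by (intro card_mono) auto
  moreover have "real (card {i \<in> {1..n}. y \<in> shell (x i) (4 * R) (R / 2)}) \<le> K2"
    using cover y(1) by (auto simp: optimal_covering_def)
  ultimately show ?thesis by linarith
qed

text \<open>The points where coincidence with \<open>\<psi>0\<close> or local vanishing may fail: the circle, the boundaries of
  the zero sets, and the rays through points of the circle at distance exactly \<open>2R\<close> from some centre. The
  equation in the definition expresses this distance condition for the radial projection of \<open>z\<close>.\<close>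

definition bad :: "(real^2) set" where
  "bad = \<Union> ({sphere 0 R0} \<union> (\<lambda>i. {z. x i \<bullet> z = ((R0\<^sup>2 + (norm (x i))\<^sup>2 - 4 * R\<^sup>2) / (2 * R0)) * norm z}) ` {1..n}
     \<union> (\<lambda>i. frontier {z. \<psi> i z = 0}) ` {1..n} \<union> {frontier {z. \<psi>0 z = 0}})"

lemma interior_bad: "interior bad = {}"
  unfolding bad_def
proof (rule interior_finite_Union_empty)
  have cl: "closed {z. f z = 0}" if "smooth_on UNIV f" for f :: "real^2 \<Rightarrow> real"
    using smooth_on_continuous[OF that] by (intro closed_Collect_eq) auto
  have k: "(R0\<^sup>2 + (norm (x i))\<^sup>2 - 4 * R\<^sup>2) / (2 * R0) > 0" for i
  proof -
    have "(2 * R)\<^sup>2 < R0\<^sup>2" using R_less R by (intro power_strict_mono) auto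
    then have "4 * R\<^sup>2 < R0\<^sup>2" by (simp add: power_mult_distrib)
    then have "0 < R0\<^sup>2 + (norm (x i))\<^sup>2 - 4 * R\<^sup>2" using zero_le_power2[of "norm (x i)"] by linarith
    then show ?thesis using R0 by simp
  qed
  have fr: "closed (frontier {z. f z = 0}) \<and> interior (frontier {z. f z = 0}) = {}" if "smooth_on UNIV f" for f :: "real^2 \<Rightarrow> real"
    using interior_frontier_closed[OF cl[OF that]] by auto
  fix S assume "S \<in> {sphere 0 R0} \<union> (\<lambda>i. {z. x i \<bullet> z = ((R0\<^sup>2 + (norm (x i))\<^sup>2 - 4 * R\<^sup>2) / (2 * R0)) * norm z}) ` {1..n}
     \<union> (\<lambda>i. frontier {z. \<psi> i z = 0}) ` {1..n} \<union> {frontier {z. \<psi>0 z = 0}}"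
  then consider "S = sphere 0 R0" | i where "S = {z. x i \<bullet> z = ((R0\<^sup>2 + (norm (x i))\<^sup>2 - 4 * R\<^sup>2) / (2 * R0)) * norm z}"
    | i where "i \<in> {1..n}" "S = frontier {z. \<psi> i z = 0}" | "S = frontier {z. \<psi>0 z = 0}" by blast
  then show "closed S \<and> interior S = {}"
  proof cases
    case 1 then show ?thesis by (simp add: interior_sphere_empty)
  next
    case (2 i)
    have "closed S" unfolding 2 by (intro closed_Collect_eq continuous_intros)
    then show ?thesis unfolding 2 using interior_cone_empty[OF k] by simp
  next
    case (3 i) then show ?thesis using fr[OF psi(1)] by simp
  next
    case 4 then show ?thesis using fr[OF psi0(1)] by simp
  qed
qed auto

lemma covered: "z \<in> ball 0 R0 \<Longrightarrow> \<exists>i\<in>{1..n}. z \<in> shell (x i) (2 * R) R"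
  using cover unfolding optimal_covering_def by blast

text \<open>In the ball a cut-off whose shell contains \<open>z\<close> equals \<open>1\<close> nearby, as does \<open>\<psi>0\<close>. In the annulus,
  some centre has distance at most \<open>2R\<close>, hence off the exceptional rays less than \<open>2R\<close>, from the radial
  projection \<open>y\<close> of \<open>z\<close>. The shell then reaches beyond the ball, so the radial extension rule applies
  on a neighbourhood of \<open>z\<close>.\<close>

lemma locally_full:
  assumes z: "z \<notin> bad" "\<psi>0 z \<noteq> 0"
  shows "\<exists>i\<in>{1..n}. \<exists>V. open V \<and> z \<in> V \<and> (\<forall>y\<in>V. \<psi> i y = \<psi>0 y)"
proof (cases "norm z < R0")
  case True
  then obtain i where i: "i \<in> {1..n}" "z \<in> shell (x i) (2 * R) R"
    using covered[of z] by auto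
  have "\<psi> i y = \<psi>0 y" if "y \<in> shell (x i) (2 * R) R \<inter> ball 0 R0" for y
    using shell_cut[OF i(1)] that psi0(4)[of y] by (auto simp: shell_cutoff_def)
  moreover have "open (shell (x i) (2 * R) R \<inter> ball 0 R0)" by (intro open_Int open_shell open_ball)
  moreover have "z \<in> shell (x i) (2 * R) R \<inter> ball 0 R0" using i True by simp
  ultimately show ?thesis using i(1) by blast
next
  case False
  have "z \<notin> sphere 0 R0" using z(1) by (auto simp: bad_def)
  then have gt: "R0 < norm z" using False by simp
  have lt: "norm z < 2 * R0" using psi0_support[OF z(2)] .
  have z0: "z \<noteq> 0" using gt R0 by auto
  define y where "y = radial z"
  have y: "norm y = R0" unfolding y_def by (rule radial(1)[OF z0])
  have "closure (ball 0 R0) \<subseteq> (\<Union>i\<in>{1..n}. {y. dist (x i) y \<le> 2 * R})"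
  proof (rule closure_minimal)
    show "ball 0 R0 \<subseteq> (\<Union>i\<in>{1..n}. {y. dist (x i) y \<le> 2 * R})"
    proof
      fix y :: "real^2" assume "y \<in> ball 0 R0"
      then obtain i where "i \<in> {1..n}" "y \<in> shell (x i) (2 * R) R" using covered by blast
      then show "y \<in> (\<Union>i\<in>{1..n}. {y. dist (x i) y \<le> 2 * R})" by (intro UN_I[of i]) (auto simp: shell_def)
    qed
    show "closed (\<Union>i\<in>{1..n}. {y. dist (x i) y \<le> 2 * R})"
      by (intro closed_UN finite_atLeastAtMost ballI closed_Collect_le continuous_intros)
  qed
  moreover have "y \<in> closure (ball 0 R0)" using y R0 by simp
  ultimately obtain i where i: "i \<in> {1..n}" "dist (x i) y \<le> 2 * R" by blast
  have "dist (x i) y \<noteq> 2 * R"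
  proof
    assume "dist (x i) y = 2 * R"
    then have "(norm (x i - y))\<^sup>2 = 4 * R\<^sup>2" by (simp add: dist_norm)
    then have "(norm (x i))\<^sup>2 + R0\<^sup>2 - 2 * (x i \<bullet> y) = 4 * R\<^sup>2"
      unfolding y[symmetric] power2_norm_eq_inner by (simp add: inner_diff_left inner_diff_right inner_commute)
    then have xy: "x i \<bullet> y = (R0\<^sup>2 + (norm (x i))\<^sup>2 - 4 * R\<^sup>2) / 2" by simp
    have "x i \<bullet> z = (norm z / R0) * (x i \<bullet> y)" unfolding y_def radial_def using z0 R0 by simp
    then have "x i \<bullet> z = ((R0\<^sup>2 + (norm (x i))\<^sup>2 - 4 * R\<^sup>2) / (2 * R0)) * norm z"
      unfolding xy by (simp add: ac_simps)
    then have "z \<in> bad" using i(1) unfolding bad_def by blast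
    then show False using z(1) by blast
  qed
  then have d: "dist (x i) y < 2 * R" using i by simp
  have nsub: "\<not> shell (x i) (2 * R) R \<subseteq> ball 0 R0"
  proof
    assume sub: "shell (x i) (2 * R) R \<subseteq> ball 0 R0"
    \<comment> \<open>pushing \<open>y\<close> outwards by half of the available room stays within distance \<open>2R\<close>\<close>
    define \<epsilon> where "\<epsilon> = (2 * R - dist (x i) y) / (2 * R0)"
    have \<epsilon>: "\<epsilon> > 0" using d R0 by (simp add: \<epsilon>_def)
    have mid: "D < 2 * R" if "D \<le> a + (2 * R - a) / 2" "a < 2 * R" for D a :: real
      using that by (simp add: field_simps)
    have "dist (x i) ((1 + \<epsilon>) *\<^sub>R y) \<le> dist (x i) y + dist y ((1 + \<epsilon>) *\<^sub>R y)" by (rule dist_triangle)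
    also have "dist y ((1 + \<epsilon>) *\<^sub>R y) = \<epsilon> * R0"
      using \<epsilon> y by (simp add: dist_norm algebra_simps)
    also have "\<epsilon> * R0 = (2 * R - dist (x i) y) / 2" using R0 by (simp add: \<epsilon>_def)
    finally have "dist (x i) ((1 + \<epsilon>) *\<^sub>R y) < 2 * R" by (rule mid[OF _ d])
    moreover have "dist (x i) y < dist (x i) ((1 + \<epsilon>) *\<^sub>R y)"
    proof (rule dist_radial(2)[OF y])
      show "norm (x i) \<le> R0" using center[OF i(1)] R by linarith
    qed (use R0 \<epsilon> in linarith)+
    moreover have "R \<le> dist (x i) y" by (rule dist_center_sphere[OF i(1) y])
    ultimately have "(1 + \<epsilon>) *\<^sub>R y \<in> shell (x i) (2 * R) R"
      unfolding shell_def by (metis (mono_tags, lifting) le_less_trans mem_Collect_eq)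
    then have "(1 + \<epsilon>) *\<^sub>R y \<in> ball 0 R0" using sub by blast
    then have "norm ((1 + \<epsilon>) *\<^sub>R y) < R0" by (simp only: mem_ball_0)
    moreover have "norm ((1 + \<epsilon>) *\<^sub>R y) = \<bar>1 + \<epsilon>\<bar> * R0" by (simp only: norm_scaleR y)
    moreover have "\<bar>1 + \<epsilon>\<bar> = 1 + \<epsilon>" using \<epsilon> by linarith
    moreover have "1 * R0 < (1 + \<epsilon>) * R0" by (rule mult_strict_right_mono) (use \<epsilon> R0 in auto)
    ultimately show False by (metis less_asym mult_1)
  qed
  define V3 where "V3 = (\<lambda>w. dist (x i) (radial w)) -` {..<2 * R} \<inter> - {0}"
  define V where "V = {w. R0 < norm w} \<inter> {w. norm w < 2 * R0} \<inter> V3"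
  have o3: "open V3"
  proof -
    have "continuous_on (- {0}) (\<lambda>w. dist (x i) (radial w))"
      unfolding radial_def by (intro continuous_intros) auto
    then show ?thesis unfolding V3_def
      using continuous_on_open_vimage[of "- {0}" "\<lambda>w. dist (x i) (radial w)"] open_lessThan[of "2 * R"]
      by (metis open_Compl closed_singleton)
  qed
  have o1: "open {w :: real^2. R0 < norm w}" "open {w :: real^2. norm w < 2 * R0}"
    by (intro open_Collect_less continuous_intros)+
  have "open V" unfolding V_def by (intro open_Int o1 o3)
  moreover have "z \<in> V" unfolding V_def V3_def using gt lt z0 d y_def by simp
  moreover have "\<psi> i w = \<psi>0 w" if "w \<in> V" for w
  proof -
    have "R0 \<le> norm w" "norm w \<le> 2 * R0" "dist (x i) (radial w) < 2 * R"
      using that unfolding V_def V3_def by auto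
    then have "w \<in> cone_over R0 (x i) (2 * R)" using cone_over_iff by blast
    then show ?thesis using shell_cut[OF i(1)] nsub unfolding shell_cutoff_def by metis
  qed
  ultimately show ?thesis using i(1) by blast
qed

section \<open>The sum of the cut-offs\<close>

definition Phi :: "real^2 \<Rightarrow> real" where "Phi = (\<lambda>z. \<Sum>i=1..n. \<psi> i z)"
text \<open>With these abbreviations \<open>\<mu>\<close> is the size of the Laplacians of the \<open>\<psi> i\<close> and \<open>\<rho> * \<mu>\<close> the
  size of the Laplacian of \<open>\<psi>0\<close>.\<close>

definition "\<mu> = C0 / R\<^sup>2"
definition "\<rho> = (R / R0)\<^sup>2"
definition "\<theta> = 2 * \<delta> - 1"
definition "active z = {i \<in> {1..n}. \<psi> i z \<noteq> 0}"

lemma params: "0 < \<mu>" "0 < \<rho>" "\<rho> < 1/4" "0 \<le> \<theta>" "\<theta> < 1" "\<rho> * \<mu> = C0 / R0\<^sup>2"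
proof -
  show "0 < \<mu>" unfolding \<mu>_def by (rule divide_pos_pos[OF C0 zero_less_power[OF R]])
  show "0 < \<rho>" unfolding \<rho>_def by (rule zero_less_power[OF divide_pos_pos[OF R R0]])
  show "0 \<le> \<theta>" "\<theta> < 1" using \<delta> unfolding \<theta>_def by linarith+
  have "R / R0 < 1/2" using R_less R0 by (simp add: field_simps)
  then have "(R / R0)\<^sup>2 < (1/2)\<^sup>2" using R R0 by (intro power_strict_mono) auto
  then show "\<rho> < 1/4" by (simp add: \<rho>_def power2_eq_square)
  show "\<rho> * \<mu> = C0 / R0\<^sup>2" using R by (simp add: \<mu>_def \<rho>_def power_divide)
qed

lemma smooth_Phi: "smooth_on UNIV Phi"
  unfolding Phi_def by (rule smooth_on_sum) (auto intro: psi(1))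

lemma laplacian_cong:
  assumes "open V" "z \<in> V" "\<And>y. y \<in> V \<Longrightarrow> f y = g y"
  shows "laplacian f z = laplacian g z"
proof -
  have "ddir w f y = ddir w g y" if "y \<in> V" for y w by (rule ddir_cong[OF assms(1) that assms(3)])
  then have "ddir w (ddir w f) z = ddir w (ddir w g) z" for w
    by (intro ddir_cong[OF assms(1,2)])
  then show ?thesis by (simp add: laplacian_eq_ddir)
qed

lemma laplacian_zero: "laplacian (\<lambda>_. 0 :: real) z = 0"
proof -
  have "ddir w (\<lambda>_. 0 :: real) = (\<lambda>_. 0)" for w :: "real^2" by (simp add: fun_eq_iff ddir_const)
  then show ?thesis by (simp add: laplacian_eq_ddir)
qed

lemma laplacian_Phi: "laplacian Phi z = (\<Sum>i=1..n. laplacian (\<psi> i) z)"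
proof -
  have 1: "ddir w Phi = (\<lambda>z. \<Sum>i=1..n. ddir w (\<psi> i) z)" for w
    unfolding Phi_def by (intro ext ddir_sum v_diff(1) psi(1))
  have "ddir w (ddir w Phi) z = (\<Sum>i=1..n. ddir w (ddir w (\<psi> i)) z)" for w
    unfolding 1 by (intro ddir_sum v_diff(2) psi(1))
  then show ?thesis by (simp add: laplacian_eq_ddir sum.distrib)
qed

lemma lap_cutoff:
  assumes "cutoff_bounds \<delta> C0 r f" "f z \<noteq> 0" "0 \<le> f z"
  shows "\<bar>laplacian f z\<bar> \<le> C0 / r\<^sup>2 * f z powr \<theta>"
proof -
  have "\<bar>laplacian f z\<bar> / f z powr \<theta> \<le> C0 / r\<^sup>2" using assms unfolding cutoff_bounds_def \<theta>_def by blast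
  moreover have "0 < f z powr \<theta>" using assms by simp
  ultimately show ?thesis by (simp add: divide_le_eq)
qed

lemma lap_psi0: "\<psi>0 z \<noteq> 0 \<Longrightarrow> \<bar>laplacian \<psi>0 z\<bar> \<le> \<rho> * \<mu> * \<psi>0 z powr \<theta>"
  unfolding params(6) using ball_cut psi0(2) by (intro lap_cutoff) (auto simp: ball_cutoff_def)

lemma lap_psi:
  assumes "i \<in> {1..n}" "\<psi> i z \<noteq> 0" shows "\<bar>laplacian (\<psi> i) z\<bar> \<le> \<mu> * \<psi>0 z powr \<theta>"
proof -
  have "\<bar>laplacian (\<psi> i) z\<bar> \<le> \<mu> * \<psi> i z powr \<theta>"
    unfolding \<mu>_def using shell_cut[OF assms(1)] psi(2)[OF assms(1)] assms(2)
    by (intro lap_cutoff) (auto simp: shell_cutoff_def)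
  also have "\<dots> \<le> \<mu> * \<psi>0 z powr \<theta>"
    using params psi[OF assms(1)] by (intro mult_left_mono powr_mono2) auto
  finally show ?thesis .
qed

text \<open>One active index coincides locally with \<open>\<psi>0\<close> and is split off; inactive ones vanish locally because the
  point is not on the boundary of their zero sets. Only the remaining active ones are charged \<open>\<mu>\<close>.\<close>

lemma good_point:
  assumes z: "z \<notin> bad" "\<psi>0 z \<noteq> 0"
  shows "\<psi>0 z \<le> Phi z" "Phi z \<le> real (card (active z)) * \<psi>0 z"
    "\<bar>laplacian Phi z - laplacian \<psi>0 z\<bar> \<le> (real (card (active z)) - 1) * (\<mu> * \<psi>0 z powr \<theta>)"
proof -
  obtain i V where i: "i \<in> {1..n}" and V: "open V" "z \<in> V" "\<And>y. y \<in> V \<Longrightarrow> \<psi> i y = \<psi>0 y"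
    using locally_full[OF z] by blast
  have li: "laplacian (\<psi> i) z = laplacian \<psi>0 z" by (rule laplacian_cong[OF V])
  have fin: "finite (active z)" by (simp add: active_def)
  have ia: "i \<in> active z" using i V z by (simp add: active_def)
  have l0: "laplacian (\<psi> j) z = 0" if "j \<in> {1..n}" "\<psi> j z = 0" for j
  proof -
    have "z \<notin> frontier {z. \<psi> j z = 0}" using z(1) that(1) unfolding bad_def by blast
    then have "z \<in> interior {z. \<psi> j z = 0}" using that(2) closure_subset[of "{z. \<psi> j z = 0}"] by (auto simp: frontier_def)
    then have "laplacian (\<psi> j) z = laplacian (\<lambda>_. 0 :: real) z"
      by (intro laplacian_cong[OF open_interior]) (use interior_subset in auto)
    then show ?thesis by (simp add: laplacian_zero)
  qed
  have "Phi z = (\<Sum>j\<in>active z. \<psi> j z)"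
    unfolding Phi_def active_def by (rule sum.mono_neutral_right) auto
  then have P: "Phi z = \<psi>0 z + (\<Sum>j\<in>active z - {i}. \<psi> j z)"
    using sum.remove[OF fin ia, of "\<lambda>j. \<psi> j z"] V by simp
  show "\<psi>0 z \<le> Phi z" 
  proof -
    have "0 \<le> (\<Sum>j\<in>active z - {i}. \<psi> j z)"
      by (rule sum_nonneg) (use psi(2) in \<open>auto simp: active_def\<close>)
    then show ?thesis unfolding P by simp
  qed
  have "(\<Sum>j\<in>active z. \<psi> j z) \<le> (\<Sum>j\<in>active z. \<psi>0 z)" by (rule sum_mono) (use psi(3) in \<open>auto simp: active_def\<close>)
  then show "Phi z \<le> real (card (active z)) * \<psi>0 z" using \<open>Phi z = (\<Sum>j\<in>active z. \<psi> j z)\<close> by simp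
  have "laplacian Phi z = (\<Sum>j\<in>active z. laplacian (\<psi> j) z)"
    unfolding laplacian_Phi active_def by (rule sum.mono_neutral_right) (auto simp: l0)
  then have "laplacian Phi z - laplacian \<psi>0 z = (\<Sum>j\<in>active z - {i}. laplacian (\<psi> j) z)"
    using sum.remove[OF fin ia, of "\<lambda>j. laplacian (\<psi> j) z"] li by simp
  also have "\<bar>\<dots>\<bar> \<le> (\<Sum>j\<in>active z - {i}. \<mu> * \<psi>0 z powr \<theta>)"
    by (rule order_trans[OF sum_abs sum_mono]) (auto simp: active_def intro: lap_psi)
  also have "\<dots> = (real (card (active z)) - 1) * (\<mu> * \<psi>0 z powr \<theta>)"
  proof -
    have "card (active z) \<ge> 1" using ia fin by (metis One_nat_def Suc_leI card_gt_0_iff empty_iff)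
    then show ?thesis using ia fin by (simp add: card_Diff_singleton of_nat_diff)
  qed
  finally show "\<bar>laplacian Phi z - laplacian \<psi>0 z\<bar> \<le> (real (card (active z)) - 1) * (\<mu> * \<psi>0 z powr \<theta>)" .
qed

lemma Phi_zero: assumes "\<psi>0 z = 0" shows "Phi z = 0"
  unfolding Phi_def
proof (rule sum.neutral, rule ballI)
  show "\<psi> i z = 0" if "i \<in> {1..n}" for i using psi(2,3)[OF that, of z] assms by simp
qed

lemma zero_point:
  assumes z: "z \<notin> bad" "\<psi>0 z = 0" shows "laplacian \<psi>0 z = 0" "laplacian Phi z = 0"
proof -
  have "z \<notin> frontier {z. \<psi>0 z = 0}" using z(1) unfolding bad_def by blast
  then have i: "z \<in> interior {z. \<psi>0 z = 0}" using z(2) closure_subset[of "{z. \<psi>0 z = 0}"] by (auto simp: frontier_def)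
  have i0: "\<psi>0 y = 0" if "y \<in> interior {z. \<psi>0 z = 0}" for y using that interior_subset by blast
  have "laplacian \<psi>0 z = laplacian (\<lambda>_. 0 :: real) z" by (rule laplacian_cong[OF open_interior i i0])
  then show "laplacian \<psi>0 z = 0" by (simp add: laplacian_zero)
  have "laplacian Phi z = laplacian (\<lambda>_. 0 :: real) z" by (rule laplacian_cong[OF open_interior i Phi_zero[OF i0]])
  then show "laplacian Phi z = 0" by (simp add: laplacian_zero)
qed

context
  fixes m :: real
  assumes m: "\<And>z. real (card (active z)) \<le> m"
begin

lemma open_pos: "open {z. \<psi>0 z \<noteq> 0}"
  using smooth_on_continuous[OF psi0(1)] by (intro open_Collect_neq) auto

lemma Phi_bounds: "\<psi>0 z \<le> Phi z" "Phi z \<le> m * \<psi>0 z"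
proof -
  have c: "continuous_on A \<psi>0" "continuous_on A Phi" for A
    using smooth_on_continuous[OF psi0(1)] smooth_on_continuous[OF smooth_Phi] by (auto intro: continuous_on_subset)
  have "\<psi>0 z \<le> Phi z \<and> Phi z \<le> m * \<psi>0 z" if "\<psi>0 z \<noteq> 0"
  proof
    show "\<psi>0 z \<le> Phi z"
      by (rule le_by_density[OF interior_bad open_pos _ c]) (use that good_point(1) in auto)
    show "Phi z \<le> m * \<psi>0 z"
    proof (rule le_by_density[OF interior_bad open_pos _ c(2)])
      show "Phi y \<le> m * \<psi>0 y" if "y \<in> {z. \<psi>0 z \<noteq> 0}" "y \<notin> bad" for y
        using good_point(2)[OF that(2)] that(1) mult_right_mono[OF m[of y] psi0(2)[of y]] by auto
    qed (use that c in \<open>auto intro!: continuous_intros\<close>)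
  qed
  then show "\<psi>0 z \<le> Phi z" "Phi z \<le> m * \<psi>0 z" using Phi_zero[of z] by (cases "\<psi>0 z = 0"; simp)+
qed

text \<open>A continuous majorant \<open>b\<close> of \<open>\<psi>0 powr \<theta>\<close> is used because the power itself is discontinuous at the
  zeros of \<open>\<psi>0\<close> when \<open>\<theta> = 0\<close>, and density arguments need continuity on all of \<open>V\<close>.\<close>

lemma laplacian_bounds_on:
  assumes V: "open V" "z \<in> V" and b: "continuous_on V b" "\<And>y. y \<in> V \<Longrightarrow> 0 \<le> b y"
    "\<And>y. y \<in> V \<Longrightarrow> \<psi>0 y \<noteq> 0 \<Longrightarrow> \<psi>0 y powr \<theta> \<le> b y" and m1: "1 \<le> m"
  shows "\<bar>laplacian \<psi>0 z\<bar> \<le> \<rho> * \<mu> * b z"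
    and "\<bar>laplacian Phi z - laplacian \<psi>0 z\<bar> \<le> (m - 1) * (\<mu> * b z)"
proof -
  note c = laplacian_continuous[OF psi0(1)] laplacian_continuous[OF smooth_Phi]
  have g1: "\<bar>laplacian \<psi>0 y\<bar> \<le> \<rho> * \<mu> * b y" if "y \<in> V" "y \<notin> bad" for y
  proof (cases "\<psi>0 y = 0")
    case True
    have "0 \<le> \<rho> * \<mu> * b y" using b(2)[OF that(1)] params(1,2) by (intro mult_nonneg_nonneg) auto
    then show ?thesis using zero_point(1)[OF that(2) True] by simp
  next
    case False
    have "\<rho> * \<mu> * \<psi>0 y powr \<theta> \<le> \<rho> * \<mu> * b y"
      using params(1,2) by (intro mult_left_mono b(3) that False) auto
    then show ?thesis using lap_psi0[OF False] by linarith
  qed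
  have g2: "\<bar>laplacian Phi y - laplacian \<psi>0 y\<bar> \<le> (m - 1) * (\<mu> * b y)" if "y \<in> V" "y \<notin> bad" for y
  proof (cases "\<psi>0 y = 0")
    case True
    have "0 \<le> (m - 1) * (\<mu> * b y)" using b(2)[OF that(1)] params(1) m1 by (intro mult_nonneg_nonneg) auto
    then show ?thesis using zero_point[OF that(2) True] by simp
  next
    case False
    have "(real (card (active y)) - 1) * (\<mu> * \<psi>0 y powr \<theta>) \<le> (m - 1) * (\<mu> * b y)"
      using params(1) m[of y] m1 by (intro mult_mono mult_left_mono b(3) that False) auto
    then show ?thesis using good_point(3)[OF that(2) False] by linarith
  qed
  show "\<bar>laplacian \<psi>0 z\<bar> \<le> \<rho> * \<mu> * b z"
    by (rule le_by_density[OF interior_bad V]) (use g1 in \<open>auto intro!: continuous_intros c b(1)\<close>)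
  show "\<bar>laplacian Phi z - laplacian \<psi>0 z\<bar> \<le> (m - 1) * (\<mu> * b z)"
    by (rule le_by_density[OF interior_bad V]) (use g2 in \<open>auto intro!: continuous_intros c b(1)\<close>)
qed

lemma laplacian_bounds:
  assumes "1 \<le> m" "\<psi>0 z \<noteq> 0"
  shows "\<bar>laplacian \<psi>0 z\<bar> \<le> \<rho> * \<mu> * \<psi>0 z powr \<theta>"
    and "\<bar>laplacian Phi z - laplacian \<psi>0 z\<bar> \<le> (m - 1) * (\<mu> * \<psi>0 z powr \<theta>)"
proof -
  have z: "z \<in> {z. \<psi>0 z \<noteq> 0}" using assms by simp
  have c: "continuous_on {z. \<psi>0 z \<noteq> 0} (\<lambda>z. \<psi>0 z powr \<theta>)"
    by (intro continuous_on_powr continuous_on_const continuous_on_subset[OF smooth_on_continuous[OF psi0(1)]]) auto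
  show "\<bar>laplacian \<psi>0 z\<bar> \<le> \<rho> * \<mu> * \<psi>0 z powr \<theta>" by (rule lap_psi0[OF assms(2)])
  show "\<bar>laplacian Phi z - laplacian \<psi>0 z\<bar> \<le> (m - 1) * (\<mu> * \<psi>0 z powr \<theta>)"
    by (rule laplacian_bounds_on(2)[OF open_pos z c _ _ assms(1)]) auto
qed

end

end

section \<open>Numerical estimates for the critical case\<close>

lemma exp_quadratic_bound:
  fixes b :: real
  assumes "0 \<le> b" "b \<le> 9/8"
  shows "exp b - 1 \<le> b + 39/50 * b\<^sup>2"
proof -
  obtain t where t: "\<bar>t\<bar> \<le> \<bar>b\<bar>" and e: "exp b = (\<Sum>m<5. b ^ m / fact m) + (exp t / fact 5) * b ^ 5"
    using Maclaurin_exp_le by blast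
  have "exp (9/8::real) = exp 1 * exp (1/8)" by (simp flip: exp_add)
  also have "\<dots> \<le> 272/100 * (1 + 1/8 + (1/8)\<^sup>2)"
    using e_less_272 exp_bound[of "1/8"] by (intro mult_mono) auto
  finally have E: "exp (9/8::real) \<le> 311/100" by (simp add: power2_eq_square)
  have "exp t \<le> exp (9/8)" using t assms by simp
  then have et: "exp t \<le> 311/100" using E by linarith
  have S: "(\<Sum>m<5. b ^ m / fact m) = 1 + b + b\<^sup>2/2 + b^3/6 + b^4/24"
    by (simp add: eval_nat_numeral)
  have f5: "fact 5 = (120::real)" by (simp add: eval_nat_numeral)
  have b2: "0 \<le> b\<^sup>2" by simp
  have "b * b\<^sup>2 \<le> 9/8 * b\<^sup>2" using assms by (intro mult_right_mono) auto
  then have b3: "b^3 \<le> 9/8 * b\<^sup>2" by (simp add: power2_eq_square power3_eq_cube)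
  have "b * b^3 \<le> 9/8 * b^3" using assms by (intro mult_right_mono) auto
  then have b4: "b^4 \<le> 81/64 * b\<^sup>2" using b3 by (simp add: power4_eq_xxxx power3_eq_cube)
  have "b * b^4 \<le> 9/8 * b^4" using assms by (intro mult_right_mono) auto
  moreover have "b * b^4 = b^5" by (simp add: eval_nat_numeral)
  ultimately have b5: "b^5 \<le> 729/512 * b\<^sup>2" using b4 by simp
  have "(exp t / 120) * b^5 \<le> (311/100 / 120) * (729/512 * b\<^sup>2)"
    using et b5 assms by (intro mult_mono divide_right_mono) auto
  then have "exp b \<le> 1 + b + b\<^sup>2/2 + b^3/6 + b^4/24 + (311/100 / 120) * (729/512 * b\<^sup>2)"
    unfolding e S f5 by linarith
  then show ?thesis using b3 b4 b2 by linarith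
qed

text \<open>The coefficient of the Laplacian in \<open>gradient_bound\<close> when the Laplacian grows exponentially: the two
  fractions are \<open>1/4 + 99/1680\<close> and \<open>1/9 + 99/10080\<close>, and \<open>exp b - 1\<close> is the relative growth up to the
  radius of the circle.\<close>

definition genv :: "real \<Rightarrow> real" where "genv b = 173/560 + 1219/10080 * (exp b - 1)"

lemma genv_bounds:
  assumes "0 \<le> b" "b \<le> 9/8"
  shows "genv b \<le> 173/560 + 1219/10080 * (b + 39/50 * b\<^sup>2)" "0 \<le> genv b" "genv b \<le> 113/200"
proof -
  show 1: "genv b \<le> 173/560 + 1219/10080 * (b + 39/50 * b\<^sup>2)"
    unfolding genv_def using exp_quadratic_bound[OF assms] by simp
  show "0 \<le> genv b" unfolding genv_def using assms by simp
  have "b\<^sup>2 \<le> (9/8)\<^sup>2" using assms by (intro power_mono) auto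
  then have "b\<^sup>2 \<le> 81/64" by (simp add: power2_eq_square)
  then show "genv b \<le> 113/200" using 1[unfolded distrib_left] assms by linarith
qed

text \<open>The critical inequality keeps \<open>n * \<rho>\<close> within \<open>\<rho> / (n - 1)\<close> of \<open>1\<close>. The worst case is \<open>n = 5\<close>, where \<open>\<rho>\<close> is
  close to \<open>1/5\<close>; for \<open>n \<ge> 6\<close> the smallness of \<open>\<rho>\<close> leaves more room.\<close>

locale critical_numbers =
  fixes n :: nat and \<rho> :: real
  assumes n5: "5 \<le> n" and q1: "1 \<le> real n * \<rho>" and rho: "0 < \<rho>" "\<rho> < 1/4"
    and crit: "(real n * \<rho> - 1) * (real n - 1) < \<rho>"
begin

lemma rho_small: "\<rho> \<le> 4/19" "6 \<le> n \<Longrightarrow> \<rho> \<le> 5/29"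
proof -
  define N where "N = real n"
  have N5: "5 \<le> N" using n5 by (simp add: N_def)
  have c: "\<rho> * (N * (N - 1) - 1) < N - 1" using crit unfolding N_def by (simp add: algebra_simps)
  have pos: "0 < N * (N - 1) - 1"
  proof -
    have "5 * 4 \<le> N * (N - 1)" using N5 by (intro mult_mono) auto
    then show ?thesis by simp
  qed
  have gen: "\<rho> \<le> r" if "N - 1 \<le> r * (N * (N - 1) - 1)" for r
  proof (rule ccontr)
    assume "\<not> \<rho> \<le> r"
    then have "r * (N * (N - 1) - 1) < \<rho> * (N * (N - 1) - 1)" using pos by (intro mult_strict_right_mono) auto
    then show False using c that by linarith
  qed
  show "\<rho> \<le> 4/19"
  proof (rule gen)
    have "0 \<le> (N - 5) * (4 * N - 3)" using N5 by (intro mult_nonneg_nonneg) auto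
    then show "N - 1 \<le> 4/19 * (N * (N - 1) - 1)" by (simp add: algebra_simps)
  qed
  assume "6 \<le> n"
  then have N6: "6 \<le> N" by (simp add: N_def)
  show "\<rho> \<le> 5/29"
  proof (rule gen)
    have "0 \<le> (N - 6) * (5 * N - 4)" using N6 by (intro mult_nonneg_nonneg) auto
    then show "N - 1 \<le> 5/29 * (N * (N - 1) - 1)" by (simp add: algebra_simps)
  qed
qed

text \<open>The relative margin of the crude count at a point where \<open>n \<psi>0 - \<Phi> = (n-1) y \<psi>0\<close>.\<close>

definition "slack y = (real n * \<rho> - 1) - \<rho> / (real n - 1) + \<rho> * y"

lemma slack_cases:
  obtains (five) "n = 5" "1/5 \<le> \<rho>" "slack y = 19/4 * \<rho> - 1 + \<rho> * y"
  | (six) "\<rho> \<le> 5/29" "- \<rho> / 5 + \<rho> * y \<le> slack y"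
proof (cases "n = 5")
  case True
  have "1/5 \<le> \<rho>" using q1 True by simp
  moreover have "slack y = 19/4 * \<rho> - 1 + \<rho> * y" unfolding slack_def using True by simp
  ultimately show ?thesis by (rule five[OF True])
next
  case False
  then have n6: "6 \<le> n" using n5 by simp
  then have "\<rho> / (real n - 1) \<le> \<rho> / 5" using rho by (intro divide_left_mono) auto
  then have "- \<rho> / 5 + \<rho> * y \<le> slack y" unfolding slack_def using q1 by linarith
  then show ?thesis by (rule six[OF rho_small(2)[OF n6]])
qed

lemma slack_ge: "- 48/128 * \<rho> + 16/128 * \<rho> + \<rho> * y \<le> slack y"
proof -
  have "\<rho> / (real n - 1) \<le> \<rho> / 4" using rho n5 by (intro divide_left_mono) auto
  then show ?thesis unfolding slack_def using q1 by linarith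
qed

text \<open>The left side is the squared gradient bound for \<open>n \<psi>0 - \<Phi>\<close> at radius \<open>3/2 w\<close>, where \<open>y = w\<^sup>2\<close>;
  the right side is what the completed square with multiplier \<open>1/16\<close> allows. The intermediate bound
  \<open>64/10 + 256/10 * w\<^sup>2\<close> is the value of the right side for \<open>n = 5\<close>, \<open>\<rho> = 1/5\<close>.\<close>

lemma upper_small:
  assumes w: "0 \<le> w" "w \<le> 1/2"
  shows "(4/3 + 3 * (1 + \<rho>) * genv (9/4 * w))\<^sup>2 \<le> 128 * ((1 - \<rho>)/8 + slack (w\<^sup>2))"
proof -
  define N where "N = genv (9/4 * w)"
  have N: "N \<le> 173/560 + 1219/10080 * (9/4 * w + 39/50 * (9/4 * w)\<^sup>2)" "0 \<le> N" "N \<le> 113/200"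
    unfolding N_def using genv_bounds[of "9/4 * w"] w by auto
  have w2: "0 \<le> w\<^sup>2" "w\<^sup>2 \<le> 1/4" using power_mono[OF w(2,1), of 2] by (auto simp: power2_eq_square)
  \<comment> \<open>the left side before squaring, with \<open>\<rho> = 1/5\<close>\<close>
  define P where "P = 4/3 + 36/10 * N"
  have P0: "0 \<le> P" using N by (simp add: P_def)
  have Pw: "P \<le> 4891/2000 + 98/100 * w + 172/100 * w\<^sup>2"
  proof -
    have sq: "(9/4 * w)\<^sup>2 = 81/16 * w\<^sup>2" by (simp add: power2_eq_square)
    have "N \<le> 173/560 + 1219/10080 * (9/4 * w + 39/50 * (81/16 * w\<^sup>2))" using N(1) unfolding sq .
    then show ?thesis unfolding P_def distrib_left using w(1) w2(1) by linarith
  qed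
  have "P\<^sup>2 \<le> (4891/2000 + 98/100 * w + 172/100 * w\<^sup>2)\<^sup>2" using Pw P0 by (rule power_mono)
  also have "\<dots> = (4891/2000)\<^sup>2 + 2 * (4891/2000) * (98/100) * w + ((98/100)\<^sup>2 + 2 * (4891/2000) * (172/100)) * w\<^sup>2
      + 2 * (98/100) * (172/100) * (w * w\<^sup>2) + (172/100)\<^sup>2 * (w\<^sup>2 * w\<^sup>2)"
    by (simp add: power2_eq_square algebra_simps)
  also have "\<dots> \<le> (4891/2000)\<^sup>2 + 2 * (4891/2000) * (98/100) * w + ((98/100)\<^sup>2 + 2 * (4891/2000) * (172/100)) * w\<^sup>2
      + 2 * (98/100) * (172/100) * (1/2 * w\<^sup>2) + (172/100)\<^sup>2 * (1/4 * w\<^sup>2)"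
    using w w2 by (intro add_mono mult_left_mono mult_right_mono order_refl) auto
  also have "\<dots> \<le> 64/10 + 256/10 * w\<^sup>2"
  proof -
    \<comment> \<open>the difference of the two quadratics in \<open>w\<close> has leading coefficient about \<open>13.8\<close> and its minimum near \<open>0.1736\<close>\<close>
    have "0 \<le> (w - 1736/10000)\<^sup>2" by simp
    then have "0 \<le> 138/10 * (w\<^sup>2 - 2 * (1736/10000) * w + (1736/10000)\<^sup>2)" by (simp add: power2_diff)
    then show ?thesis using w w2 by (simp add: power2_eq_square[of "1736/10000::real"] power2_eq_square[of "4891/2000::real"]
        power2_eq_square[of "98/100::real"] power2_eq_square[of "172/100::real"] power2_eq_square[of "49/50::real"]
        power2_eq_square[of "43/25::real"] power2_eq_square[of "217/1250::real"])
  qed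
  finally have main: "P\<^sup>2 \<le> 64/10 + 256/10 * w\<^sup>2" .
  have P4: "P \<le> 34/10" unfolding P_def using N(3) by simp
  show ?thesis
  proof (cases rule: slack_cases[of "w\<^sup>2"])
    case five
    define x where "x = \<rho> - 1/5"
    have x: "0 \<le> x" "x \<le> 1/95" using five(2) rho_small(1) by (auto simp: x_def)
    have "4/3 + 3 * (1 + \<rho>) * N = P + 3 * N * x" unfolding P_def x_def by (simp add: algebra_simps)
    also have "\<dots> \<le> P + 17/10 * x" using N x by (intro add_left_mono mult_right_mono) auto
    finally have "4/3 + 3 * (1 + \<rho>) * N \<le> P + 17/10 * x" .
    then have "(4/3 + 3 * (1 + \<rho>) * N)\<^sup>2 \<le> (P + 17/10 * x)\<^sup>2" using N rho by (intro power_mono) auto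
    also have "\<dots> = P\<^sup>2 + 34/10 * (P * x) + 289/100 * (x * x)" by (simp add: power2_eq_square algebra_simps)
    also have "\<dots> \<le> P\<^sup>2 + 34/10 * (34/10 * x) + 289/100 * (1/95 * x)"
      using P4 x by (intro add_mono mult_left_mono mult_right_mono order_refl) auto
    also have "\<dots> \<le> P\<^sup>2 + 592 * x" using x by simp
    also have "\<dots> \<le> 64/10 + 256/10 * w\<^sup>2 + 592 * x" using main by simp
    also have "\<dots> \<le> 128 * ((1 - \<rho>)/8 + slack (w\<^sup>2))"
    proof -
      have "1/5 * w\<^sup>2 \<le> \<rho> * w\<^sup>2" using five(2) w2 by (intro mult_right_mono) auto
      then show ?thesis unfolding five(3) x_def by (simp add: field_simps)
    qed
    finally show ?thesis by (simp add: N_def)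
  next
    case six
    have "(4/3 + 3 * (1 + \<rho>) * N)\<^sup>2 \<le> P\<^sup>2"
    proof (rule power_mono)
      have "3 * (1 + \<rho>) * N \<le> 36/10 * N" using six(1) N by (intro mult_right_mono) auto
      then show "4/3 + 3 * (1 + \<rho>) * N \<le> P" by (simp add: P_def)
    qed (use N rho in auto)
    also have "\<dots> \<le> 64/10 + 256/10 * w\<^sup>2" by (rule main)
    also have "\<dots> \<le> 128 * ((1 - \<rho>)/8 + slack (w\<^sup>2))"
    proof -
      have "\<rho> * (416/10 - 128 * w\<^sup>2) \<le> 5/29 * (416/10 - 128 * w\<^sup>2)" using six(1) w2 by (intro mult_right_mono) auto
      have "128 * ((1 - \<rho>)/8 + S) = 16 - 16 * \<rho> + 128 * S" if "S = slack (w\<^sup>2)" for S by (simp add: field_simps)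
      from this[OF refl] have "128 * ((1 - \<rho>)/8 + slack (w\<^sup>2)) = 16 - 16 * \<rho> + 128 * slack (w\<^sup>2)" .
      moreover have "416/10 * \<rho> - 128 * (\<rho> * w\<^sup>2) \<le> 5/29 * (416/10) - 5/29 * 128 * w\<^sup>2"
        using \<open>\<rho> * (416/10 - 128 * w\<^sup>2) \<le> 5/29 * (416/10 - 128 * w\<^sup>2)\<close> by (simp add: algebra_simps)
      ultimately show ?thesis using six(2) w2 by linarith
    qed
    finally show ?thesis by (simp add: N_def)
  qed
qed

text \<open>The same comparison with the fixed radius \<open>3/4\<close>, the value of \<open>3/2 w\<close> at \<open>y = 1/4\<close>.\<close>

lemma upper_large:
  assumes y: "1/4 \<le> y" "y \<le> 1"
  shows "(8/3 * y + 3/2 * (1 + \<rho>) * genv (9/8))\<^sup>2 \<le> 128 * ((1 - \<rho>)/8 + slack y) * y"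
proof -
  have N: "0 \<le> genv (9/8)" "genv (9/8) \<le> 113/200" using genv_bounds[of "9/8"] by auto
  have "3/2 * (1 + \<rho>) * genv (9/8) \<le> 3/2 * (1 + 4/19) * (113/200)"
    using N rho rho_small(1) by (intro mult_mono) auto
  then have "8/3 * y + 3/2 * (1 + \<rho>) * genv (9/8) \<le> 8/3 * y + 1027/1000" by simp
  then have "(8/3 * y + 3/2 * (1 + \<rho>) * genv (9/8))\<^sup>2 \<le> (8/3 * y + 1027/1000)\<^sup>2"
    using N rho y by (intro power_mono) auto
  also have "\<dots> = 64/9 * (y * y) + 2 * (8/3) * (1027/1000) * y + (1027/1000) * (1027/1000)"
    by (simp add: power2_eq_square algebra_simps)
  also have "\<dots> \<le> (16 - \<rho> * (48 - 128 * y)) * y"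
  proof (cases "y \<le> 3/8")
    case True
    have "\<rho> * (48 - 128 * y) \<le> 4/19 * (48 - 128 * y)" using rho_small(1) True by (intro mult_right_mono) auto
    then have "(16 - 4/19 * (48 - 128 * y)) * y \<le> (16 - \<rho> * (48 - 128 * y)) * y"
      using y by (intro mult_right_mono) auto
    moreover have "1/4 * y \<le> y * y" using y by (intro mult_right_mono) auto
    moreover have "(16 - 4/19 * (48 - 128 * y)) * y = 112/19 * y + 512/19 * (y * y)"
      by (simp add: algebra_simps)
    moreover have "64 / 9 * (y * y) + 2 * (8 / 3) * (1027 / 1000) * y + 1027 / 1000 * (1027 / 1000)
        \<le> 112/19 * y + 512/19 * (y * y)" if "1/4 * y \<le> y * y"
      using that y(1) by linarith
    ultimately show ?thesis by linarith
  next
    case False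
    have "0 \<le> - (\<rho> * (48 - 128 * y)) * y" using rho False y by (intro mult_nonneg_nonneg) (auto simp: mult_le_0_iff)
    then have "\<rho> * (48 - 128 * y) * y \<le> 0" by simp
    moreover have "(y - 3/8) * (y - 1) \<le> 0" using False y by (intro mult_nonneg_nonpos) auto
    moreover have "(y - 3/8) * (y - 1) = y * y - 11/8 * y + 3/8" by (simp add: field_simps)
    moreover have "(16 - \<rho> * (48 - 128 * y)) * y = 16 * y - \<rho> * (48 - 128 * y) * y" by (rule left_diff_distrib)
    ultimately show ?thesis using False y by linarith
  qed
  also have "\<dots> \<le> 128 * ((1 - \<rho>)/8 + slack y) * y"
  proof (rule mult_right_mono)
    have "128 * ((1 - \<rho>)/8 + slack y) = 16 - 16 * \<rho> + 128 * slack y" by (simp add: field_simps)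
    moreover have "\<rho> * (48 - 128 * y) = 48 * \<rho> - 128 * (\<rho> * y)" by (simp add: algebra_simps)
    ultimately show "16 - \<rho> * (48 - 128 * y) \<le> 128 * ((1 - \<rho>)/8 + slack y)" using slack_ge[of y] by linarith
  qed (use y in simp)
  finally show ?thesis .
qed

text \<open>The two constants \<open>10\<close> and \<open>14\<close> dominate the squared gradient bounds for \<open>\<Phi> - \<psi>0\<close> in the two ranges of
  \<open>y\<close>; the right sides come from the completed square with multiplier \<open>1/20\<close>.\<close>

lemma lower_slack: "0 \<le> y \<Longrightarrow> 10 \<le> 200 * (1/10 + slack y)" "1/10 \<le> y \<Longrightarrow> 14 \<le> 200 * (1/10 + slack y)"
proof -
  have "-1/20 + (if y \<le> 1/4 then y/5 else 1/20) \<le> slack y" if "0 \<le> y" for y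
  proof (cases rule: slack_cases[of y])
    case five
    have "1/5 * y \<le> \<rho> * y" using five(2) that by (intro mult_right_mono) auto
    then show ?thesis using five by auto
  next
    case six
    show ?thesis
    proof (cases "y \<le> 1/5")
      case True
      have "\<rho> * (1/5 - y) \<le> 5/29 * (1/5 - y)" using six(1) True by (intro mult_right_mono) auto
      then show ?thesis using six(2) True that by (simp add: algebra_simps)
    next
      case False
      then have "0 \<le> \<rho> * (y - 1/5)" using rho by simp
      then show ?thesis using six(2) by (auto simp: algebra_simps)
    qed
  qed
  from this[of y] show "0 \<le> y \<Longrightarrow> 10 \<le> 200 * (1/10 + slack y)" "1/10 \<le> y \<Longrightarrow> 14 \<le> 200 * (1/10 + slack y)"
    by (auto split: if_splits)
qed

end

section \<open>Gradients of the sum of cut-offs\<close>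

lemma ddir_le_grad:
  fixes f :: "real^2 \<Rightarrow> real"
  assumes "f differentiable (at z)"
  shows "ddir w f z \<le> norm w * norm (grad f z)"
proof -
  have "ddir w f z = w \<bullet> grad f z"
    using ddir_coordinates[OF assms, of w] by (simp add: inner_real2 grad_nth)
  then show ?thesis using norm_cauchy_schwarz[of w "grad f z"] by simp
qed

lemma ddir_zero_at_minimum:
  fixes f :: "'a::euclidean_space \<Rightarrow> real"
  assumes "f differentiable (at z)" "\<And>y. 0 \<le> f y" "f z = 0"
  shows "ddir w f z = 0"
proof -
  have "((\<lambda>s. f (z + s *\<^sub>R w)) has_real_derivative ddir w f (z + 0 *\<^sub>R w)) (at 0)"
    by (rule has_derivative_line) (use assms in simp)
  then show ?thesis
    by (rule DERIV_local_min[of _ _ _ 1, THEN trans[rotated]]) (use assms in auto)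
qed

text \<open>Completing the square in \<open>(w1, w2)\<close>; when \<open>a = 0\<close> the hypothesis forces the linear term to vanish.\<close>

lemma quadratic_form_nonneg:
  fixes a g1 g2 \<kappa> l W w1 w2 :: real
  assumes "0 \<le> a" "0 \<le> \<kappa>" "l\<^sup>2 * (g1\<^sup>2 + g2\<^sup>2) \<le> a * \<kappa>"
  shows "0 \<le> a * (w1\<^sup>2 + w2\<^sup>2) + 2 * l * W * (w1 * g1 + w2 * g2) + W\<^sup>2 * \<kappa>"
proof (cases "a = 0")
  case True
  then have "(l * g1)\<^sup>2 + (l * g2)\<^sup>2 \<le> 0" using assms(3) by (simp add: power_mult_distrib distrib_left)
  then have "l * g1 = 0" "l * g2 = 0" by (simp_all add: sum_power2_le_zero_iff)
  then have t: "2 * l * W * (w1 * g1 + w2 * g2) = 0" by auto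
  show ?thesis unfolding t using True assms(2) by simp
next
  case False
  then have a: "0 < a" using assms(1) by simp
  have "0 \<le> (a * w1 + l * W * g1)\<^sup>2 + (a * w2 + l * W * g2)\<^sup>2 + W\<^sup>2 * (a * \<kappa> - l\<^sup>2 * (g1\<^sup>2 + g2\<^sup>2))"
    using assms(3) by (intro add_nonneg_nonneg mult_nonneg_nonneg) auto
  also have "\<dots> = a * (a * (w1\<^sup>2 + w2\<^sup>2) + 2 * l * W * (w1 * g1 + w2 * g2) + W\<^sup>2 * \<kappa>)"
    by (simp add: power2_eq_square algebra_simps)
  finally show ?thesis using a by (simp add: zero_le_mult_iff)
qed

lemma powr_tangent:
  fixes s \<sigma> \<theta> :: real
  assumes "0 < s" "0 < \<sigma>" "0 \<le> \<theta>" "\<theta> < 1"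
  shows "s powr \<theta> \<le> \<sigma> powr \<theta> * (1 - \<theta> + \<theta> / \<sigma> * s)"
proof -
  have "(s / \<sigma>) powr \<theta> * 1 powr (1 - \<theta>) \<le> \<theta> * (s / \<sigma>) + (1 - \<theta>) * 1"
    using assms by (intro Youngs_inequality_0) auto
  then have "\<sigma> powr \<theta> * (s / \<sigma>) powr \<theta> \<le> \<sigma> powr \<theta> * (1 - \<theta> + \<theta> / \<sigma> * s)"
    by (intro mult_left_mono) auto
  moreover have "\<sigma> powr \<theta> * (s / \<sigma>) powr \<theta> = s powr \<theta>"
    using assms by (simp flip: powr_mult)
  ultimately show ?thesis by simp
qed

lemma exp_chord:
  fixes a t r :: real
  assumes "0 < r" "0 \<le> t" "t \<le> r"
  shows "exp (a * t) \<le> 1 + (exp (a * r) - 1) / r * t"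
proof -
  have "exp ((1 - t/r) *\<^sub>R 0 + (t/r) *\<^sub>R (a * r)) \<le> (1 - t/r) * exp 0 + (t/r) * exp (a * r)"
    by (rule convex_onD[OF exp_convex]) (use assms in auto)
  moreover have "(t/r) *\<^sub>R (a * r) = a * t" using assms by simp
  moreover have "(1 - t/r) * exp 0 + (t/r) * exp (a * r) = 1 + (exp (a * r) - 1) / r * t"
    using assms by (simp add: field_simps)
  ultimately show ?thesis by simp
qed

text \<open>Gronwall's inequality started from the last time at which \<open>F\<close> is at most \<open>\<sigma>\<close>; the differential
  inequality is required only above that level.\<close>

lemma exponential_growth_above_level:
  fixes F F' :: "real \<Rightarrow> real"
  assumes F: "\<And>t. (F has_real_derivative F' t) (at t)"
    and grow: "\<And>t. \<sigma> < F t \<Longrightarrow> F' t \<le> a * F t" and "F 0 \<le> \<sigma>" and "0 \<le> a" "0 \<le> \<sigma>"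
  shows "F 1 \<le> \<sigma> * exp a"
proof -
  have cF: "continuous_on A F" for A using F by (meson DERIV_isCont continuous_at_imp_continuous_on)
  let ?S = "{t \<in> {0..1}. F t \<le> \<sigma>}"
  have cS: "compact ?S"
  proof -
    have "closed {t. F t \<le> \<sigma>}" by (intro closed_Collect_le cF continuous_on_const)
    then have "compact ({0..1} \<inter> {t. F t \<le> \<sigma>})" by (intro compact_Int_closed) auto
    moreover have "{0..1} \<inter> {t. F t \<le> \<sigma>} = ?S" by auto
    ultimately show ?thesis by simp
  qed
  have nS: "?S \<noteq> {}"
  proof -
    have "0 \<in> ?S" using assms(3) by simp
    then show ?thesis by blast
  qed
  obtain t0 where t0: "t0 \<in> ?S" "\<And>t. t \<in> ?S \<Longrightarrow> t \<le> t0"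
    using compact_attains_sup[OF cS nS] by blast
  let ?h = "\<lambda>t. F t * exp (- (a * t))"
  have "?h 1 \<le> ?h t0"
  proof (rule DERIV_nonpos_imp_decreasing_open[where f = ?h and a = t0 and b = 1])
    show "t0 \<le> 1" using t0 by auto
    show "continuous_on {t0..1} ?h" by (intro continuous_intros cF)
    fix t assume t: "t0 < t" "t < 1"
    have "\<sigma> < F t" using t t0(1) t0(2)[of t] by force
    then have "F' t \<le> a * F t" by (rule grow)
    then have "F' t * exp (- (a * t)) \<le> a * F t * exp (- (a * t))" by (intro mult_right_mono) auto
    moreover have "(?h has_real_derivative F' t * exp (- (a * t)) + F t * (exp (- (a * t)) * (- a))) (at t)"
      by (rule DERIV_mult'[THEN DERIV_cong]) (auto intro!: F derivative_eq_intros)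
    ultimately show "\<exists>y. (?h has_real_derivative y) (at t) \<and> y \<le> 0"
      by (intro exI[of _ "F' t * exp (- (a * t)) + F t * (exp (- (a * t)) * (- a))"]) (simp add: mult_ac)
  qed
  also have "\<dots> \<le> \<sigma> * 1"
    using t0(1) assms(4,5) by (intro mult_mono) auto
  finally have "F 1 * exp (- a) \<le> \<sigma>" by simp
  then have "F 1 * exp (- a) * exp a \<le> \<sigma> * exp a" by (intro mult_right_mono) auto
  then show ?thesis by (simp add: mult.assoc flip: exp_add)
qed

context shell_family
begin

text \<open>The functions \<open>\<Phi> - \<psi>0\<close> and \<open>n \<psi>0 - \<Phi>\<close> of the two bounds are \<open>comb 1 (- 1)\<close> and
  \<open>comb (- 1) (real n)\<close>.\<close>

definition comb :: "real \<Rightarrow> real \<Rightarrow> real^2 \<Rightarrow> real" where "comb a b = (\<lambda>z. a * Phi z + b * \<psi>0 z)"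

lemma smooth_comb: "smooth_on UNIV (comb a b)"
  unfolding comb_def by (intro smooth_on_add smooth_on_cmult smooth_Phi psi0(1) open_UNIV)

lemma ddir_comb: "ddir w (comb a b) = (\<lambda>z. a * ddir w Phi z + b * ddir w \<psi>0 z)"
proof
  fix z
  have d: "(\<lambda>z. a * Phi z) differentiable (at z)" "(\<lambda>z. b * \<psi>0 z) differentiable (at z)"
    by (auto intro!: derivative_intros v_diff(1) smooth_Phi psi0(1))
  show "ddir w (comb a b) z = a * ddir w Phi z + b * ddir w \<psi>0 z"
    unfolding comb_def ddir_add[OF d] ddir_cmult[OF v_diff(1)[OF smooth_Phi]] ddir_cmult[OF v_diff(1)[OF psi0(1)]] ..
qed

lemma laplacian_comb: "laplacian (comb a b) z = a * laplacian Phi z + b * laplacian \<psi>0 z"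
proof -
  have d: "(\<lambda>z. a * ddir w Phi z) differentiable (at z)" "(\<lambda>z. b * ddir w \<psi>0 z) differentiable (at z)" for w
    by (auto intro!: derivative_intros v_diff(2) smooth_Phi psi0(1))
  have "ddir w (ddir w (comb a b)) z = a * ddir w (ddir w Phi) z + b * ddir w (ddir w \<psi>0) z" for w
    unfolding ddir_comb ddir_add[OF d] ddir_cmult[OF v_diff(2)[OF smooth_Phi]] ddir_cmult[OF v_diff(2)[OF psi0(1)]] ..
  then show ?thesis unfolding laplacian_eq_ddir by (simp add: algebra_simps)
qed

lemma grad_comb: "grad (comb a b) z = a *\<^sub>R grad Phi z + b *\<^sub>R grad \<psi>0 z"
  by (simp add: vec_eq_iff forall_2 grad_nth ddir_comb)

text \<open>The inverse of the natural length at \<open>z\<close>: over this length a Laplacian of size \<open>\<mu> \<psi>0 powr \<theta>\<close>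
  changes a function by the order of \<open>\<psi>0 z\<close>.\<close>

definition "inv_len z = sqrt (\<mu> * \<psi>0 z powr (\<theta> - 1))"

lemma inv_len:
  assumes "\<psi>0 z \<noteq> 0"
  shows "0 < \<psi>0 z" "0 < inv_len z" "(inv_len z)\<^sup>2 = \<mu> * \<psi>0 z powr (\<theta> - 1)" "(inv_len z)\<^sup>2 * \<psi>0 z = \<mu> * \<psi>0 z powr \<theta>"
proof -
  show 1: "0 < \<psi>0 z" using psi0(2)[of z] assms by simp
  show 2: "(inv_len z)\<^sup>2 = \<mu> * \<psi>0 z powr (\<theta> - 1)" unfolding inv_len_def using params(1) by simp
  show "0 < inv_len z" unfolding inv_len_def using params(1) 1 by simp
  show "(inv_len z)\<^sup>2 * \<psi>0 z = \<mu> * \<psi>0 z powr \<theta>" unfolding 2 using 1 by (simp add: powr_diff)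
qed

lemma card_active_le: "real (card (active z)) \<le> real n"
proof -
  have "card (active z) \<le> card {1..n}" unfolding active_def by (intro card_mono) auto
  then show ?thesis by simp
qed

lemma n_ge: "1 \<le> real n * \<rho>" "5 \<le> n"
proof -
  have "(R0 / R)\<^sup>2 \<le> real n" using cover by (simp add: optimal_covering_def)
  then have "(R0 / R)\<^sup>2 * \<rho> \<le> real n * \<rho>" using params(2) by (intro mult_right_mono) auto
  moreover have "(R0 / R)\<^sup>2 * \<rho> = 1" unfolding \<rho>_def using R R0 by (simp add: power_divide)
  ultimately show 1: "1 \<le> real n * \<rho>" by simp
  have "real n > 4"
  proof (rule ccontr)
    assume "\<not> 4 < real n"
    then have "real n * \<rho> \<le> 4 * \<rho>" using params(2) by (intro mult_right_mono) auto
    then show False using 1 params(3) by linarith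
  qed
  then show "5 \<le> n" by simp
qed

lemma q_le: "real n * \<rho> \<le> K1"
proof -
  have "real n \<le> K1 * (R0 / R)\<^sup>2" using cover by (simp add: optimal_covering_def)
  then have "real n * \<rho> \<le> K1 * (R0 / R)\<^sup>2 * \<rho>" using params(2) by (intro mult_right_mono) auto
  moreover have "(R0 / R)\<^sup>2 * \<rho> = 1" unfolding \<rho>_def using R R0 by (simp add: power_divide)
  ultimately show ?thesis by (simp add: mult.assoc)
qed

context
  assumes rho_small: "\<rho> \<le> 4/19"
begin

lemma one_n: "1 \<le> real n" using n_ge by simp

text \<open>Young's inequality bounds \<open>\<psi>0 powr \<theta>\<close>, and with it \<open>|\<Delta>\<psi>0|\<close>, by an affine function of \<open>\<psi>0\<close>, so
  \<open>gradient_bound_self\<close> applies. The radius \<open>5/2\<close> natural lengths nearly optimizes the constant.\<close>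

lemma grad_psi0_bound:
  assumes z: "\<psi>0 z \<noteq> 0"
  shows "norm (grad \<psi>0 z) \<le> 3/2 * inv_len z * \<psi>0 z"
proof -
  note l = inv_len[OF z]
  let ?b = "\<lambda>y. \<psi>0 z powr \<theta> * (1 - \<theta> + \<theta> / \<psi>0 z * \<psi>0 y)"
  have lap: "\<bar>laplacian \<psi>0 y\<bar> \<le> \<rho> * \<mu> * ?b y" for y
  proof (rule laplacian_bounds_on(1)[OF card_active_le open_UNIV UNIV_I _ _ _ one_n])
    show "continuous_on UNIV ?b" by (intro continuous_intros smooth_on_continuous[OF psi0(1)])
    show "0 \<le> ?b y" for y using params(4,5) psi0(2)[of y] l(1) by (intro mult_nonneg_nonneg add_nonneg_nonneg) auto
    show "\<psi>0 y powr \<theta> \<le> ?b y" if "\<psi>0 y \<noteq> 0" for y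
      using powr_tangent[OF inv_len(1)[OF that] l(1) params(4,5)] .
  qed
  have e: "\<theta> / \<psi>0 z * (\<rho> * \<mu> * \<psi>0 z powr \<theta>) * ((5/2) / inv_len z)\<^sup>2 / 4 = \<theta> * \<rho> * (25/16)"
  proof -
    have "\<theta> / \<psi>0 z * (\<rho> * \<mu> * \<psi>0 z powr \<theta>) = \<theta> * \<rho> * (inv_len z)\<^sup>2"
      using l(1) l(4)[symmetric] by (simp add: mult.assoc)
    then show ?thesis using l(2) by (simp add: power_divide power2_eq_square)
  qed
  have tr: "\<theta> * \<rho> \<le> 4/19" using mult_mono[of \<theta> 1 \<rho> "4/19"] rho_small params(2,4,5) by simp
  have "(5/2) / inv_len z * norm (grad \<psi>0 z) \<le> 2 * \<psi>0 z + 2 * (\<rho> * \<mu> * \<psi>0 z powr \<theta>) * (1 - \<theta> + \<theta> / \<psi>0 z * \<psi>0 z)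
      * (7/12 + 31/240 * (33/100 / (1 - 33/100))) * ((5/2) / inv_len z)\<^sup>2"
  proof (rule gradient_bound_self[OF psi0(1) _ psi0(2)])
    show "\<bar>laplacian \<psi>0 y\<bar> \<le> \<rho> * \<mu> * \<psi>0 z powr \<theta> * (1 - \<theta> + \<theta> / \<psi>0 z * \<psi>0 y)" for y
      using lap[of y] by (simp only: mult.assoc)
    show "\<theta> / \<psi>0 z * (\<rho> * \<mu> * \<psi>0 z powr \<theta>) * ((5/2) / inv_len z)\<^sup>2 / 4 \<le> 33/100"
      unfolding e using tr by simp
    show "0 \<le> \<rho> * \<mu> * \<psi>0 z powr \<theta>" using params(1,2) by (intro mult_nonneg_nonneg) auto
  qed (use l params(4,5) in auto)
  also have "2 * (\<rho> * \<mu> * \<psi>0 z powr \<theta>) * (1 - \<theta> + \<theta> / \<psi>0 z * \<psi>0 z) = 2 * \<rho> * ((inv_len z)\<^sup>2 * \<psi>0 z)"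
    using l(1) unfolding l(4) by simp
  also have "2 * \<psi>0 z + 2 * \<rho> * ((inv_len z)\<^sup>2 * \<psi>0 z) * (7/12 + 31/240 * (33/100 / (1 - 33/100))) * ((5/2) / inv_len z)\<^sup>2
      = \<psi>0 z * (2 + \<rho> * (25/2 * (7/12 + 31/240 * (33/100 / (1 - 33/100)))))"
    using l(2) by (simp add: field_simps power2_eq_square)
  also have "\<dots> \<le> \<psi>0 z * (15/4)"
    using l(1) rho_small by (intro mult_left_mono) (auto simp: field_simps)
  finally show ?thesis using l(2) by (simp add: field_simps)
qed

text \<open>Where \<open>\<psi>0\<close> exceeds \<open>\<psi>0 z\<close>, the inverse length is at most the one at \<open>z\<close>, because \<open>\<theta> < 1\<close>. So the
  gradient bound becomes a linear differential inequality along the segment.\<close>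

lemma psi0_growth:
  assumes z: "\<psi>0 z \<noteq> 0"
  shows "\<psi>0 (z + h) \<le> \<psi>0 z * exp (3/2 * inv_len z * norm h)"
proof -
  note l = inv_len[OF z]
  have "\<psi>0 (z + 1 *\<^sub>R h) \<le> \<psi>0 z * exp (3/2 * inv_len z * norm h)"
  proof (rule exponential_growth_above_level[where F = "\<lambda>t. \<psi>0 (z + t *\<^sub>R h)"])
    show "((\<lambda>t. \<psi>0 (z + t *\<^sub>R h)) has_real_derivative ddir h \<psi>0 (z + t *\<^sub>R h)) (at t)" for t
      by (rule has_derivative_line[OF v_diff(1)[OF psi0(1)]])
    show "ddir h \<psi>0 (z + t *\<^sub>R h) \<le> 3/2 * inv_len z * norm h * \<psi>0 (z + t *\<^sub>R h)" if gt: "\<psi>0 z < \<psi>0 (z + t *\<^sub>R h)" for t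
    proof -
      let ?y = "z + t *\<^sub>R h"
      have y: "\<psi>0 ?y \<noteq> 0" using gt l(1) by simp
      have ll: "inv_len ?y \<le> inv_len z"
        unfolding inv_len_def using params(1,5) gt l(1) by (intro real_sqrt_le_mono mult_left_mono powr_mono2') auto
      have "ddir h \<psi>0 ?y \<le> norm h * norm (grad \<psi>0 ?y)" by (rule ddir_le_grad[OF v_diff(1)[OF psi0(1)]])
      also have "\<dots> \<le> norm h * (3/2 * inv_len ?y * \<psi>0 ?y)" by (intro mult_left_mono grad_psi0_bound y) auto
      also have "\<dots> \<le> norm h * (3/2 * inv_len z * \<psi>0 ?y)"
        using ll psi0(2) by (intro mult_left_mono mult_right_mono) auto
      finally show ?thesis by (simp add: mult_ac)
    qed
  qed (use l in auto)
  then show ?thesis by simp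
qed

text \<open>By \<open>psi0_growth\<close> the majorant \<open>\<psi>0 powr \<theta>\<close> of the Laplacian grows at most exponentially away from
  \<open>z\<close>; on a circle of given radius the exponential lies below its chord, which has the affine form required
  by \<open>gradient_bound\<close>. The radius \<open>r\<close> is measured in natural lengths, and \<open>k\<close> is the cost of
  the Laplacian relative to \<open>(n - 1) \<mu>\<close>.\<close>

lemma comb_gradient:
  assumes z: "\<psi>0 z \<noteq> 0" and r: "0 < r" and nn: "\<And>y. 0 \<le> comb a b y"
    and k: "\<And>y B. 0 \<le> B \<Longrightarrow> \<bar>laplacian \<psi>0 y\<bar> \<le> \<rho> * \<mu> * B \<Longrightarrow>
      \<bar>laplacian Phi y - laplacian \<psi>0 y\<bar> \<le> (real n - 1) * (\<mu> * B) \<Longrightarrow>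
      \<bar>laplacian (comb a b) y\<bar> \<le> (real n - 1) * k * (\<mu> * B)" and k0: "0 \<le> k"
  shows "r * norm (grad (comb a b) z) \<le> inv_len z * (2 * comb a b z + 2 * ((real n - 1) * k * \<psi>0 z * r\<^sup>2 * genv (3/2 * r)))"
proof -
  note l = inv_len[OF z]
  let ?G = "3/2 * inv_len z"
  let ?b = "\<lambda>y. \<psi>0 z powr \<theta> * exp (?G * norm (y - z))"
  have b: "continuous_on UNIV ?b" by (intro continuous_intros)
  have bp: "\<psi>0 y powr \<theta> \<le> ?b y" if "\<psi>0 y \<noteq> 0" for y
  proof -
    have "\<psi>0 y \<le> \<psi>0 z * exp (?G * norm (y - z))" using psi0_growth[OF z, of "y - z"] by simp
    then have "\<psi>0 y powr \<theta> \<le> (\<psi>0 z * exp (?G * norm (y - z))) powr \<theta>"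
      using psi0(2) params(4) by (intro powr_mono2) auto
    also have "\<dots> = \<psi>0 z powr \<theta> * exp (?G * norm (y - z)) powr \<theta>" using l(1) by (simp add: powr_mult)
    also have "exp (?G * norm (y - z)) powr \<theta> \<le> exp (?G * norm (y - z)) powr 1"
      using params(5) l(2) by (intro powr_mono) auto
    finally show ?thesis using l(1) by (simp add: mult_left_mono)
  qed
  have lap: "\<bar>laplacian (comb a b) y\<bar> \<le> (real n - 1) * k * (\<mu> * ?b y)" for y
  proof (rule k)
    have b0: "\<And>y. y \<in> UNIV \<Longrightarrow> 0 \<le> ?b y" by simp
    show "0 \<le> ?b y" by simp
    show "\<bar>laplacian \<psi>0 y\<bar> \<le> \<rho> * \<mu> * ?b y"
      by (rule laplacian_bounds_on(1)[OF card_active_le open_UNIV UNIV_I b b0 bp one_n])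
    show "\<bar>laplacian Phi y - laplacian \<psi>0 y\<bar> \<le> (real n - 1) * (\<mu> * ?b y)"
      by (rule laplacian_bounds_on(2)[OF card_active_le open_UNIV UNIV_I b b0 bp one_n])
  qed
  define M0 where "M0 = (real n - 1) * k * (\<mu> * \<psi>0 z powr \<theta>)"
  define r' where "r' = r / inv_len z"
  have r': "0 < r'" "inv_len z * r' = r" using r l(2) by (auto simp: r'_def)
  have M0: "0 \<le> M0" unfolding M0_def using one_n k0 params(1) by (intro mult_nonneg_nonneg) auto
  have "r' * norm (grad (comb a b) z) \<le> 2 * comb a b z + 2 * (M0 * r'\<^sup>2 * (1/4 + 99/140 * (1/12))
      + M0 * (exp (?G * r') - 1) / r' * r' ^ 3 * (1/9 + 99/140 * (1/72)))"
  proof (rule gradient_bound[OF smooth_comb r'(1) nn])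
    fix h :: "real^2" assume h: "norm h \<le> r'"
    have "\<bar>laplacian (comb a b) (z + h)\<bar> \<le> M0 * exp (?G * norm h)"
      using lap[of "z + h"] by (simp add: M0_def mult_ac)
    also have "\<dots> \<le> M0 * (1 + (exp (?G * r') - 1) / r' * norm h)"
      using h r'(1) M0 by (intro mult_left_mono exp_chord) auto
    finally show "\<bar>laplacian (comb a b) (z + h)\<bar> \<le> M0 + M0 * (exp (?G * r') - 1) / r' * norm h"
      by (simp add: algebra_simps)
  qed
  also have "M0 * r'\<^sup>2 * (1/4 + 99/140 * (1/12)) + M0 * (exp (?G * r') - 1) / r' * r' ^ 3 * (1/9 + 99/140 * (1/72))
      = M0 * r'\<^sup>2 * genv (?G * r')"
  proof -
    have "M0 * E / r' * r' ^ 3 = M0 * r'\<^sup>2 * E" for E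
      using r'(1) by (simp add: power2_eq_square power3_eq_cube)
    then show ?thesis unfolding genv_def by (simp add: distrib_left)
  qed
  also have "?G * r' = 3/2 * r" using r'(2) by simp
  also have "M0 * r'\<^sup>2 = (real n - 1) * k * \<psi>0 z * r\<^sup>2"
  proof -
    have "M0 = (real n - 1) * k * ((inv_len z)\<^sup>2 * \<psi>0 z)" unfolding M0_def l(4) ..
    then have "M0 * r'\<^sup>2 = (real n - 1) * k * \<psi>0 z * (inv_len z * r')\<^sup>2" by (simp add: power_mult_distrib mult_ac)
    then show ?thesis unfolding r'(2) .
  qed
  finally have "inv_len z * (r' * norm (grad (comb a b) z)) \<le> inv_len z * (2 * comb a b z + 2 * ((real n - 1) * k * \<psi>0 z * r\<^sup>2 * genv (3/2 * r)))"
    using l(2) by (intro mult_left_mono) auto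
  then show ?thesis unfolding mult.assoc[symmetric] r'(2) .
qed

end

end

section \<open>Pointwise comparison\<close>

context shell_family
begin

lemma psi0_le_powr: "\<psi>0 z \<le> \<psi>0 z powr \<theta>"
proof (cases "\<psi>0 z = 0")
  case False
  then have "\<psi>0 z powr 1 \<le> \<psi>0 z powr \<theta>"
    using psi0(2,3)[of z] params(5) by (intro powr_mono') auto
  then show ?thesis using psi0(2)[of z] by simp
qed simp

text \<open>The coefficient of \<open>w\<^sup>2\<close>, with \<open>w\<close> the vorticity, in the pointwise form of the two flux bounds, after
  adding \<open>l\<close> times the null divergence. The last term pays for the time derivative of \<open>\<eta>\<close>.\<close>

definition "lower_weight l z = l * laplacian (comb 1 (- 1)) z
  + (real n * \<rho> * K2 * \<mu> * \<psi>0 z powr \<theta> - laplacian Phi z - \<rho> * \<mu> * Phi z) / 2"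

definition "upper_weight l z = l * laplacian (comb (- 1) (real n)) z
  + (real n * \<rho> * K2 * \<mu> * \<psi>0 z powr \<theta> + laplacian Phi z - \<rho> * \<mu> * Phi z) / 2"

text \<open>The crude count: \<open>m - 1\<close> for the active cut-offs other than the one equal to \<open>\<psi>0\<close>, \<open>\<rho>\<close> for that
  one, and \<open>m * \<rho>\<close> for the time derivative.\<close>

lemma weights_generic:
  assumes m: "\<And>z. real (card (active z)) \<le> m" "1 \<le> m" and D: "m - 1 + \<rho> + m * \<rho> \<le> real n * \<rho> * K2"
    and z: "\<psi>0 z \<noteq> 0"
  shows "0 \<le> lower_weight 0 z" "0 \<le> upper_weight 0 z"
proof -
  define M where "M = \<mu> * \<psi>0 z powr \<theta>"
  have M: "0 \<le> M" unfolding M_def using params(1) by simp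
  have lap: "\<bar>laplacian \<psi>0 z\<bar> \<le> \<rho> * M" "\<bar>laplacian Phi z - laplacian \<psi>0 z\<bar> \<le> (m - 1) * M"
    unfolding M_def mult.assoc[symmetric] using laplacian_bounds[OF m(1) m(2) z] by (simp_all add: mult.assoc)
  have "m * \<psi>0 z \<le> m * \<psi>0 z powr \<theta>" using psi0_le_powr m(2) by (intro mult_left_mono) auto
  with Phi_bounds(2)[OF m(1), of z] have "Phi z \<le> m * \<psi>0 z powr \<theta>" by (rule order_trans)
  then have "\<mu> * Phi z \<le> \<mu> * (m * \<psi>0 z powr \<theta>)" using params(1) by (intro mult_left_mono) auto
  then have "\<rho> * (\<mu> * Phi z) \<le> \<rho> * (m * M)" unfolding M_def using params(2) by (intro mult_left_mono) (auto simp: mult_ac)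
  moreover have "(m - 1 + \<rho> + m * \<rho>) * M \<le> real n * \<rho> * K2 * M" using D M by (rule mult_right_mono)
  moreover have "(m - 1 + \<rho> + m * \<rho>) * M = (m - 1) * M + \<rho> * M + \<rho> * (m * M)" by (simp add: algebra_simps)
  moreover have "real n * \<rho> * K2 * \<mu> * \<psi>0 z powr \<theta> = real n * \<rho> * K2 * M" by (simp add: M_def mult_ac)
  moreover have "\<rho> * \<mu> * Phi z = \<rho> * (\<mu> * Phi z)" by simp
  ultimately have "0 \<le> real n * \<rho> * K2 * \<mu> * \<psi>0 z powr \<theta> - laplacian Phi z - \<rho> * \<mu> * Phi z"
    "0 \<le> real n * \<rho> * K2 * \<mu> * \<psi>0 z powr \<theta> + laplacian Phi z - \<rho> * \<mu> * Phi z"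
    using lap by linarith+
  then show "0 \<le> lower_weight 0 z" "0 \<le> upper_weight 0 z"
    unfolding lower_weight_def upper_weight_def by simp_all
qed

lemma grad_comb_zero:
  assumes "\<And>y. 0 \<le> comb a b y" "comb a b z = 0" shows "grad (comb a b) z = 0"
  using ddir_zero_at_minimum[OF v_diff(1)[OF smooth_comb] assms]
  by (simp add: vec_eq_iff forall_2 grad_nth)

lemma peers_nonneg: "0 \<le> comb 1 (- 1) z" "0 \<le> comb (- 1) (real n) z"
  using Phi_bounds[OF card_active_le, of z] by (simp_all add: comb_def)

context
  assumes crit: "(real n * \<rho> - 1) * (real n - 1) < \<rho>" and K2: "real n \<le> K2"
begin

interpretation critical_numbers n \<rho>
  using n_ge params(2,3) crit by unfold_locales auto

context
  fixes z assumes z: "\<psi>0 z \<noteq> 0"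
begin

text \<open>The part of the possible overlap that is missing at \<open>z\<close>: it is \<open>0\<close> if all cut-offs equal \<open>\<psi>0\<close> and
  \<open>1\<close> if their sum is \<open>\<psi>0\<close>.\<close>

definition "defect = comb (- 1) (real n) z / ((real n - 1) * \<psi>0 z)"

lemma N4: "4 \<le> real n - 1" using n_ge(2) by simp

lemma peers: "comb (- 1) (real n) z = (real n - 1) * defect * \<psi>0 z" "comb 1 (- 1) z = (real n - 1) * (1 - defect) * \<psi>0 z"
  "Phi z = (real n - (real n - 1) * defect) * \<psi>0 z" "0 \<le> defect" "defect \<le> 1"
proof -
  have p: "0 < (real n - 1) * \<psi>0 z" using N4 inv_len(1)[OF z] by simp
  show 1: "comb (- 1) (real n) z = (real n - 1) * defect * \<psi>0 z"
  proof -
    have "c = c / b * b" if "0 < b" for b c :: real using that by simp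
    from this[OF p] show ?thesis unfolding defect_def by (simp only: mult_ac)
  qed
  have s: "comb (- 1) (real n) z + comb 1 (- 1) z = (real n - 1) * \<psi>0 z" by (simp add: comb_def algebra_simps)
  then show 2: "comb 1 (- 1) z = (real n - 1) * (1 - defect) * \<psi>0 z" unfolding 1 by (simp add: algebra_simps)
  show "Phi z = (real n - (real n - 1) * defect) * \<psi>0 z" using 1 by (simp add: comb_def algebra_simps)
  show "0 \<le> defect" unfolding defect_def using p peers_nonneg(2) by (intro divide_nonneg_pos) auto
  show "defect \<le> 1" unfolding defect_def using p peers_nonneg(1)[of z] s by (simp add: divide_le_eq)
qed

lemma weights_ge:
  assumes "0 \<le> l" "l \<le> 1/2"
  shows "(real n - 1) * (\<mu> * \<psi>0 z powr \<theta>) / 2 * (2 * l + slack defect) \<le> lower_weight l z"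
    and "(real n - 1) * (\<mu> * \<psi>0 z powr \<theta>) / 2 * (2 * l * (1 - \<rho>) + slack defect) \<le> upper_weight l z"
proof -
  define M where "M = \<mu> * \<psi>0 z powr \<theta>"
  define N where "N = real n - 1"
  define d where "d = laplacian Phi z - laplacian \<psi>0 z"
  define e where "e = laplacian \<psi>0 z"
  have M: "0 \<le> M" unfolding M_def using params(1) by simp
  have N: "4 \<le> N" using N4 by (simp add: N_def)
  have lap: "\<bar>e\<bar> \<le> \<rho> * M" "\<bar>d\<bar> \<le> N * M"
    unfolding M_def mult.assoc[symmetric] d_def e_def N_def
    using laplacian_bounds[OF card_active_le one_n z] rho_small(1) by (simp_all add: mult.assoc)
  have D: "laplacian (comb 1 (- 1)) z = d" "laplacian (comb (- 1) (real n)) z = N * e - d" "laplacian Phi z = d + e"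
    unfolding laplacian_comb d_def e_def N_def by (simp_all add: algebra_simps)
  have "N * defect \<le> N * 1" using N peers(5) by (intro mult_left_mono) auto
  then have P0: "0 \<le> real n - N * defect" by (simp add: N_def)
  have "\<rho> * \<mu> * Phi z = (\<rho> * (real n - N * defect)) * (\<mu> * \<psi>0 z)" unfolding peers(3) N_def by (simp add: mult_ac)
  also have "\<dots> \<le> (\<rho> * (real n - N * defect)) * M"
    unfolding M_def using P0 params(1,2) psi0_le_powr[of z] by (intro mult_left_mono mult_nonneg_nonneg) auto
  finally have PH: "\<rho> * \<mu> * Phi z \<le> (\<rho> * (real n - N * defect)) * M" .
  have "real n * \<rho> * real n * M \<le> real n * \<rho> * K2 * M"
    using K2 params(2) M by (intro mult_right_mono mult_left_mono) auto
  then have KK: "real n * \<rho> * real n * M \<le> real n * \<rho> * K2 * \<mu> * \<psi>0 z powr \<theta>" by (simp add: M_def mult_ac)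
  have S: "N * slack defect = N * (real n * \<rho> - 1) - \<rho> + \<rho> * N * defect"
    unfolding slack_def N_def[symmetric] using N by (simp add: field_simps)
  have base: "real n * \<rho> * real n * M - N * M - \<rho> * M - (\<rho> * (real n - N * defect)) * M = N * slack defect * M"
  proof -
    have n: "real n = N + 1" by (simp add: N_def)
    show ?thesis unfolding S unfolding n by (simp add: algebra_simps)
  qed
  have ld: "\<bar>(1/2 - l) * d\<bar> \<le> (1/2 - l) * (N * M)" unfolding abs_mult using assms lap by (intro mult_mono) auto
  have le: "\<bar>l * N * e\<bar> \<le> l * N * (\<rho> * M)" unfolding abs_mult using assms lap N by (intro mult_mono) auto
  have eqL: "N * M / 2 * (2 * l + slack defect) = l * (N * M) + N * slack defect * M / 2" by (simp add: field_simps)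
  have eqU: "N * M / 2 * (2 * l * (1 - \<rho>) + slack defect) = l * (N * M) - l * N * (\<rho> * M) + N * slack defect * M / 2"
    by (simp add: field_simps)
  have ex: "(1/2 - l) * d = d/2 - l * d" "(1/2 - l) * (N * M) = (N * M)/2 - l * (N * M)" by (simp_all add: algebra_simps)
  have "l * (N * M) + N * slack defect * M / 2 \<le> lower_weight l z"
    unfolding lower_weight_def D diff_divide_distrib add_divide_distrib using PH KK base ld lap(1) unfolding ex by linarith
  then show "(real n - 1) * (\<mu> * \<psi>0 z powr \<theta>) / 2 * (2 * l + slack defect) \<le> lower_weight l z"
    unfolding N_def[symmetric] M_def[symmetric] eqL .
  have ex2: "l * (N * e - d) = l * N * e - l * d" by (simp add: algebra_simps)
  have "l * (N * M) - l * N * (\<rho> * M) + N * slack defect * M / 2 \<le> upper_weight l z"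
    unfolding upper_weight_def D ex2 diff_divide_distrib add_divide_distrib using PH KK base ld le lap(1) unfolding ex by linarith
  then show "(real n - 1) * (\<mu> * \<psi>0 z powr \<theta>) / 2 * (2 * l * (1 - \<rho>) + slack defect) \<le> upper_weight l z"
    unfolding N_def[symmetric] M_def[symmetric] eqU .
qed

lemma upper_peer_gradient:
  assumes "0 < r"
  shows "r * norm (grad (comb (- 1) (real n)) z)
    \<le> inv_len z * ((real n - 1) * \<psi>0 z) * (2 * defect + 2 * (1 + \<rho>) * r\<^sup>2 * genv (3/2 * r))"
proof -
  have "r * norm (grad (comb (- 1) (real n)) z) \<le> inv_len z * (2 * comb (- 1) (real n) z
      + 2 * ((real n - 1) * (1 + \<rho>) * \<psi>0 z * r\<^sup>2 * genv (3/2 * r)))"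
  proof (rule comb_gradient[OF rho_small(1) z assms peers_nonneg(2)])
    fix y B assume B: "0 \<le> B" "\<bar>laplacian \<psi>0 y\<bar> \<le> \<rho> * \<mu> * B"
      "\<bar>laplacian Phi y - laplacian \<psi>0 y\<bar> \<le> (real n - 1) * (\<mu> * B)"
    have "\<bar>(real n - 1) * laplacian \<psi>0 y\<bar> \<le> (real n - 1) * (\<rho> * \<mu> * B)"
      unfolding abs_mult using B N4 by (intro mult_mono) auto
    moreover have "laplacian (comb (- 1) (real n)) y = (real n - 1) * laplacian \<psi>0 y - (laplacian Phi y - laplacian \<psi>0 y)"
      unfolding laplacian_comb by (simp add: algebra_simps)
    moreover have "(real n - 1) * (1 + \<rho>) * (\<mu> * B) = (real n - 1) * (\<mu> * B) + (real n - 1) * (\<rho> * \<mu> * B)"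
      by (simp add: algebra_simps)
    ultimately show "\<bar>laplacian (comb (- 1) (real n)) y\<bar> \<le> (real n - 1) * (1 + \<rho>) * (\<mu> * B)" using B(3) by linarith
  qed (use params(2) in simp)
  then show ?thesis unfolding peers(1) by (simp add: algebra_simps)
qed

lemma lower_peer_gradient:
  assumes "0 < r"
  shows "r * norm (grad (comb 1 (- 1)) z)
    \<le> inv_len z * ((real n - 1) * \<psi>0 z) * (2 * (1 - defect) + 2 * r\<^sup>2 * genv (3/2 * r))"
proof -
  have "r * norm (grad (comb 1 (- 1)) z) \<le> inv_len z * (2 * comb 1 (- 1) z
      + 2 * ((real n - 1) * 1 * \<psi>0 z * r\<^sup>2 * genv (3/2 * r)))"
    by (rule comb_gradient[OF rho_small(1) z assms peers_nonneg(1)]) (auto simp: laplacian_comb)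
  then show ?thesis unfolding peers(2) by (simp add: algebra_simps)
qed

text \<open>The radius \<open>3/2 w\<close> makes both terms of the gradient bound proportional to \<open>w\<close>, as a bound of
  the squared gradient by the function itself requires.\<close>

lemma upper_peer_gradient_small:
  assumes w: "defect = w\<^sup>2" "0 \<le> w"
  shows "norm (grad (comb (- 1) (real n)) z)
    \<le> inv_len z * ((real n - 1) * \<psi>0 z) * (w * (4/3 + 3 * (1 + \<rho>) * genv (9/4 * w)))"
proof (cases "w = 0")
  case True
  then have "grad (comb (- 1) (real n)) z = 0" using w peers(1) by (intro grad_comb_zero peers_nonneg) auto
  then show ?thesis using True by simp
next
  case False
  then have w0: "0 < w" using w(2) by simp
  have "3/2 * w * norm (grad (comb (- 1) (real n)) z)
    \<le> inv_len z * ((real n - 1) * \<psi>0 z) * (2 * w\<^sup>2 + 2 * (1 + \<rho>) * (3/2 * w)\<^sup>2 * genv (3/2 * (3/2 * w)))"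
    unfolding w(1)[symmetric] by (rule upper_peer_gradient) (use w0 in simp)
  also have "3/2 * (3/2 * w) = 9/4 * w" by simp
  also have "2 * w\<^sup>2 + 2 * (1 + \<rho>) * (3/2 * w)\<^sup>2 * genv (9/4 * w) = 3/2 * w * (w * (4/3 + 3 * (1 + \<rho>) * genv (9/4 * w)))"
    by (simp add: power2_eq_square algebra_simps)
  finally have "3/2 * w * norm (grad (comb (- 1) (real n)) z)
    \<le> 3/2 * w * (inv_len z * ((real n - 1) * \<psi>0 z) * (w * (4/3 + 3 * (1 + \<rho>) * genv (9/4 * w))))" by (simp only: mult_ac)
  then show ?thesis by (rule mult_left_le_imp_le) (use w0 in simp)
qed

text \<open>Squaring a gradient bound in natural units: the inverse length squared times \<open>\<psi>0 z\<close> is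
  \<open>\<mu> \<psi>0 powr \<theta>\<close>.\<close>

lemma squared_gradient:
  assumes "norm g \<le> inv_len z * ((real n - 1) * \<psi>0 z) * a" "a\<^sup>2 \<le> A * b" "0 \<le> a"
  shows "(norm g)\<^sup>2 \<le> (real n - 1) * (\<mu> * \<psi>0 z powr \<theta>) * ((real n - 1) * b * \<psi>0 z) * A"
proof -
  have "(norm g)\<^sup>2 \<le> (inv_len z * ((real n - 1) * \<psi>0 z) * a)\<^sup>2" using assms(1) by (rule power_mono) simp
  also have "\<dots> = ((real n - 1) * ((inv_len z)\<^sup>2 * \<psi>0 z) * ((real n - 1) * \<psi>0 z)) * a\<^sup>2"
    by (simp add: power2_eq_square mult_ac)
  also have "\<dots> \<le> ((real n - 1) * ((inv_len z)\<^sup>2 * \<psi>0 z) * ((real n - 1) * \<psi>0 z)) * (A * b)"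
    using assms(2) N4 inv_len(1,2)[OF z] by (intro mult_left_mono mult_nonneg_nonneg) auto
  finally show ?thesis unfolding inv_len(4)[OF z] by (simp add: mult_ac)
qed

lemma finish_core:
  assumes g: "(norm g)\<^sup>2 \<le> (real n - 1) * (\<mu> * \<psi>0 z powr \<theta>) * X * A" and X: "0 \<le> X"
    and \<kappa>: "(real n - 1) * (\<mu> * \<psi>0 z powr \<theta>) / 2 * B \<le> \<kappa>" and AB: "l\<^sup>2 * A \<le> B / 2"
  shows "l\<^sup>2 * (norm g)\<^sup>2 \<le> X * \<kappa>"
proof -
  define M where "M = (real n - 1) * (\<mu> * \<psi>0 z powr \<theta>)"
  have M: "0 \<le> M" unfolding M_def using N4 params(1) by (intro mult_nonneg_nonneg) auto
  have "l\<^sup>2 * (norm g)\<^sup>2 \<le> l\<^sup>2 * (M * X * A)" using g unfolding M_def by (intro mult_left_mono) auto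
  also have "\<dots> = (M * X) * (l\<^sup>2 * A)" by (simp add: mult_ac)
  also have "\<dots> \<le> (M * X) * (B / 2)" using AB M X by (intro mult_left_mono mult_nonneg_nonneg) auto
  also have "\<dots> = X * (M / 2 * B)" by (simp add: mult_ac)
  also have "\<dots> \<le> X * \<kappa>" using \<kappa> X unfolding M_def by (intro mult_left_mono) auto
  finally show ?thesis .
qed

text \<open>The multiplier \<open>1/16\<close> balances the gain, linear in the multiplier, against the quadratic cost of the
  completed square when \<open>defect\<close> is small and \<open>n = 5\<close>.\<close>

lemma upper_critical:
  "(1/16)\<^sup>2 * (norm (grad (comb (- 1) (real n)) z))\<^sup>2 \<le> comb (- 1) (real n) z * upper_weight (1/16) z"
  "0 \<le> upper_weight (1/16) z"
proof -
  let ?A = "128 * ((1 - \<rho>)/8 + slack defect)"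
  define w where "w = sqrt defect"
  have w: "defect = w\<^sup>2" "0 \<le> w" unfolding w_def using peers(4) by simp_all
  have g: "0 \<le> genv (9/4 * w)" if "w \<le> 1/2" using that w(2) by (intro genv_bounds(2)) auto
  have g': "0 \<le> genv (9/8)" by (rule genv_bounds(2)) auto
  have wh: "w \<le> 1/2" if "defect \<le> 1/4"
  proof (rule power2_le_imp_le)
    show "w\<^sup>2 \<le> (1/2)\<^sup>2" using that w(1) by (simp add: power2_eq_square)
  qed simp
  have "(norm (grad (comb (- 1) (real n)) z))\<^sup>2
      \<le> (real n - 1) * (\<mu> * \<psi>0 z powr \<theta>) * ((real n - 1) * defect * \<psi>0 z) * ?A \<and> 0 \<le> ?A"
  proof (cases "defect \<le> 1/4")
    case True
    note b = upper_small[OF w(2) wh[OF True]]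
    have "(w * (4/3 + 3 * (1 + \<rho>) * genv (9/4 * w)))\<^sup>2 \<le> ?A * defect"
    proof -
      have "(w * a)\<^sup>2 = a\<^sup>2 * defect" for a unfolding w(1) by (simp only: power_mult_distrib mult.commute)
      then show ?thesis using mult_right_mono[OF b[folded w(1)] peers(4)] by (simp only:)
    qed
    moreover have "0 \<le> w * (4/3 + 3 * (1 + \<rho>) * genv (9/4 * w))"
      using g[OF wh[OF True]] w(2) params(2) by (intro mult_nonneg_nonneg add_nonneg_nonneg) auto
    moreover have "0 \<le> ?A" using b zero_le_power2 order_trans unfolding w(1) by blast
    ultimately show ?thesis using squared_gradient[OF upper_peer_gradient_small[OF w]] by blast
  next
    case False
    then have d: "1/4 \<le> defect" by simp
    note b = upper_large[OF d peers(5)]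
    have "3/4 * norm (grad (comb (- 1) (real n)) z)
      \<le> inv_len z * ((real n - 1) * \<psi>0 z) * (2 * defect + 2 * (1 + \<rho>) * (3/4)\<^sup>2 * genv (3/2 * (3/4)))"
      by (rule upper_peer_gradient) simp
    also have "3/2 * (3/4) = (9/8::real)" by simp
    also have "2 * defect + 2 * (1 + \<rho>) * (3/4)\<^sup>2 * genv (9/8) = 3/4 * (8/3 * defect + 3/2 * (1 + \<rho>) * genv (9/8))"
      by (simp add: power2_eq_square algebra_simps)
    finally have "3/4 * norm (grad (comb (- 1) (real n)) z)
        \<le> 3/4 * (inv_len z * ((real n - 1) * \<psi>0 z) * (8/3 * defect + 3/2 * (1 + \<rho>) * genv (9/8)))" by (simp only: mult_ac)
    then have "norm (grad (comb (- 1) (real n)) z)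
        \<le> inv_len z * ((real n - 1) * \<psi>0 z) * (8/3 * defect + 3/2 * (1 + \<rho>) * genv (9/8))"
      by (rule mult_left_le_imp_le) simp
    moreover have "0 \<le> 8/3 * defect + 3/2 * (1 + \<rho>) * genv (9/8)"
      using g' d params(2) by (intro mult_nonneg_nonneg add_nonneg_nonneg) auto
    moreover have "0 \<le> ?A"
    proof -
      have "0 \<le> ?A * defect" using b zero_le_power2 order_trans by blast
      then show ?thesis using d by (simp add: zero_le_mult_iff)
    qed
    ultimately show ?thesis using squared_gradient[OF _ b] by blast
  qed
  then have G: "(norm (grad (comb (- 1) (real n)) z))\<^sup>2
      \<le> (real n - 1) * (\<mu> * \<psi>0 z powr \<theta>) * comb (- 1) (real n) z * ?A" and A: "0 \<le> ?A"
    unfolding peers(1) by blast+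
  have W: "(real n - 1) * (\<mu> * \<psi>0 z powr \<theta>) / 2 * (2 * (1/16) * (1 - \<rho>) + slack defect) \<le> upper_weight (1/16) z"
    by (rule weights_ge(2)) auto
  have B: "2 * (1/16) * (1 - \<rho>) + slack defect = ?A / 128" by simp
  show "(1/16)\<^sup>2 * (norm (grad (comb (- 1) (real n)) z))\<^sup>2 \<le> comb (- 1) (real n) z * upper_weight (1/16) z"
    by (rule finish_core[OF G peers_nonneg(2) W]) (simp add: B power2_eq_square)
  have "0 \<le> (real n - 1) * (\<mu> * \<psi>0 z powr \<theta>) / 2 * (2 * (1/16) * (1 - \<rho>) + slack defect)"
  proof (intro mult_nonneg_nonneg divide_nonneg_pos)
    show "0 \<le> 2 * (1/16) * (1 - \<rho>) + slack defect" unfolding B using A by (rule divide_nonneg_pos) simp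
  qed (use N4 params(1) in auto)
  then show "0 \<le> upper_weight (1/16) z" using W by (rule order_trans)
qed

text \<open>If \<open>defect\<close> is small, \<open>\<Phi> - \<psi>0\<close> is nearly \<open>(n-1) \<psi>0\<close>, and the gradient is estimated through those of
  \<open>\<psi>0\<close> and of \<open>n \<psi>0 - \<Phi>\<close>; otherwise directly, with a radius that shrinks as \<open>\<Phi> - \<psi>0\<close> does.\<close>

lemma lower_critical:
  "(1/20)\<^sup>2 * (norm (grad (comb 1 (- 1)) z))\<^sup>2 \<le> comb 1 (- 1) z * lower_weight (1/20) z"
  "0 \<le> lower_weight (1/20) z"
proof -
  let ?A = "200 * (1/10 + slack defect)"
  have A: "0 \<le> ?A" using lower_slack(1)[OF peers(4)] by simp
  have G: "(norm (grad (comb 1 (- 1)) z))\<^sup>2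
      \<le> (real n - 1) * (\<mu> * \<psi>0 z powr \<theta>) * ((real n - 1) * (1 - defect) * \<psi>0 z) * ?A"
  proof (cases "defect \<le> 1/10")
    case True
    define w where "w = sqrt defect"
    have w: "defect = w\<^sup>2" "0 \<le> w" unfolding w_def using peers(4) by simp_all
    have w3: "w \<le> 8/25"
    proof (rule power2_le_imp_le)
      show "w\<^sup>2 \<le> (8/25)\<^sup>2" using True w(1) by (simp add: power2_eq_square)
    qed simp
    have g: "0 \<le> genv (9/4 * w)" "genv (9/4 * w) \<le> 113/200" using w(2) w3 by (intro genv_bounds; simp)+
    have P: "w * (4/3 + 3 * (1 + \<rho>) * genv (9/4 * w)) \<le> 8/25 * (4/3 + 3 * (23/19) * (113/200))"
      using g w w3 params(2) rho_small(1) by (intro mult_mono add_mono mult_nonneg_nonneg add_nonneg_nonneg) auto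
    have "grad (comb 1 (- 1)) z = (real n - 1) *\<^sub>R grad \<psi>0 z - grad (comb (- 1) (real n)) z"
      unfolding grad_comb by (simp add: algebra_simps)
    then have "norm (grad (comb 1 (- 1)) z) \<le> norm ((real n - 1) *\<^sub>R grad \<psi>0 z) + norm (grad (comb (- 1) (real n)) z)"
      by (simp only: norm_triangle_ineq4)
    also have "\<dots> \<le> (real n - 1) * (3/2 * inv_len z * \<psi>0 z)
        + inv_len z * ((real n - 1) * \<psi>0 z) * (w * (4/3 + 3 * (1 + \<rho>) * genv (9/4 * w)))"
      using grad_psi0_bound[OF rho_small(1) z] N4 by (intro add_mono upper_peer_gradient_small[OF w]) (simp add: mult_left_mono)
    also have "\<dots> = inv_len z * ((real n - 1) * \<psi>0 z) * (3/2 + w * (4/3 + 3 * (1 + \<rho>) * genv (9/4 * w)))"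
    proof -
      have "N * (3/2 * L * s) + L * (N * s) * b = L * (N * s) * (3/2 + b)" for N L s b :: real
        by (simp add: algebra_simps)
      then show ?thesis .
    qed
    also have "\<dots> \<le> inv_len z * ((real n - 1) * \<psi>0 z) * 3"
      using P N4 inv_len(1,2)[OF z] by (intro mult_left_mono mult_nonneg_nonneg) auto
    finally have n3: "norm (grad (comb 1 (- 1)) z) \<le> inv_len z * ((real n - 1) * \<psi>0 z) * 3" .
    have "10 * (9/10) \<le> ?A * (1 - defect)" using lower_slack(1)[OF peers(4)] True by (intro mult_mono) auto
    then have "3\<^sup>2 \<le> ?A * (1 - defect)" by simp
    then show ?thesis by (rule squared_gradient[OF n3]) simp
  next
    case False
    then have d: "1/10 \<le> defect" by simp
    define w where "w = sqrt (1 - defect)"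
    have w: "1 - defect = w\<^sup>2" "0 \<le> w" unfolding w_def using peers(5) by simp_all
    have w1: "w \<le> 1" unfolding w_def using peers(4) by simp
    have g: "0 \<le> genv (9/8 * w)" "genv (9/8 * w) \<le> 113/200" using w(2) w1 by (intro genv_bounds; simp)+
    have n: "norm (grad (comb 1 (- 1)) z) \<le> inv_len z * ((real n - 1) * \<psi>0 z) * (w * (37/10))"
    proof (cases "w = 0")
      case True
      then have "grad (comb 1 (- 1)) z = 0" using w peers(2) by (intro grad_comb_zero peers_nonneg) auto
      then show ?thesis using True by simp
    next
      case False
      then have w0: "0 < w" using w(2) by simp
      have "3/4 * w * norm (grad (comb 1 (- 1)) z)
        \<le> inv_len z * ((real n - 1) * \<psi>0 z) * (2 * w\<^sup>2 + 2 * (3/4 * w)\<^sup>2 * genv (3/2 * (3/4 * w)))"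
        unfolding w(1)[symmetric] by (rule lower_peer_gradient) (use w0 in simp)
      also have "3/2 * (3/4 * w) = 9/8 * w" by simp
      also have "2 * w\<^sup>2 + 2 * (3/4 * w)\<^sup>2 * genv (9/8 * w) = 3/4 * w * (w * (8/3 + 3/2 * genv (9/8 * w)))"
        by (simp add: power2_eq_square algebra_simps)
      finally have "3/4 * w * norm (grad (comb 1 (- 1)) z)
        \<le> 3/4 * w * (inv_len z * ((real n - 1) * \<psi>0 z) * (w * (8/3 + 3/2 * genv (9/8 * w))))" by (simp only: mult_ac)
      then have "norm (grad (comb 1 (- 1)) z) \<le> inv_len z * ((real n - 1) * \<psi>0 z) * (w * (8/3 + 3/2 * genv (9/8 * w)))"
        by (rule mult_left_le_imp_le) (use w0 in simp)
      also have "\<dots> \<le> inv_len z * ((real n - 1) * \<psi>0 z) * (w * (37/10))"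
        using g w N4 inv_len(1,2)[OF z] by (intro mult_left_mono mult_nonneg_nonneg) auto
      finally show ?thesis .
    qed
    have "14 * w\<^sup>2 \<le> ?A * w\<^sup>2" using lower_slack(2)[OF d] by (intro mult_right_mono) auto
    moreover have "(w * (37/10))\<^sup>2 = 1369/100 * w\<^sup>2" by (simp add: power2_eq_square)
    ultimately have "(w * (37/10))\<^sup>2 \<le> ?A * w\<^sup>2" using zero_le_power2[of w] by linarith
    then show ?thesis unfolding w(1) by (rule squared_gradient[OF n]) (use w in simp)
  qed
  have W: "(real n - 1) * (\<mu> * \<psi>0 z powr \<theta>) / 2 * (2 * (1/20) + slack defect) \<le> lower_weight (1/20) z"
    by (rule weights_ge(1)) auto
  have B: "2 * (1/20) + slack defect = ?A / 200" by simp
  show "(1/20)\<^sup>2 * (norm (grad (comb 1 (- 1)) z))\<^sup>2 \<le> comb 1 (- 1) z * lower_weight (1/20) z"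
    by (rule finish_core[OF G[folded peers(2)] peers_nonneg(1) W]) (simp add: B power2_eq_square)
  have "0 \<le> (real n - 1) * (\<mu> * \<psi>0 z powr \<theta>) / 2 * (2 * (1/20) + slack defect)"
    unfolding B using A N4 params(1) by (intro mult_nonneg_nonneg divide_nonneg_pos) auto
  then show "0 \<le> lower_weight (1/20) z" using W by (rule order_trans)
qed

end

end

text \<open>Three cases. If \<open>K2 < n\<close>, at most \<open>min K2 (n - 1)\<close> cut-offs are active. If \<open>n\<close> of them may be active,
  the crude count still suffices unless \<open>(n\<rho> - 1)(n - 1) < \<rho>\<close>. The rest is the critical case; there
  \<open>K2 \<ge> n\<close>, so the dissipation surplus in the upper bound is at least \<open>n \<psi>0 - \<Phi>\<close>.\<close>

theorem weights_dominate:
  assumes K2: "1 < K2"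
  obtains l l' where
    "\<And>z. \<psi>0 z \<noteq> 0 \<Longrightarrow> 0 \<le> lower_weight l z \<and> l\<^sup>2 * (norm (grad (comb 1 (- 1)) z))\<^sup>2 \<le> comb 1 (- 1) z * lower_weight l z"
    "\<And>z. \<psi>0 z \<noteq> 0 \<Longrightarrow> 0 \<le> upper_weight l' z \<and> l'\<^sup>2 * (norm (grad (comb (- 1) (real n)) z))\<^sup>2 \<le> comb (- 1) (real n) z * upper_weight l' z"
    "\<And>z. comb (- 1) (real n) z \<le> real n * \<rho> * K2 * \<psi>0 z - Phi z \<or> l' = 0 \<and> 0 \<le> real n * \<rho> * K2 * \<psi>0 z - Phi z"
proof -
  have q: "1 \<le> real n * \<rho>" and n5: "5 \<le> real n" using n_ge by auto
  note peers_nonneg[iff] and witness = that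
  have qK: "K2 \<le> real n * \<rho> * K2" using mult_right_mono[OF q, of K2] K2 by simp
  have generic: thesis if m: "\<And>z. real (card (active z)) \<le> m" "1 \<le> m" "m \<le> K2"
    and D: "m - 1 + \<rho> + m * \<rho> \<le> real n * \<rho> * K2" for m
  proof (rule witness[of 0 0])
    have "Phi z \<le> real n * \<rho> * K2 * \<psi>0 z" for z
    proof -
      have "m * \<psi>0 z \<le> real n * \<rho> * K2 * \<psi>0 z" using m(3) qK psi0(2) by (intro mult_right_mono) auto
      then show ?thesis using Phi_bounds(2)[OF m(1), of z] by linarith
    qed
    then show "comb (- 1) (real n) z \<le> real n * \<rho> * K2 * \<psi>0 z - Phi z \<or> 0 = (0::real) \<and> 0 \<le> real n * \<rho> * K2 * \<psi>0 z - Phi z" for z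
      by simp
  qed (use weights_generic[OF m(1,2) D] in \<open>auto intro: mult_nonneg_nonneg\<close>)
  consider "K2 < real n" | "real n \<le> K2" "\<rho> \<le> (real n * \<rho> - 1) * (real n - 1)"
    | "real n \<le> K2" "(real n * \<rho> - 1) * (real n - 1) < \<rho>" by linarith
  then show thesis
  proof cases
    case 1
    let ?m = "min K2 (real n - 1)"
    have c: "real (card (active z)) \<le> ?m" for z
    proof -
      have "real (card (active z)) \<le> K2" using multiplicity unfolding active_def .
      moreover from this have "card (active z) < n" using 1 by linarith
      ultimately show ?thesis by linarith
    qed
    have D: "?m - 1 + \<rho> + ?m * \<rho> \<le> real n * \<rho> * K2"
    proof -
      have "(?m + 1) * \<rho> \<le> real n * \<rho>" using params(2) by (intro mult_right_mono) auto
      then have "?m - 1 + \<rho> + ?m * \<rho> \<le> (K2 - 1) + real n * \<rho>" by (simp add: algebra_simps)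
      moreover have "(real n * \<rho> - 1) * 1 \<le> (real n * \<rho> - 1) * K2" using q K2 by (intro mult_left_mono) auto
      then have "(K2 - 1) + real n * \<rho> \<le> real n * \<rho> * K2" by (simp add: algebra_simps)
      ultimately show ?thesis by linarith
    qed
    show thesis by (rule generic[OF c _ _ D]) (use K2 n5 in auto)
  next
    case 2
    have "real n - 1 + \<rho> + real n * \<rho> \<le> real n * \<rho> * real n" using 2(2) by (simp add: algebra_simps)
    also have "\<dots> \<le> real n * \<rho> * K2" using 2(1) q by (intro mult_left_mono) auto
    finally have D: "real n - 1 + \<rho> + real n * \<rho> \<le> real n * \<rho> * K2" .
    show thesis by (rule generic[OF card_active_le _ 2(1) D]) (use n5 in auto)
  next
    case 3
    show thesis
    proof (rule witness[of "1/20" "1/16"])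
      show "comb (- 1) (real n) z \<le> real n * \<rho> * K2 * \<psi>0 z - Phi z \<or> 1/16 = (0::real) \<and> 0 \<le> real n * \<rho> * K2 * \<psi>0 z - Phi z" for z
      proof -
        have "real n * \<psi>0 z \<le> real n * \<rho> * K2 * \<psi>0 z" using 3(1) qK psi0(2) by (intro mult_right_mono) auto
        then show ?thesis by (simp add: comb_def)
      qed
    qed (use upper_critical[OF 3(2,1)] lower_critical[OF 3(2,1)] in auto)
  qed
qed

end

section \<open>Integration over space and time\<close>

text \<open>At a zero of a nonnegative function the gradient vanishes; almost everywhere on the zero set of each
  partial derivative, its own derivative vanishes too.\<close>

lemma AE_laplacian_zero_on_zeros:
  fixes f :: "real^2 \<Rightarrow> real"
  assumes f: "smooth_on UNIV f" and nn: "\<And>y. 0 \<le> f y"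
  shows "AE q in (lborel :: (real \<times> (real^2)) measure). f (snd q) = 0 \<longrightarrow> laplacian f (snd q) = 0"
proof -
  have c: "ddir v (\<lambda>q. g (snd q)) (q :: real \<times> (real^2)) = ddir (snd v) g (snd q)" if "\<And>z. g differentiable (at z)" for g :: "real^2 \<Rightarrow> real" and v q
    by (rule ddir_compose_linear(1)[OF bounded_linear_snd]) (rule that)
  have "AE q in (lborel :: (real \<times> (real^2)) measure). ddir (axis j 1) f (snd q) = 0 \<longrightarrow> ddir (axis j 1) (ddir (axis j 1) f) (snd q) = 0" for j :: 2
  proof -
    have "AE q in (lborel :: (real \<times> (real^2)) measure). ddir (axis j 1) f (snd q) = 0 \<longrightarrow> ddir (dx j) (\<lambda>q. ddir (axis j 1) f (snd q)) q = 0"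
    proof (rule AE_ddir_zero_on_zeros)
      show "(\<lambda>q. ddir (axis j 1) f (snd q)) differentiable (at q)" for q :: "real \<times> (real^2)"
        using smooth_on_differentiable[OF smooth_on_compose_linear[OF bounded_linear_snd smooth_on_ddir[OF f]]] by blast
      have "ddir (dx j) (\<lambda>q. ddir (axis j 1) f (snd q)) = (\<lambda>q :: real \<times> (real^2). ddir (axis j 1) (ddir (axis j 1) f) (snd q))"
        by (rule ext) (simp add: c[OF v_diff(2)[OF f]])
      moreover have "continuous_on UNIV (\<lambda>q :: real \<times> (real^2). ddir (axis j 1) (ddir (axis j 1) f) (snd q))"
        by (rule continuous_on_compose2[OF v_cont(3)[OF f, of UNIV] continuous_on_snd[OF continuous_on_id]]) simp
      ultimately show "continuous_on UNIV (ddir (dx j) (\<lambda>q. ddir (axis j 1) f (snd q)))" by simp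
    qed
    then show ?thesis by (simp add: c[OF v_diff(2)[OF f]])
  qed
  from this[of 1] this[of 2] show ?thesis
  proof eventually_elim
    case (elim q)
    show ?case
    proof
      assume 0: "f (snd q) = 0"
      have "ddir w f (snd q) = 0" for w by (rule ddir_zero_at_minimum[OF v_diff(1)[OF f] nn 0])
      then show "laplacian f (snd q) = 0" using elim by (simp add: laplacian_eq_ddir)
    qed
  qed
qed

locale shell_flow = nse_flow \<nu> T \<Omega> u p \<eta> + shell_family \<delta> C0 K1 K2 R0 R \<psi>0 n x \<psi>
  for \<nu> T \<Omega> u p \<eta> \<delta> C0 K1 K2 R0 R \<psi>0 n x \<psi> +
  assumes \<nu>: "\<nu> > 0" and T: "T \<ge> R0\<^sup>2 / \<nu>" and ball: "ball 0 (3 * R0) \<subseteq> \<Omega>"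
    and time_cut: "time_cutoff \<delta> C0 T \<eta>" and K2: "1 < K2"
begin

lemma eta: "0 \<le> \<eta> t" "\<eta> t \<le> 1"
  using time_cut by (auto simp: time_cutoff_def)

text \<open>The assumption on \<open>T\<close> makes \<open>C0/T\<close> at most \<open>\<nu> C0/R0\<^sup>2 = \<nu>\<rho>\<mu>\<close>. At zeros of \<open>\<eta>\<close> the derivative
  vanishes because \<open>\<eta>\<close> has a minimum there.\<close>

lemma eta_deriv: "\<bar>deriv \<eta> t\<bar> \<le> \<nu> * (\<rho> * \<mu>) * \<eta> t powr \<theta>"
proof (cases "\<eta> t = 0")
  case True
  have "deriv \<eta> t = 0"
    unfolding \<eta>_facts(2) by (rule ddir_zero_at_minimum[OF smooth_on_differentiable[OF \<eta>_facts(1) UNIV_I] eta(1) True])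
  then show ?thesis using True by simp
next
  case False
  then have e: "0 < \<eta> t" using eta(1)[of t] by simp
  have T0: "0 < R0\<^sup>2 / \<nu>" using R0 \<nu> by simp
  have "\<bar>deriv \<eta> t\<bar> / \<eta> t powr \<delta> \<le> C0 / T" using time_cut False unfolding time_cutoff_def by blast
  then have "\<bar>deriv \<eta> t\<bar> \<le> C0 / T * \<eta> t powr \<delta>" using e by (simp add: divide_le_eq)
  also have "\<dots> \<le> C0 / (R0\<^sup>2 / \<nu>) * \<eta> t powr \<theta>"
  proof (rule mult_mono)
    show "C0 / T \<le> C0 / (R0\<^sup>2 / \<nu>)" using T T0 C0 by (intro divide_left_mono mult_pos_pos) auto
    show "\<eta> t powr \<delta> \<le> \<eta> t powr \<theta>" using e eta(2)[of t] \<delta> unfolding \<theta>_def by (intro powr_mono') auto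
  qed (use C0 \<nu> in auto)
  also have "C0 / (R0\<^sup>2 / \<nu>) = \<nu> * (\<rho> * \<mu>)" unfolding params(6) by simp
  finally show ?thesis .
qed

lemma eta_le_powr: "\<eta> t \<le> \<eta> t powr \<theta>"
proof (cases "\<eta> t = 0")
  case False
  then have "\<eta> t powr 1 \<le> \<eta> t powr \<theta>" using eta[of t] params(5) by (intro powr_mono') auto
  then show ?thesis using eta(1)[of t] by simp
qed simp

lemma test_function_below:
  assumes f: "smooth_on UNIV f" and z: "\<And>z. \<psi>0 z = 0 \<Longrightarrow> f z = 0"
  shows "test_function \<Omega> f"
proof -
  have t: "test_function (ball 0 (2 * R0)) \<psi>0" using ball_cut by (simp add: ball_cutoff_def)
  have s: "closure {z. f z \<noteq> 0} \<subseteq> closure {z. \<psi>0 z \<noteq> 0}" by (rule closure_mono) (use z in auto)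
  then have "compact (closure {z. f z \<noteq> 0})"
    using t unfolding test_function_def by (metis closed_closure compact_Int_closed inf.absorb_iff2)
  moreover have "ball 0 (2 * R0) \<subseteq> ball (0 :: real^2) (3 * R0)" using R0 by (intro subset_ball) simp
  then have "closure {z. f z \<noteq> 0} \<subseteq> \<Omega>" using s t ball unfolding test_function_def by blast
  ultimately show ?thesis using f by (simp add: test_function_def)
qed

lemma tests: "test_function \<Omega> \<psi>0" "test_function \<Omega> Phi" "test_function \<Omega> (comb a b)"
  "i \<in> {1..n} \<Longrightarrow> test_function \<Omega> (\<psi> i)"
proof -
  show "test_function \<Omega> \<psi>0" by (rule test_function_below[OF psi0(1)])
  show "test_function \<Omega> Phi" by (rule test_function_below[OF smooth_Phi Phi_zero])
  show "test_function \<Omega> (comb a b)" by (rule test_function_below[OF smooth_comb]) (simp add: comb_def Phi_zero)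
  assume i: "i \<in> {1..n}"
  show "test_function \<Omega> (\<psi> i)"
    by (rule test_function_below[OF psi(1)[OF i]]) (use psi(2,3)[OF i] in \<open>metis order_antisym\<close>)
qed

definition "enstrophy_density = (\<lambda>q. 1/2 * (vort q)\<^sup>2 * (\<eta> (fst q) * \<psi>0 (snd q)) powr \<theta>)"

text \<open>For \<open>\<theta> = 0\<close> the density is discontinuous, since the power is the indicator of the set where the weight is
  nonzero; hence domination by the continuous function \<open>w\<^sup>2/2\<close> on the compact support.\<close>

lemma integrable_enstrophy: "set_integrable lborel win enstrophy_density"
proof -
  let ?K = "supp \<psi>0"
  have cv: "continuous_on cyl (\<lambda>q. 1/2 * (vort q)\<^sup>2)" by (intro continuous_intros cont_pieces[OF tests(1)])
  have K: "compact ?K" "?K \<subseteq> win" by (rule supp[OF tests(1)])+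
  have "continuous_on ?K (\<lambda>q. 1/2 * (vort q)\<^sup>2)" using cv K(2) win(1) by (blast intro: continuous_on_subset)
  then have i: "integrable lborel (\<lambda>q. indicator ?K q *\<^sub>R (1/2 * (vort q)\<^sup>2))"
    using K(1) by (rule borel_integrable_compact[rotated])
  have m: "(\<lambda>q. indicator win q *\<^sub>R enstrophy_density q) \<in> borel_measurable lborel"
  proof -
    have "(\<lambda>q. indicator win q *\<^sub>R (1/2 * (vort q)\<^sup>2)) \<in> borel_measurable borel"
      using win continuous_on_subset[OF cv] by (intro borel_measurable_continuous_on_indicator) auto
    moreover have "continuous_on UNIV (\<lambda>q::real \<times> (real^2). \<eta> (fst q) * \<psi>0 (snd q))"
      by (intro continuous_intros continuous_on_compose2[OF smooth_on_continuous[OF \<eta>_facts(1)]]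
          continuous_on_compose2[OF smooth_on_continuous[OF psi0(1)]]) auto
    then have "(\<lambda>q::real \<times> (real^2). \<eta> (fst q) * \<psi>0 (snd q)) \<in> borel_measurable borel"
      by (rule borel_measurable_continuous_onI)
    then have "(\<lambda>q::real \<times> (real^2). (\<eta> (fst q) * \<psi>0 (snd q)) powr \<theta>) \<in> borel_measurable borel" by measurable
    ultimately have "(\<lambda>q. indicator win q *\<^sub>R (1/2 * (vort q)\<^sup>2) * (\<eta> (fst q) * \<psi>0 (snd q)) powr \<theta>) \<in> borel_measurable borel"
      by (rule borel_measurable_times)
    then show ?thesis by (simp add: enstrophy_density_def mult_ac)
  qed
  have b: "norm (indicator win q *\<^sub>R enstrophy_density q) \<le> norm (indicator ?K q *\<^sub>R (1/2 * (vort q)\<^sup>2))" for q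
  proof (cases "q \<in> ?K")
    case True
    have "0 \<le> \<eta> (fst q) * \<psi>0 (snd q)" "\<eta> (fst q) * \<psi>0 (snd q) \<le> 1"
      by (intro mult_nonneg_nonneg mult_le_one eta psi0(2,3))+
    then have "(\<eta> (fst q) * \<psi>0 (snd q)) powr \<theta> \<le> 1"
      using params(4) by (intro powr_le1) auto
    then have "1/2 * (vort q)\<^sup>2 * (\<eta> (fst q) * \<psi>0 (snd q)) powr \<theta> \<le> 1/2 * (vort q)\<^sup>2 * 1"
      by (intro mult_left_mono) auto
    then show ?thesis using True K(2) by (auto simp: enstrophy_density_def abs_mult)
  next
    case False
    then have "\<eta> (fst q) * \<psi>0 (snd q) = 0" using outside_supp[OF tests(1) False] by auto
    then have "enstrophy_density q = 0" unfolding enstrophy_density_def by (simp only: powr_0 mult_zero_right)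
    then show ?thesis by simp
  qed
  show ?thesis unfolding set_integrable_def by (rule Bochner_Integration.integrable_bound[OF i m AE_I2[OF b]])
qed

lemma flux_sum: "(\<Sum>i=1..n. LINT q:win|lborel. flux_density (\<psi> i) q) = (LINT q:win|lborel. flux_density Phi q)"
proof -
  have "flux_density Phi q = (\<Sum>i=1..n. flux_density (\<psi> i) q)" for q
  proof -
    have d: "ddir w Phi z = (\<Sum>i=1..n. ddir w (\<psi> i) z)" for w z
      unfolding Phi_def by (intro ddir_sum v_diff(1) psi(1))
    show ?thesis unfolding flux_density_def d
      by (simp add: sum_distrib_left sum.distrib distrib_left)
  qed
  then have "(LINT q:win|lborel. flux_density Phi q) = (LINT q:win|lborel. (\<Sum>i=1..n. flux_density (\<psi> i) q))" by simp
  also have "\<dots> = (\<Sum>i=1..n. LINT q:win|lborel. flux_density (\<psi> i) q)"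
    unfolding set_lebesgue_integral_def scaleR_sum_right
    by (rule Bochner_Integration.integral_sum) (use integrable_densities(1)[OF tests(4)] in \<open>simp add: set_integrable_def\<close>)
  finally show ?thesis ..
qed

text \<open>The weights contain the enstrophy term with \<open>\<eta>\<close> in place of \<open>\<eta> powr \<theta>\<close>. The difference,
  \<open>\<eta> powr \<theta> - \<eta> \<ge> 0\<close>, pays for the part of the time derivative not already covered by the weights.\<close>

lemma time_slack:
  assumes le: "Phi z \<le> real n * \<rho> * K2 * \<psi>0 z" and d: "\<bar>d\<bar> \<le> \<nu> * (\<rho> * \<mu>) * \<eta> t powr \<theta>"
  shows "d * Phi z \<le> \<nu> * (real n * \<rho> * K2 * \<mu>) * (\<eta> t * \<psi>0 z) powr \<theta>
    - \<nu> * \<eta> t * (real n * \<rho> * K2 * \<mu> * \<psi>0 z powr \<theta> - \<rho> * \<mu> * Phi z)"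
proof -
  define a where "a = \<eta> t powr \<theta>"
  define b where "b = \<psi>0 z powr \<theta>"
  define k where "k = real n * \<rho> * K2"
  have P: "0 \<le> Phi z" using Phi_bounds(1)[OF card_active_le, of z] psi0(2)[of z] by linarith
  have pw: "(\<eta> t * \<psi>0 z) powr \<theta> = a * b" unfolding a_def b_def by (simp add: powr_mult eta(1) psi0(2))
  have k: "0 \<le> k" unfolding k_def using params(2) K2 by (intro mult_nonneg_nonneg) auto
  have "\<rho> * Phi z \<le> 1 * Phi z" using params(2,3) P by (intro mult_right_mono) auto
  also have "\<dots> \<le> k * b" using le mult_left_mono[OF psi0_le_powr k, of z] unfolding k_def[symmetric] b_def by simp
  finally have "0 \<le> (\<nu> * \<mu> * (a - \<eta> t)) * (k * b - \<rho> * Phi z)"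
    using \<nu> params(1) eta_le_powr[of t] unfolding a_def by (intro mult_nonneg_nonneg) auto
  moreover have "d * Phi z \<le> \<nu> * (\<rho> * \<mu>) * a * Phi z"
    using d P unfolding a_def by (intro mult_right_mono) auto
  ultimately show ?thesis unfolding pw k_def[symmetric] b_def[symmetric] by (simp add: algebra_simps)
qed

lemma set_integral_nonneg_AE:
  assumes "AE q in lborel. q \<in> win \<longrightarrow> 0 \<le> (D q :: real)"
  shows "0 \<le> (LINT q:win|lborel. D q)"
  unfolding set_lebesgue_integral_def
  by (rule integral_nonneg_AE, use assms in eventually_elim) (auto simp: indicator_def)

lemma AE_laplacians_zero:
  "AE q in lborel. \<psi>0 (snd q) = 0 \<longrightarrow> laplacian \<psi>0 (snd (q :: real \<times> (real^2))) = 0 \<and> laplacian Phi (snd q) = 0"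
proof -
  have P: "0 \<le> Phi z" for z using Phi_bounds(1)[OF card_active_le, of z] psi0(2)[of z] by linarith
  from AE_laplacian_zero_on_zeros[OF psi0(1) psi0(2)] AE_laplacian_zero_on_zeros[OF smooth_Phi P]
  show ?thesis by eventually_elim (use Phi_zero in auto)
qed

text \<open>The difference of the two sides, plus a multiple of the null divergence, has an integrand that is
  nonnegative almost everywhere: where \<open>\<psi>0\<close> is nonzero it is \<open>\<nu>\<eta>\<close> times a nonnegative quadratic form in
  the gradient and the value of the vorticity, plus the slack in time; where \<open>\<psi>0\<close> vanishes, so does it.\<close>

lemma flux_bounds:
  shows "\<nu> * (LINT q:win|lborel. dissipation_density \<psi>0 q) - \<nu> * (real n * \<rho> * K2 * \<mu>) * (LINT q:win|lborel. enstrophy_density q)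
      \<le> (LINT q:win|lborel. flux_density Phi q)"
    and "(LINT q:win|lborel. flux_density Phi q)
      \<le> \<nu> * (real n * \<rho> * K2) * (LINT q:win|lborel. dissipation_density \<psi>0 q) + \<nu> * (real n * \<rho> * K2 * \<mu>) * (LINT q:win|lborel. enstrophy_density q)"
proof -
  define k where "k = real n * \<rho> * K2"
  obtain l l' where
    low: "\<And>z. \<psi>0 z \<noteq> 0 \<Longrightarrow> 0 \<le> lower_weight l z \<and> l\<^sup>2 * (norm (grad (comb 1 (- 1)) z))\<^sup>2 \<le> comb 1 (- 1) z * lower_weight l z"
    and up: "\<And>z. \<psi>0 z \<noteq> 0 \<Longrightarrow> 0 \<le> upper_weight l' z \<and> l'\<^sup>2 * (norm (grad (comb (- 1) (real n)) z))\<^sup>2 \<le> comb (- 1) (real n) z * upper_weight l' z"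
    and dom: "\<And>z. comb (- 1) (real n) z \<le> real n * \<rho> * K2 * \<psi>0 z - Phi z \<or> l' = 0 \<and> 0 \<le> real n * \<rho> * K2 * \<psi>0 z - Phi z"
    using weights_dominate[OF K2] by metis
  have Pk: "Phi z \<le> k * \<psi>0 z" for z
    using dom[of z] peers_nonneg(2)[of z] unfolding k_def by linarith
  note slack = time_slack[OF Pk[unfolded k_def] eta_deriv, folded k_def]
  have slack': "- deriv \<eta> t * Phi z \<le> \<nu> * (k * \<mu>) * (\<eta> t * \<psi>0 z) powr \<theta>
    - \<nu> * \<eta> t * (k * \<mu> * \<psi>0 z powr \<theta> - \<rho> * \<mu> * Phi z)" for t z
    using time_slack[OF Pk[unfolded k_def], of "- deriv \<eta> t" t z] eta_deriv[of t] unfolding k_def by simp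
  note int = integrable_densities[OF tests(1)] integrable_densities[OF tests(2)] integrable_densities[OF tests(3)] integrable_enstrophy
  let ?DL = "\<lambda>q. \<nu> * dissipation_density Phi q - error_density Phi q - \<nu> * dissipation_density \<psi>0 q
      + \<nu> * (k * \<mu>) * enstrophy_density q + \<nu> * l * cross_density (comb 1 (- 1)) q"
  let ?DU = "\<lambda>q. \<nu> * k * dissipation_density \<psi>0 q + \<nu> * (k * \<mu>) * enstrophy_density q
      - \<nu> * dissipation_density Phi q + error_density Phi q + \<nu> * l' * cross_density (comb (- 1) (real n)) q"
  have zero: "?DL q = 0 \<and> ?DU q = 0" if z: "\<psi>0 (snd q) = 0" and L: "laplacian \<psi>0 (snd q) = 0" "laplacian Phi (snd q) = 0" for q
  proof -
    have P: "Phi (snd q) = 0" by (rule Phi_zero[OF z])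
    have "grad (comb 1 (- 1)) (snd q) = 0" "grad (comb (- 1) (real n)) (snd q) = 0"
      by (rule grad_comb_zero[OF peers_nonneg(1)] grad_comb_zero[OF peers_nonneg(2)]; simp add: comb_def P z)+
    then have g: "ddir (axis 1 1) (comb 1 (- 1)) (snd q) = 0" "ddir (axis 2 1) (comb 1 (- 1)) (snd q) = 0"
      "ddir (axis 1 1) (comb (- 1) (real n)) (snd q) = 0" "ddir (axis 2 1) (comb (- 1) (real n)) (snd q) = 0"
      by (simp_all flip: grad_nth)
    show ?thesis
      unfolding dissipation_density_def error_density_def enstrophy_density_def cross_density_def g P z L laplacian_comb by simp
  qed
  have posL: "0 \<le> ?DL q" if z: "\<psi>0 (snd q) \<noteq> 0" for q
  proof -
    let ?X = "comb 1 (- 1)" and ?z = "snd q" and ?t = "fst q"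
    define W where "W = vort q"
    define w1 where "w1 = ddir (dx 1) vort q"
    define w2 where "w2 = ddir (dx 2) vort q"
    have "l\<^sup>2 * ((grad ?X ?z $ 1)\<^sup>2 + (grad ?X ?z $ 2)\<^sup>2) \<le> ?X ?z * lower_weight l ?z"
      using low[OF z] by (simp only: norm_real2)
    then have Q: "0 \<le> ?X ?z * (w1\<^sup>2 + w2\<^sup>2) + 2 * l * W * (w1 * ddir (axis 1 1) ?X ?z + w2 * ddir (axis 2 1) ?X ?z) + W\<^sup>2 * lower_weight l ?z"
      unfolding grad_nth[symmetric] using low[OF z] peers_nonneg(1) by (intro quadratic_form_nonneg) auto
    let ?S = "\<nu> * (k * \<mu>) * (\<eta> ?t * \<psi>0 ?z) powr \<theta> - \<nu> * \<eta> ?t * (k * \<mu> * \<psi>0 ?z powr \<theta> - \<rho> * \<mu> * Phi ?z) - deriv \<eta> ?t * Phi ?z"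
    have S: "0 \<le> ?S" using slack[of ?t ?z] by simp
    have eq: "?DL q = \<nu> * \<eta> ?t * (?X ?z * (w1\<^sup>2 + w2\<^sup>2) + 2 * l * W * (w1 * ddir (axis 1 1) ?X ?z + w2 * ddir (axis 2 1) ?X ?z) + W\<^sup>2 * lower_weight l ?z)
        + 1/2 * W\<^sup>2 * ?S"
    proof -
      have X: "?X ?z = Phi ?z - \<psi>0 ?z" by (simp add: comb_def)
      show ?thesis
        unfolding dissipation_density_def error_density_def enstrophy_density_def cross_density_def lower_weight_def X
          W_def[symmetric] w1_def[symmetric] w2_def[symmetric] k_def[symmetric]
        by (simp add: field_simps)
    qed
    show ?thesis unfolding eq
      by (rule add_nonneg_nonneg[OF mult_nonneg_nonneg[OF _ Q] mult_nonneg_nonneg[OF _ S]]) (use \<nu> eta(1) in auto)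
  qed
  have posU: "0 \<le> ?DU q" if z: "\<psi>0 (snd q) \<noteq> 0" for q
  proof -
    let ?Y = "comb (- 1) (real n)" and ?z = "snd q" and ?t = "fst q"
    let ?a = "k * \<psi>0 ?z - Phi ?z"
    define W where "W = vort q"
    define w1 where "w1 = ddir (dx 1) vort q"
    define w2 where "w2 = ddir (dx 2) vort q"
    have a: "0 \<le> ?a" using Pk by simp
    have "l'\<^sup>2 * (norm (grad ?Y ?z))\<^sup>2 \<le> ?a * upper_weight l' ?z"
    proof (cases "l' = 0")
      case True then show ?thesis using a up[OF z] by simp
    next
      case False
      then have "?Y ?z \<le> ?a" using dom[of ?z] unfolding k_def by simp
      then have "?Y ?z * upper_weight l' ?z \<le> ?a * upper_weight l' ?z" using up[OF z] by (intro mult_right_mono) auto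
      then show ?thesis using up[OF z] by linarith
    qed
    then have "l'\<^sup>2 * ((grad ?Y ?z $ 1)\<^sup>2 + (grad ?Y ?z $ 2)\<^sup>2) \<le> ?a * upper_weight l' ?z"
      by (simp only: norm_real2)
    then have Q: "0 \<le> ?a * (w1\<^sup>2 + w2\<^sup>2) + 2 * l' * W * (w1 * ddir (axis 1 1) ?Y ?z + w2 * ddir (axis 2 1) ?Y ?z) + W\<^sup>2 * upper_weight l' ?z"
      unfolding grad_nth[symmetric] using up[OF z] a by (intro quadratic_form_nonneg) auto
    let ?S = "\<nu> * (k * \<mu>) * (\<eta> ?t * \<psi>0 ?z) powr \<theta> - \<nu> * \<eta> ?t * (k * \<mu> * \<psi>0 ?z powr \<theta> - \<rho> * \<mu> * Phi ?z) + deriv \<eta> ?t * Phi ?z"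
    have S: "0 \<le> ?S" using slack'[of ?t ?z] by simp
    have eq: "?DU q = \<nu> * \<eta> ?t * (?a * (w1\<^sup>2 + w2\<^sup>2) + 2 * l' * W * (w1 * ddir (axis 1 1) ?Y ?z + w2 * ddir (axis 2 1) ?Y ?z) + W\<^sup>2 * upper_weight l' ?z)
        + 1/2 * W\<^sup>2 * ?S"
      unfolding dissipation_density_def error_density_def enstrophy_density_def cross_density_def upper_weight_def
          W_def[symmetric] w1_def[symmetric] w2_def[symmetric] k_def[symmetric]
      by (simp add: field_simps)
    show ?thesis unfolding eq
      by (rule add_nonneg_nonneg[OF mult_nonneg_nonneg[OF _ Q] mult_nonneg_nonneg[OF _ S]]) (use \<nu> eta(1) in auto)
  qed
  have "0 \<le> (LINT q:win|lborel. ?DL q)"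
    by (rule set_integral_nonneg_AE, use AE_laplacians_zero in eventually_elim) (use posL zero in fastforce)
  also have "\<dots> = \<nu> * (LINT q:win|lborel. dissipation_density Phi q) - (LINT q:win|lborel. error_density Phi q)
      - \<nu> * (LINT q:win|lborel. dissipation_density \<psi>0 q) + \<nu> * (k * \<mu>) * (LINT q:win|lborel. enstrophy_density q)
      + \<nu> * l * (LINT q:win|lborel. cross_density (comb 1 (- 1)) q)"
    using int by (simp add: set_integral_add set_integral_diff)
  finally show "\<nu> * (LINT q:win|lborel. dissipation_density \<psi>0 q) - \<nu> * (real n * \<rho> * K2 * \<mu>) * (LINT q:win|lborel. enstrophy_density q)
      \<le> (LINT q:win|lborel. flux_density Phi q)"
    unfolding energy_identity[OF tests(2)] cross_integral[OF tests(3)] k_def by simp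
  have "0 \<le> (LINT q:win|lborel. ?DU q)"
    by (rule set_integral_nonneg_AE, use AE_laplacians_zero in eventually_elim) (use posU zero in fastforce)
  also have "\<dots> = \<nu> * k * (LINT q:win|lborel. dissipation_density \<psi>0 q) + \<nu> * (k * \<mu>) * (LINT q:win|lborel. enstrophy_density q)
      - \<nu> * (LINT q:win|lborel. dissipation_density Phi q) + (LINT q:win|lborel. error_density Phi q)
      + \<nu> * l' * (LINT q:win|lborel. cross_density (comb (- 1) (real n)) q)"
    using int by (simp add: set_integral_add set_integral_diff)
  finally show "(LINT q:win|lborel. flux_density Phi q)
      \<le> \<nu> * (real n * \<rho> * K2) * (LINT q:win|lborel. dissipation_density \<psi>0 q) + \<nu> * (real n * \<rho> * K2 * \<mu>) * (LINT q:win|lborel. enstrophy_density q)"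
    unfolding energy_identity[OF tests(2)] cross_integral[OF tests(3)] k_def by simp
qed

end

section \<open>The enstrophy cascade\<close>

theorem theorem6p2:
  fixes \<nu> R0 \<delta> C0 K1 K2 T \<gamma> c E0 P0 \<sigma>0 R :: real
    and \<Omega> :: "(real^2) set"
    and u :: "real \<Rightarrow> real^2 \<Rightarrow> real^2"
    and p :: "real \<Rightarrow> real^2 \<Rightarrow> real"
    and \<psi>0 :: "real^2 \<Rightarrow> real"
    and \<eta> :: "real \<Rightarrow> real"
    and n :: nat
    and x :: "nat \<Rightarrow> real^2"
    and \<psi> :: "nat \<Rightarrow> real^2 \<Rightarrow> real"
  assumes "\<nu> > 0" and "R0 > 0"
    and "open \<Omega>" and "bounded \<Omega>" and "connected \<Omega>" and "ball 0 (3 * R0) \<subseteq> \<Omega>"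
    and "smooth_NSE_solution \<nu> \<Omega> u p"
    and "1 / 2 \<le> \<delta>" and "\<delta> < 1" and "C0 > 0" and "K1 > 1" and "K2 > 1"
    and "ball_cutoff \<delta> C0 R0 \<psi>0"
    and "time_cutoff \<delta> C0 T \<eta>"
    and "E0 = avg_enstrophy \<delta> T \<Omega> u (\<lambda>t x. \<eta> t * \<psi>0 x)"
    and "P0 = avg_palinstrophy T \<Omega> u (\<lambda>t x. \<eta> t * \<psi>0 x)"
    and "P0 > 0"
    and "\<sigma>0 = sqrt (E0 / P0)"
    and "c = 1 / sqrt (C0 * K1 * K2)"
    and "0 < \<gamma>" and "\<gamma> < 1"
    and "T \<ge> R0\<^sup>2 / \<nu>"
    and "\<sigma>0 < c * \<gamma> * R0"
    and "1 / (c * \<gamma>) * \<sigma>0 \<le> R" and "R \<le> R0"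
    and "optimal_covering K1 K2 R0 R n x"
    and "\<forall>i\<in>{1..n}. shell_cutoff \<delta> C0 R0 \<psi>0 (x i) R (\<psi> i)"
  shows "(1 - \<gamma>\<^sup>2) / K1 * (R / R0)\<^sup>2 * (\<nu> * P0) \<le> ensemble_flux T \<Omega> u \<eta> n \<psi> \<and>
         ensemble_flux T \<Omega> u \<eta> n \<psi> \<le> K2 * (1 + \<gamma>\<^sup>2 / (K1 * K2)) * (R / R0)\<^sup>2 * (\<nu> * P0)"
proof -
  note A = assms
  have E0_nonneg: "0 \<le> E0"
  proof -
    have "0 \<le> R0\<^sup>2 / \<nu>" using A(1) by simp
    then have "0 \<le> T" using A(22) by linarith
    then show ?thesis
      unfolding A(15) avg_enstrophy_def set_lebesgue_integral_def
      by (intro mult_nonneg_nonneg integral_nonneg_AE AE_I2) (auto split: prod.split)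
  qed
  have c: "0 < c" unfolding A(19) using A(10-12) by (intro divide_pos_pos) auto
  have \<sigma>: "\<sigma>0 \<le> c * \<gamma> * R"
  proof -
    have "0 < c * \<gamma>" using c A(20) by simp
    then show ?thesis using A(24) by (simp add: divide_le_eq mult_ac)
  qed
  have R: "0 < R"
  proof -
    have "0 \<le> \<sigma>0" unfolding A(18) using E0_nonneg A(17) by simp
    then have "0 \<le> c * \<gamma> * R" using \<sigma> by linarith
    then have "c * \<gamma> * 0 \<le> c * \<gamma> * R" by simp
    then have "0 \<le> R" by (rule mult_left_le_imp_le) (use c A(20) in simp)
    moreover have "R \<noteq> 0"
    proof
      assume "R = 0"
      then have "n = 0" using A(26) by (simp add: optimal_covering_def)
      then have "ball (0 :: real^2) R0 = {}" using A(26) by (simp add: optimal_covering_def)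
      then show False using A(2) by simp
    qed
    ultimately show ?thesis by simp
  qed
  interpret shell_flow \<nu> T \<Omega> u p \<eta> \<delta> C0 K1 K2 R0 R \<psi>0 n x \<psi>
    using A R by unfold_locales (auto simp: time_cutoff_def)
  have T0: "0 < T"
  proof -
    have "0 < R0\<^sup>2 / \<nu>" using A(1,2) by simp
    then show ?thesis using A(22) by linarith
  qed
  define P where "P = (LINT q:win|lborel. dissipation_density \<psi>0 q)"
  define E where "E = (LINT q:win|lborel. enstrophy_density q)"
  define F where "F = (LINT q:win|lborel. flux_density Phi q)"
  have P0: "P0 = 1 / T * P" unfolding A(16) P_def by (rule densities_eq(2)[OF psi0(1)])
  have E0: "E0 = 1 / T * E" unfolding A(15) E_def enstrophy_density_def \<theta>_def by (rule densities_eq(3)[OF psi0(1)])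
  have ens: "ensemble_flux T \<Omega> u \<eta> n \<psi> = 1 / real n * (1 / T * F)"
  proof -
    have "(\<Sum>i=1..n. enstrophy_flux T \<Omega> u (\<lambda>t x. \<eta> t * \<psi> i x)) = (\<Sum>i=1..n. 1 / T * (LINT q:win|lborel. flux_density (\<psi> i) q))"
      by (rule sum.cong[OF refl]) (rule densities_eq(1)[OF psi(1)])
    then show ?thesis unfolding ensemble_flux_def F_def flux_sum[symmetric] sum_distrib_left[symmetric] by (rule arg_cong)
  qed
  define q where "q = real n * \<rho>"
  have q: "1 \<le> q" "q \<le> K1" unfolding q_def by (rule n_ge(1), rule q_le)
  have n: "0 < real n" using n_ge(2) by simp
  have low: "\<nu> * P0 - \<nu> * (q * K2 * \<mu>) * E0 \<le> 1 / T * F"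
  proof -
    have "1 / T * (\<nu> * P - \<nu> * (q * K2 * \<mu>) * E) \<le> 1 / T * F"
      unfolding P_def E_def F_def q_def using T0 by (intro mult_left_mono flux_bounds(1)) simp
    then show ?thesis unfolding P0 E0 by (simp add: right_diff_distrib mult_ac)
  qed
  have up: "1 / T * F \<le> \<nu> * (q * K2) * P0 + \<nu> * (q * K2 * \<mu>) * E0"
  proof -
    have "1 / T * F \<le> 1 / T * (\<nu> * (q * K2) * P + \<nu> * (q * K2 * \<mu>) * E)"
      unfolding P_def E_def F_def q_def using T0 by (intro mult_left_mono flux_bounds(2)) simp
    then show ?thesis unfolding P0 E0 by (simp add: distrib_left mult_ac)
  qed
  \<comment> \<open>the lower bound on \<open>R\<close>, squared, with the value of \<open>c\<close> inserted\<close>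
  have \<mu>E: "K1 * (K2 * \<mu> * E0) \<le> \<gamma>\<^sup>2 * P0"
  proof -
    have "E0 / P0 \<le> (c * \<gamma> * R)\<^sup>2" using \<sigma> unfolding A(18) by (rule sqrt_le_D)
    then have "E0 \<le> (c * \<gamma> * R)\<^sup>2 * P0" using A(17) by (simp add: divide_le_eq)
    also have "(c * \<gamma> * R)\<^sup>2 = \<gamma>\<^sup>2 * R\<^sup>2 / (C0 * K1 * K2)"
      unfolding A(19) power_mult_distrib power_divide using A(10-12) by simp
    finally have "K1 * K2 * \<mu> * E0 \<le> K1 * K2 * \<mu> * (\<gamma>\<^sup>2 * R\<^sup>2 / (C0 * K1 * K2) * P0)"
      using params(1) A(11,12) by (intro mult_left_mono) auto
    also have "\<dots> = \<gamma>\<^sup>2 * P0" unfolding \<mu>_def using A(10-12) R by simp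
    finally show ?thesis by (simp add: mult_ac)
  qed
  have K1: "0 < K1" "0 < K2" using A(11,12) by auto
  have \<mu>E': "\<nu> * (q * K2 * \<mu>) * E0 \<le> q * \<gamma>\<^sup>2 / K1 * (\<nu> * P0)"
  proof -
    have "K2 * \<mu> * E0 \<le> \<gamma>\<^sup>2 * P0 / K1" using \<mu>E K1 by (simp add: le_divide_eq mult_ac)
    then have "\<nu> * q * (K2 * \<mu> * E0) \<le> \<nu> * q * (\<gamma>\<^sup>2 * P0 / K1)" using A(1) q by (intro mult_left_mono) auto
    then show ?thesis by (simp add: mult_ac)
  qed
  have nP: "0 \<le> \<nu> * P0" using A(1,17) by simp
  have rq: "(R / R0)\<^sup>2 = 1 / real n * q" unfolding q_def \<rho>_def using n by simp
  show ?thesis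
  proof
    \<comment> \<open>equivalent to \<open>q \<le> K1\<close>\<close>
    have "q * (1 - \<gamma>\<^sup>2) / K1 \<le> 1 - q * \<gamma>\<^sup>2 / K1" using q K1 by (simp add: field_simps)
    then have "q * (1 - \<gamma>\<^sup>2) / K1 * (\<nu> * P0) \<le> (1 - q * \<gamma>\<^sup>2 / K1) * (\<nu> * P0)" using nP by (rule mult_right_mono)
    also have "\<dots> = \<nu> * P0 - q * \<gamma>\<^sup>2 / K1 * (\<nu> * P0)" by (simp add: left_diff_distrib)
    also have "\<dots> \<le> 1 / T * F" using low \<mu>E' by linarith
    finally have "1 / real n * (q * (1 - \<gamma>\<^sup>2) / K1 * (\<nu> * P0)) \<le> 1 / real n * (1 / T * F)"
      using n by (intro mult_left_mono) auto
    then show "(1 - \<gamma>\<^sup>2) / K1 * (R / R0)\<^sup>2 * (\<nu> * P0) \<le> ensemble_flux T \<Omega> u \<eta> n \<psi>"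
      unfolding ens rq by (simp add: mult_ac)
    have "1 / T * F \<le> q * K2 * (\<nu> * P0) + q * \<gamma>\<^sup>2 / K1 * (\<nu> * P0)" using up \<mu>E' by (simp add: mult_ac)
    also have "\<dots> = K2 * (1 + \<gamma>\<^sup>2 / (K1 * K2)) * q * (\<nu> * P0)" using K1 by (simp add: field_simps)
    finally have "1 / real n * (1 / T * F) \<le> 1 / real n * (K2 * (1 + \<gamma>\<^sup>2 / (K1 * K2)) * q * (\<nu> * P0))"
      using n by (intro mult_left_mono) auto
    then show "ensemble_flux T \<Omega> u \<eta> n \<psi> \<le> K2 * (1 + \<gamma>\<^sup>2 / (K1 * K2)) * (R / R0)\<^sup>2 * (\<nu> * P0)"
      unfolding ens rq by (simp add: mult_ac)
  qed
qed

end
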